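(* The minimal matching cuts of an $n$-vertex graph $G$ can be enumerated in $2^{\mathcal O(\tau(G))}\cdot n^{\mathcal O(1)}$ time, and the matching cuts, as well as the maximal matching cuts, of $G$ can be enumerated with $2^{\mathcal O(\tau(G))}\cdot n^{\mathcal O(1)}$ delay.
   Context: $\tau(G)$ is the vertex cover number of $G$ (minimum size of a vertex set meeting every edge). A matching cut of $G$ is a (possibly empty) edge set $M$ that is a matching and equals $E(A,B)$ (edges between $A$ and $B$) for some partition $\{A,B\}$ of $V(G)$; minimal/maximal are with respect to inclusion among matching cuts. Enumeration lists each such cut exactly once; delay means the maximum time before the first output, between consecutive outputs, and after the last output. *)

theory Defs
  imports Complex_Main "HOL-Library.Landau_Symbols"
begin

section \<open>Matching cuts\<close>

definition simple_graph :: "'a set \<Rightarrow> 'a set set \<Rightarrow> bool" where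
  "simple_graph V E \<longleftrightarrow> finite V \<and> (\<forall>e\<in>E. e \<subseteq> V \<and> card e = 2)"

definition vertex_cover :: "'a set \<Rightarrow> 'a set set \<Rightarrow> 'a set \<Rightarrow> bool" where
  "vertex_cover V E S \<longleftrightarrow> S \<subseteq> V \<and> (\<forall>e\<in>E. e \<inter> S \<noteq> {})"

definition vertex_cover_number :: "'a set \<Rightarrow> 'a set set \<Rightarrow> nat" where
  "vertex_cover_number V E = (LEAST k. \<exists>S. vertex_cover V E S \<and> card S = k)"

definition edges_between :: "'a set set \<Rightarrow> 'a set \<Rightarrow> 'a set \<Rightarrow> 'a set set" where
  "edges_between E A B = {e \<in> E. \<exists>a\<in>A. \<exists>b\<in>B. e = {a, b}}"

definition matching :: "'a set set \<Rightarrow> 'a set set \<Rightarrow> bool" where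
  "matching E M \<longleftrightarrow> M \<subseteq> E \<and> pairwise disjnt M"

text \<open>Both sides of the partition are nonempty, so the empty edge set is a matching cut
  exactly when the graph is disconnected.\<close>

definition matching_cuts :: "'a set \<Rightarrow> 'a set set \<Rightarrow> 'a set set set" where
  "matching_cuts V E = {M. matching E M \<and>
     (\<exists>A B. A \<noteq> {} \<and> B \<noteq> {} \<and> A \<inter> B = {} \<and> A \<union> B = V \<and> M = edges_between E A B)}"

definition minimal_matching_cuts :: "'a set \<Rightarrow> 'a set set \<Rightarrow> 'a set set set" where
  "minimal_matching_cuts V E =
     {M \<in> matching_cuts V E. \<not> (\<exists>M' \<in> matching_cuts V E. M' \<subset> M)}"

definition maximal_matching_cuts :: "'a set \<Rightarrow> 'a set set \<Rightarrow> 'a set set set" where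
  "maximal_matching_cuts V E =
     {M \<in> matching_cuts V E. \<not> (\<exists>M' \<in> matching_cuts V E. M \<subset> M')}"


section \<open>Model of computation\<close>

text \<open>Jones's WHILE language over binary trees with unit-cost primitives (polynomially
  equivalent to Turing machines), extended by an output instruction. \<open>Leaf\<close> counts as false
  and every other tree as true.\<close>

datatype tree = Leaf | Node (car: tree) (cdr: tree)
where
  "car Leaf = Leaf"
| "cdr Leaf = Leaf"

datatype com =
    SetLeaf nat
  | Copy nat nat
  | SetCar nat nat
  | SetCdr nat nat
  | SetNode nat nat nat
  | Output nat
  | Seq com com
  | IfThen nat com com
  | While nat com

type_synonym store = "nat \<Rightarrow> tree"

text \<open>A trace records one \<open>Tick\<close> per elapsed time unit, and the output events. Since trees may
  share subtrees in memory, writing a tree out is charged its size rather than one unit.\<close>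

datatype event = Tick | Out tree

inductive exec :: "com \<Rightarrow> store \<Rightarrow> event list \<Rightarrow> store \<Rightarrow> bool" where
  SetLeaf: "exec (SetLeaf x) s [Tick] (s(x := Leaf))"
| Copy: "exec (Copy x y) s [Tick] (s(x := s y))"
| SetCar: "exec (SetCar x y) s [Tick] (s(x := car (s y)))"
| SetCdr: "exec (SetCdr x y) s [Tick] (s(x := cdr (s y)))"
| SetNode: "exec (SetNode x y z) s [Tick] (s(x := Node (s y) (s z)))"
| Output: "exec (Output x) s (replicate (Suc (size (s x))) Tick @ [Out (s x)]) s"
| Seq: "exec c s tr s' \<Longrightarrow> exec d s' tr' s'' \<Longrightarrow> exec (Seq c d) s (tr @ tr') s''"
| IfTrue: "s x \<noteq> Leaf \<Longrightarrow> exec c s tr s' \<Longrightarrow> exec (IfThen x c d) s (Tick # tr) s'"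
| IfFalse: "s x = Leaf \<Longrightarrow> exec d s tr s' \<Longrightarrow> exec (IfThen x c d) s (Tick # tr) s'"
| WhileFalse: "s x = Leaf \<Longrightarrow> exec (While x c) s [Tick] s"
| WhileTrue: "s x \<noteq> Leaf \<Longrightarrow> exec c s tr s' \<Longrightarrow> exec (While x c) s' tr' s'' \<Longrightarrow>
    exec (While x c) s (Tick # tr @ tr') s''"

inductive_cases exec_elims:
  "exec (SetLeaf x) s tr s'"
  "exec (Copy x y) s tr s'"
  "exec (SetCar x y) s tr s'"
  "exec (SetCdr x y) s tr s'"
  "exec (SetNode x y z) s tr s'"
  "exec (Output x) s tr s'"
  "exec (Seq c d) s tr s'"
  "exec (IfThen x c d) s tr s'"
  "exec (While x c) s tr s'"

lemma exec_deterministic: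
  "exec c s tr s' \<Longrightarrow> exec c s tr' s'' \<Longrightarrow> tr' = tr \<and> s'' = s'"
proof (induction arbitrary: tr' s'' rule: exec.induct)
  case (Seq c s tr s1 d tr1 s2)
  from Seq.prems obtain u u1 r where "tr' = u @ u1" "exec c s u r" "exec d r u1 s''"
    by (rule exec_elims(7))
  with Seq.IH show ?case by metis
next
  case (IfTrue s x c tr s1 d)
  from IfTrue.prems IfTrue.hyps(1) obtain u where "tr' = Tick # u" "exec c s u s''"
    by - (erule exec_elims(8); simp)
  with IfTrue.IH show ?case by metis
next
  case (IfFalse s x d tr s1 c)
  from IfFalse.prems IfFalse.hyps(1) obtain u where "tr' = Tick # u" "exec d s u s''"
    by - (erule exec_elims(8); simp)
  with IfFalse.IH show ?case by metis
next
  case (WhileFalse s x c)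
  from WhileFalse.prems WhileFalse.hyps show ?case
    by - (erule exec_elims(9); simp)
next
  case (WhileTrue s x c tr1 s1 tr2 s2)
  from WhileTrue.prems WhileTrue.hyps(1) obtain u u1 r
    where "tr' = Tick # u @ u1" "exec c s u r" "exec (While x c) r u1 s''"
    by - (erule exec_elims(9); simp)
  with WhileTrue.IH show ?case by metis
qed (erule exec_elims(1-6), simp)+

text \<open>The program halts on the given input, producing the given trace.\<close>

definition run :: "com \<Rightarrow> tree \<Rightarrow> event list \<Rightarrow> bool" where
  "run p inp tr \<longleftrightarrow> (\<exists>s'. exec p ((\<lambda>_. Leaf)(0 := inp)) tr s')"

fun outputs :: "event list \<Rightarrow> tree list" where
  "outputs [] = []"
| "outputs (Tick # tr) = outputs tr"
| "outputs (Out d # tr) = d # outputs tr"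

text \<open>The times elapsed before the first output, between consecutive outputs, and after the
  last output; a trace with \<open>k\<close> outputs has \<open>k + 1\<close> gaps.\<close>

fun gaps :: "event list \<Rightarrow> nat list" where
  "gaps [] = [0]"
| "gaps (Tick # tr) = Suc (hd (gaps tr)) # tl (gaps tr)"
| "gaps (Out d # tr) = 0 # gaps tr"

definition total_time :: "event list \<Rightarrow> nat" where
  "total_time tr = length (filter (\<lambda>e. e = Tick) tr)"

definition delay :: "event list \<Rightarrow> nat" where
  "delay tr = Max (set (gaps tr))"


section \<open>Enumeration of edge sets\<close>

fun encode_list :: "tree list \<Rightarrow> tree" where
  "encode_list [] = Leaf"
| "encode_list (t # ts) = Node t (encode_list ts)"

definition encode_bool :: "bool \<Rightarrow> tree" where
  "encode_bool b = (if b then Node Leaf Leaf else Leaf)"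

text \<open>The adjacency matrix of an edge set on the vertices \<open>0, \<dots>, n - 1\<close>. It serves both as the
  encoding of the input graph and, for \<open>M \<subseteq> E\<close>, as the encoding of an output \<open>M\<close>.\<close>

definition encode_edges :: "nat \<Rightarrow> nat set set \<Rightarrow> tree" where
  "encode_edges n E =
     encode_list (map (\<lambda>i. encode_list (map (\<lambda>j. encode_bool ({i, j} \<in> E)) [0..<n])) [0..<n])"

definition enumeration_trace :: "com \<Rightarrow> nat \<Rightarrow> nat set set \<Rightarrow> nat set set set \<Rightarrow> event list \<Rightarrow> bool"
where
  "enumeration_trace p n E \<M> tr \<longleftrightarrow>
     run p (encode_edges n E) tr \<and>
     (\<exists>Ms. distinct Ms \<and> set Ms = \<M> \<and> outputs tr = map (encode_edges n) Ms)"

text \<open>A single program enumerates \<open>\<P> V E\<close> for all graphs with cost (total time or delay) at most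
  \<open>2\<^bsup>O(\<tau>)\<^esup> n\<^bsup>O(1)\<^esup>\<close>. The program must also be correct on the graph without vertices, but there the
  bound is void since \<open>n\<^bsup>O(1)\<^esup>\<close> would vanish.\<close>

definition fpt_enumerable ::
  "(event list \<Rightarrow> nat) \<Rightarrow> (nat set \<Rightarrow> nat set set \<Rightarrow> nat set set set) \<Rightarrow> bool"
where
  "fpt_enumerable cost \<P> \<longleftrightarrow>
     (\<exists>p. \<exists>f \<in> O(\<lambda>k :: nat. real k). \<exists>g \<in> O(\<lambda>_ :: nat. 1 :: real).
        \<forall>n E. simple_graph {..<n} E \<longrightarrow>
          (\<exists>tr. enumeration_trace p n E (\<P> {..<n} E) tr \<and>
             (n \<ge> 1 \<longrightarrow>
                real (cost tr) \<le> 2 powr f (vertex_cover_number {..<n} E) * real n powr g n)))"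

end

theory Submission
  imports Defs
begin

text \<open>
  Swapping a pendant edge \<open>{a, u}\<close> of a matching cut for another pendant edge \<open>{a, u'}\<close> at the same
  vertex gives a matching cut again, and this respects inclusion. So it suffices to know the
  canonical matching cuts, which use only the least pendant vertex at each \<open>a\<close>: a matching cut is
  minimal or maximal iff its canonical representative is so among the canonical ones, and the
  matching cuts with a given representative form a product of sets of pendant vertices.

  Let \<open>S\<close> be a vertex cover. A colouring of \<open>S\<close> determines the colour of every other vertex in a
  canonical matching cut, except for one pendant vertex per vertex of \<open>S\<close> and for the vertices with
  differently coloured neighbours; each of the latter uses up the matching edge of some vertex of
  \<open>S\<close>, so there are at most \<open>2 |S|\<close> exceptions and at most \<open>2 ^ (3 |S|)\<close> colourings. The program
  therefore takes a greedy \<open>2\<close>-approximate cover \<open>S\<close>, lists the canonical matching cuts by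
  extending partial colourings vertex by vertex with \<open>S\<close> first (the same count bounds each
  intermediate list), filters them by pairwise comparison, and expands each into its product of
  pendant choices by a depth-first search that meets no dead ends. Finally, a minimal matching cut
  is canonical or a single edge, so there are few of them and small delay gives small total time.
\<close>

section \<open>Polynomial bounds\<close>

text \<open>Why only the delay can be bounded in general: \<open>t\<close> disjoint stars with
  \<open>k \<ge> 2\<close> leaves each have vertex cover number \<open>t\<close>, but at least
  \<open>k ^ t\<close> matching cuts, and no bound \<open>2 ^ O(t)\<close> times a polynomial in
  \<open>n\<close> covers this. Only the canonical cuts are few; they are all listed before the
  first output, a gap in which time exponential in \<tau> is allowed. Why colours outside
  \<open>S\<close> are forced: a vertex with at least two neighbours, all of one colour, cannot take
  the other colour, since all its edges would then be cut. A pendant vertex that is not the least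
  one must agree with its neighbour, because canonical cuts avoid its edge. The obstacle is that the
  bounds concern one concrete program of the WHILE language. The algorithm is therefore written as
  functions on lists, and closure rules supply programs with polynomial bounds for them. The
  depth-first search is the only part that prints, and it is verified separately.\<close>

definition poly_bounded :: "('a \<Rightarrow> nat) \<Rightarrow> ('a \<Rightarrow> nat) \<Rightarrow> bool" where
  "poly_bounded b g \<longleftrightarrow> (\<exists>c. \<forall>x. g x \<le> (b x + 2) ^ c)"

lemma poly_boundedI: "(\<And>x. g x \<le> (b x + 2) ^ c) \<Longrightarrow> poly_bounded b g"
  unfolding poly_bounded_def by blast

text \<open>The summand 2 keeps the base at least 2, so that some power of it dominates a given
  constant even where \<open>b\<close> vanishes.\<close>

lemma le_power_base: "k \<le> (b + 2) ^ k" for b k :: nat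
proof -
  have "k \<le> 2 ^ k" by simp
  also have "\<dots> \<le> (b + 2) ^ k" by (rule power_mono) auto
  finally show ?thesis .
qed

lemma poly_bounded_const: "poly_bounded b (\<lambda>_. k)"
  by (rule poly_boundedI[where c = k]) (rule le_power_base)

lemma poly_bounded_self: "poly_bounded b b"
  by (rule poly_boundedI[where c = 1]) simp

lemma poly_bounded_mono:
  assumes "poly_bounded b h" "\<And>x. g x \<le> h x"
  shows "poly_bounded b g"
  using assms unfolding poly_bounded_def by (meson order_trans)

lemma poly_bounded_mult:
  assumes "poly_bounded b f" "poly_bounded b g"
  shows "poly_bounded b (\<lambda>x. f x * g x)"
proof -
  obtain c d where "\<And>x. f x \<le> (b x + 2) ^ c" "\<And>x. g x \<le> (b x + 2) ^ d"
    using assms unfolding poly_bounded_def by blast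
  then have "f x * g x \<le> (b x + 2) ^ (c + d)" for x
    unfolding power_add by (intro mult_mono) auto
  then show ?thesis by (rule poly_boundedI)
qed

lemma poly_bounded_add:
  assumes "poly_bounded b f" "poly_bounded b g"
  shows "poly_bounded b (\<lambda>x. f x + g x)"
proof -
  obtain c d where cd: "\<And>x. f x \<le> (b x + 2) ^ c" "\<And>x. g x \<le> (b x + 2) ^ d"
    using assms unfolding poly_bounded_def by blast
  have "f x + g x \<le> (b x + 2) ^ (c + d + 1)" for x
  proof -
    let ?X = "b x + 2"
    have "?X ^ c \<le> ?X ^ (c + d)" "?X ^ d \<le> ?X ^ (c + d)"
      by (auto intro!: power_increasing)
    then have "f x + g x \<le> 2 * ?X ^ (c + d)" using cd[of x] by linarith
    also have "\<dots> \<le> ?X * ?X ^ (c + d)" by (rule mult_right_mono) auto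
    finally show ?thesis by simp
  qed
  then show ?thesis by (rule poly_boundedI)
qed

lemma poly_bounded_power:
  assumes "poly_bounded b f"
  shows "poly_bounded b (\<lambda>x. f x ^ k)"
  by (induction k) (auto intro: poly_bounded_const poly_bounded_mult[OF assms])

text \<open>Restates a bound in the size of an intermediate value as a bound for the original
  argument; this is what makes programs compose.\<close>

lemma poly_bounded_comp:
  assumes "poly_bounded b' T" "poly_bounded b (\<lambda>x. b' (f x))"
  shows "poly_bounded b (\<lambda>x. T (f x))"
proof -
  obtain c where "\<And>y. T y \<le> (b' y + 2) ^ c"
    using assms(1) unfolding poly_bounded_def by blast
  then show ?thesis
    by (intro poly_bounded_mono[OF poly_bounded_power[where k = c],
          OF poly_bounded_add[OF assms(2) poly_bounded_const[of _ 2]]])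
qed

lemmas poly_bounded_intros =
  poly_bounded_const poly_bounded_mult poly_bounded_add poly_bounded_power

section \<open>Encodings\<close>

class encodable = fixes enc :: "'a \<Rightarrow> tree"

instantiation bool :: encodable begin
definition enc_bool :: "bool \<Rightarrow> tree" where "enc_bool = encode_bool"
instance ..
end

instantiation unit :: encodable begin
definition enc_unit :: "unit \<Rightarrow> tree" where "enc_unit u = Leaf"
instance ..
end

text \<open>Unary coding is affordable because the numbers are vertices, degrees and lengths of
  lists. It also makes a number a list that a loop can consume.\<close>

instantiation nat :: encodable begin
definition enc_nat :: "nat \<Rightarrow> tree" where "enc_nat n = encode_list (replicate n Leaf)"
instance ..
end

instantiation list :: (encodable) encodable begin
definition enc_list :: "'a list \<Rightarrow> tree" where "enc_list xs = encode_list (map enc xs)"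
instance ..
end

instantiation prod :: (encodable, encodable) encodable begin
definition enc_prod :: "'a \<times> 'b \<Rightarrow> tree" where "enc_prod p = Node (enc (fst p)) (enc (snd p))"
instance ..
end

abbreviation sz :: "'a :: encodable \<Rightarrow> nat" where "sz x \<equiv> size (enc x)"

lemma enc_simps [simp]:
  "enc True = Node Leaf Leaf" "enc False = Leaf" "enc () = Leaf"
  "enc (0 :: nat) = Leaf" "enc (Suc n) = Node Leaf (enc n)"
  "enc ([] :: 'a :: encodable list) = Leaf" "enc (x # xs) = Node (enc x) (enc xs)"
  "enc (a, b) = Node (enc a) (enc b)"
  by (simp_all add: enc_bool_def encode_bool_def enc_unit_def enc_nat_def enc_list_def enc_prod_def)

lemma enc_nil_iff [simp]: "enc xs = Leaf \<longleftrightarrow> xs = []" "Leaf = enc xs \<longleftrightarrow> xs = []"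
  by (cases xs; simp)+

lemma enc_bool_iff [simp]: "enc (b :: bool) = Leaf \<longleftrightarrow> \<not> b"
  by (cases b) auto

lemma enc_zero_iff [simp]: "enc (n :: nat) = Leaf \<longleftrightarrow> n = 0"
  by (cases n) auto

lemma enc_replicate_unit: "enc (replicate n ()) = enc n"
  by (induction n) auto

lemma sz_nat [simp]: "sz (n :: nat) = n"
  by (induction n) auto

lemma sz_bool_le: "sz (b :: bool) \<le> 1"
  by (cases b) auto

lemma sz_list: "sz xs = (\<Sum>x\<leftarrow>xs. sz x + 1)"
  by (induction xs) auto

lemma sz_append [simp]: "sz (xs @ ys) = sz xs + sz ys"
  by (simp add: sz_list)

lemma sz_rev [simp]: "sz (rev xs) = sz xs"
  by (simp add: sz_list rev_map[symmetric])

lemma length_le_sz: "length xs \<le> sz xs"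
  by (induction xs) auto

lemma sz_member: "x \<in> set xs \<Longrightarrow> sz x < sz xs"
  by (induction xs) auto

lemma sz_list_le:
  assumes "\<And>x. x \<in> set xs \<Longrightarrow> sz x \<le> B"
  shows "sz xs \<le> length xs * (B + 1)"
  using assms
proof (induction xs)
  case (Cons a xs)
  have "sz a \<le> B" using Cons.prems by simp
  moreover have "sz xs \<le> length xs * (B + 1)" using Cons by simp
  ultimately show ?case by simp
qed simp

section \<open>Timed execution\<close>

text \<open>Silent execution: a trace without outputs is determined by its length, so the trace is
  replaced by a number.\<close>

definition texec :: "com \<Rightarrow> store \<Rightarrow> nat \<Rightarrow> store \<Rightarrow> bool" where
  "texec c s t s' \<longleftrightarrow> exec c s (replicate t Tick) s'"

lemma texec_basic:
  "texec (SetLeaf r) s 1 (s(r := Leaf))"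
  "texec (Copy r q) s 1 (s(r := s q))"
  "texec (SetCar r q) s 1 (s(r := car (s q)))"
  "texec (SetCdr r q) s 1 (s(r := cdr (s q)))"
  "texec (SetNode r q u) s 1 (s(r := Node (s q) (s u)))"
  by (simp_all add: texec_def exec.intros)

lemma texec_Seq: "texec c s t s' \<Longrightarrow> texec d s' u s'' \<Longrightarrow> texec (Seq c d) s (t + u) s''"
  unfolding texec_def replicate_add by (rule exec.Seq)

lemma texec_IfTrue: "s r \<noteq> Leaf \<Longrightarrow> texec c s t s' \<Longrightarrow> texec (IfThen r c d) s (Suc t) s'"
  unfolding texec_def by (simp add: exec.IfTrue)

lemma texec_IfFalse: "s r = Leaf \<Longrightarrow> texec d s t s' \<Longrightarrow> texec (IfThen r c d) s (Suc t) s'"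
  unfolding texec_def by (simp add: exec.IfFalse)

lemma texec_WhileFalse: "s r = Leaf \<Longrightarrow> texec (While r c) s 1 s"
  unfolding texec_def by (simp add: exec.WhileFalse)

lemma texec_WhileTrue:
  "s r \<noteq> Leaf \<Longrightarrow> texec c s t s' \<Longrightarrow> texec (While r c) s' u s'' \<Longrightarrow>
    texec (While r c) s (Suc (t + u)) s''"
  unfolding texec_def replicate_Suc replicate_add by (rule exec.WhileTrue)

section \<open>Functions computable within a polynomial of a given bound\<close>

text \<open>Argument and result are passed in register \<open>0\<close>, and every register from \<open>m\<close> on is
  preserved. So a caller can save its own data above \<open>m\<close>, and programs compose without
  renaming of registers.\<close>

definition implements :: "com \<Rightarrow> nat \<Rightarrow> ('a :: encodable \<Rightarrow> nat) \<Rightarrow> ('a \<Rightarrow> 'b :: encodable) \<Rightarrow> bool" where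
  "implements p m T f \<longleftrightarrow> (\<forall>x s. s 0 = enc x \<longrightarrow>
     (\<exists>t s'. texec p s t s' \<and> t \<le> T x \<and> s' 0 = enc (f x) \<and> (\<forall>r\<ge>m. s' r = s r)))"

text \<open>The size of the result is bounded separately from the time, since
  \<open>SetNode x x x\<close> doubles a tree in one step and a short run can thus produce a value
  of exponential size. The bound \<open>b\<close> is a parameter because the search for colourings
  is polynomial only relative to a bound other than the size of the input.\<close>

definition computable :: "('a :: encodable \<Rightarrow> nat) \<Rightarrow> ('a \<Rightarrow> 'b :: encodable) \<Rightarrow> bool" where
  "computable b f \<longleftrightarrow> poly_bounded b (\<lambda>x. sz (f x)) \<and>
     (\<exists>p m T. m \<ge> 1 \<and> poly_bounded b T \<and> implements p m T f)"

abbreviation FP :: "('a :: encodable \<Rightarrow> 'b :: encodable) \<Rightarrow> bool" where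
  "FP f \<equiv> computable sz f"

lemma implementsE:
  assumes "implements p m T f" "s 0 = enc x"
  obtains t s' where "texec p s t s'" "t \<le> T x" "s' 0 = enc (f x)" "\<forall>r\<ge>m. s' r = s r"
  using assms unfolding implements_def by blast

lemma computable_sz: "computable b f \<Longrightarrow> poly_bounded b (\<lambda>x. sz (f x))"
  unfolding computable_def by blast

lemma computableE:
  assumes "computable b f"
  obtains p m T where "m \<ge> 1" "poly_bounded b T" "implements p m T f"
  using assms unfolding computable_def by blast

text \<open>A program sees codes only. Functions that differ merely in the type of their values,
  such as pairing and \<open>Cons\<close>, share a program.\<close>

lemma computable_cong_enc:
  assumes "computable b g" "\<And>x. enc (f x) = enc (g x)"
  shows "computable b f"
  using assms unfolding computable_def implements_def by simp

section \<open>Composition, pairing, branching and constants\<close>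

lemma computable_basic:
  assumes "\<And>s x. s 0 = enc x \<Longrightarrow> \<exists>s'. texec p s 1 s' \<and> s' 0 = enc (f x) \<and> (\<forall>r\<ge>1. s' r = s r)"
    and "poly_bounded b (\<lambda>x. sz (f x))"
  shows "computable b f"
proof -
  have "implements p 1 (\<lambda>_. 1) f"
    unfolding implements_def using assms(1) by (metis order_refl)
  then show ?thesis
    unfolding computable_def using assms(2) poly_bounded_const[of b 1] by blast
qed

lemma computable_id:
  assumes "poly_bounded b sz"
  shows "computable b (\<lambda>x. x)"
proof (rule computable_basic[where p = "Copy 0 0"])
  fix s :: store and x :: 'a assume "s 0 = enc x"
  then show "\<exists>s'. texec (Copy 0 0) s 1 s' \<and> s' 0 = enc x \<and> (\<forall>r\<ge>1. s' r = s r)"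
    using texec_basic(2)[of 0 0 s] by auto
qed (rule assms)

lemma computable_comp:
  fixes f :: "'a :: encodable \<Rightarrow> 'b :: encodable" and g :: "'b \<Rightarrow> 'c :: encodable"
  assumes g: "FP g" and f: "computable b f"
  shows "computable b (\<lambda>x. g (f x))"
proof -
  obtain p m T where p: "m \<ge> 1" "poly_bounded b T" "implements p m T f"
    using f by (rule computableE)
  obtain q n U where q: "n \<ge> 1" "poly_bounded sz U" "implements q n U g"
    using g by (rule computableE)
  have "implements (Seq p q) (max m n) (\<lambda>x. T x + U (f x)) (\<lambda>x. g (f x))"
    unfolding implements_def
  proof (intro allI impI)
    fix x :: 'a and s :: store assume "s 0 = enc x"
    with p(3) obtain t s' where 1: "texec p s t s'" "t \<le> T x" "s' 0 = enc (f x)"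
      "\<forall>r\<ge>m. s' r = s r" by (rule implementsE)
    from q(3) 1(3) obtain u s'' where 2: "texec q s' u s''" "u \<le> U (f x)" "s'' 0 = enc (g (f x))"
      "\<forall>r\<ge>n. s'' r = s' r" by (rule implementsE)
    show "\<exists>t s'. texec (Seq p q) s t s' \<and> t \<le> T x + U (f x) \<and> s' 0 = enc (g (f x)) \<and>
            (\<forall>r\<ge>max m n. s' r = s r)"
      using texec_Seq[OF 1(1) 2(1)] 1 2 by (intro exI[of _ "t + u"] exI[of _ s'']) auto
  qed
  moreover have "poly_bounded b (\<lambda>x. T x + U (f x))"
    by (intro poly_bounded_add p(2) poly_bounded_comp[OF q(2)] computable_sz f)
  moreover have "poly_bounded b (\<lambda>x. sz (g (f x)))"
    by (rule poly_bounded_comp[OF computable_sz[OF g] computable_sz[OF f]])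
  moreover have "max m n \<ge> 1" using p(1) by auto
  ultimately show ?thesis unfolding computable_def by blast
qed

lemma computable_pair:
  fixes f :: "'a :: encodable \<Rightarrow> 'b :: encodable" and g :: "'a \<Rightarrow> 'c :: encodable"
  assumes f: "computable b f" and g: "computable b g"
  shows "computable b (\<lambda>x. (f x, g x))"
proof -
  obtain p m T where p: "m \<ge> 1" "poly_bounded b T" "implements p m T f"
    using f by (rule computableE)
  obtain q n U where q: "n \<ge> 1" "poly_bounded b U" "implements q n U g"
    using g by (rule computableE)
  define k where "k = max m n"
  have k: "k \<ge> 1" "m \<le> k" "n \<le> k" using p(1) by (auto simp: k_def)
  \<comment> \<open>Register \<open>k\<close> keeps the argument and \<open>k + 1\<close> the first
    result; both lie above the registers that \<open>p\<close> and \<open>q\<close> may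
    change.\<close>
  let ?c = "Seq (Copy k 0) (Seq p (Seq (Copy (k + 1) 0) (Seq (Copy 0 k) (Seq q
    (SetNode 0 (k + 1) 0)))))"
  have "implements ?c (k + 2) (\<lambda>x. T x + U x + 4) (\<lambda>x. (f x, g x))"
    unfolding implements_def
  proof (intro allI impI)
    fix x :: 'a and s :: store assume s: "s 0 = enc x"
    define s1 where "s1 = s(k := s 0)"
    have "s1 0 = enc x" using s k by (simp add: s1_def)
    with p(3) obtain t s2 where 1: "texec p s1 t s2" "t \<le> T x" "s2 0 = enc (f x)"
      "\<forall>r\<ge>m. s2 r = s1 r" by (rule implementsE)
    define s3 where "s3 = s2(k + 1 := s2 0)"
    define s4 where "s4 = s3(0 := s3 k)"
    have "s4 0 = enc x" using s k 1(4) by (simp add: s4_def s3_def s1_def)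
    with q(3) obtain u s5 where 2: "texec q s4 u s5" "u \<le> U x" "s5 0 = enc (g x)"
      "\<forall>r\<ge>n. s5 r = s4 r" by (rule implementsE)
    define s6 where "s6 = s5(0 := Node (s5 (k + 1)) (s5 0))"
    have "texec ?c s (1 + (t + (1 + (1 + (u + 1))))) s6"
      using 1(1) 2(1) unfolding s1_def s3_def s4_def s6_def by (intro texec_Seq) (assumption | rule texec_basic)+
    moreover have "s6 0 = enc (f x, g x)"
      using 1(3) 2(3) 2(4) k by (simp add: s6_def s4_def s3_def)
    moreover have "\<forall>r\<ge>k + 2. s6 r = s r"
      using 1(4) 2(4) k by (auto simp: s6_def s4_def s3_def s1_def)
    ultimately show "\<exists>t s'. texec ?c s t s' \<and> t \<le> T x + U x + 4 \<and> s' 0 = enc (f x, g x) \<and>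
            (\<forall>r\<ge>k + 2. s' r = s r)"
      using 1(2) 2(2) by (intro exI[of _ "1 + (t + (1 + (1 + (u + 1))))"] exI[of _ s6]) auto
  qed
  moreover have "poly_bounded b (\<lambda>x. T x + U x + 4)"
    by (intro poly_bounded_intros p(2) q(2))
  moreover have "poly_bounded b (\<lambda>x. sz (f x, g x))"
    using poly_bounded_add[OF poly_bounded_add[OF computable_sz[OF f] computable_sz[OF g]]
        poly_bounded_const[of b 1]] by simp
  ultimately show ?thesis unfolding computable_def
    by (intro conjI exI[of _ ?c] exI[of _ "k + 2"] exI[of _ "\<lambda>x. T x + U x + 4"]) auto
qed

lemma computable_if:
  fixes f g :: "'a :: encodable \<Rightarrow> 'b :: encodable"
  assumes c: "computable b c" and f: "computable b f" and g: "computable b g" and b: "poly_bounded b sz"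
  shows "computable b (\<lambda>x. if c x then f x else g x)"
proof -
  obtain r l V where r: "l \<ge> 1" "poly_bounded b V" "implements r l V c"
    using c by (rule computableE)
  obtain p m T where p: "m \<ge> 1" "poly_bounded b T" "implements p m T f"
    using f by (rule computableE)
  obtain q n U where q: "n \<ge> 1" "poly_bounded b U" "implements q n U g"
    using g by (rule computableE)
  define k where "k = max l (max m n)"
  have k: "k \<ge> 1" "l \<le> k" "m \<le> k" "n \<le> k" using p(1) by (auto simp: k_def)
  let ?h = "\<lambda>x. if c x then f x else g x"
  let ?c = "Seq (Copy k 0) (Seq r (Seq (Copy (k + 1) 0) (Seq (Copy 0 k) (IfThen (k + 1) p q))))"
  let ?T = "\<lambda>x. V x + T x + U x + 4"
  have "implements ?c (k + 2) ?T ?h"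
    unfolding implements_def
  proof (intro allI impI)
    fix x :: 'a and s :: store assume s: "s 0 = enc x"
    define s1 where "s1 = s(k := s 0)"
    have "s1 0 = enc x" using s k by (simp add: s1_def)
    with r(3) obtain t s2 where 1: "texec r s1 t s2" "t \<le> V x" "s2 0 = enc (c x)"
      "\<forall>r\<ge>l. s2 r = s1 r" by (rule implementsE)
    define s3 where "s3 = s2(k + 1 := s2 0)"
    define s4 where "s4 = s3(0 := s3 k)"
    have s4: "s4 0 = enc x" "s4 (k + 1) = enc (c x)"
      using s k 1(3) 1(4) by (simp_all add: s4_def s3_def s1_def)
    obtain u s5 where 2: "texec (IfThen (k + 1) p q) s4 (Suc u) s5" "u \<le> T x + U x"
      "s5 0 = enc (?h x)" "\<forall>r\<ge>k. s5 r = s4 r"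
    proof (cases "c x")
      case True
      obtain u s5 where "texec p s4 u s5" "u \<le> T x" "s5 0 = enc (f x)"
        "\<forall>r\<ge>m. s5 r = s4 r" using p(3) s4(1) by (rule implementsE)
      then show thesis using True s4(2) k by (intro that[of u s5] texec_IfTrue) auto
    next
      case False
      obtain u s5 where "texec q s4 u s5" "u \<le> U x" "s5 0 = enc (g x)"
        "\<forall>r\<ge>n. s5 r = s4 r" using q(3) s4(1) by (rule implementsE)
      then show thesis using False s4(2) k by (intro that[of u s5] texec_IfFalse) auto
    qed
    have "texec ?c s (1 + (t + (1 + (1 + Suc u)))) s5"
      using 1(1) 2(1) unfolding s1_def s3_def s4_def by (intro texec_Seq) (assumption | rule texec_basic)+
    moreover have "\<forall>r\<ge>k + 2. s5 r = s r"
      using 1(4) 2(4) k by (auto simp: s4_def s3_def s1_def)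
    ultimately show "\<exists>t s'. texec ?c s t s' \<and> t \<le> ?T x \<and> s' 0 = enc (?h x) \<and>
            (\<forall>r\<ge>k + 2. s' r = s r)"
      using 1(2) 2(2,3) by (intro exI[of _ "1 + (t + (1 + (1 + Suc u)))"] exI[of _ s5]) auto
  qed
  moreover have "poly_bounded b ?T"
    by (intro poly_bounded_intros p(2) q(2) r(2))
  moreover have "poly_bounded b (\<lambda>x. sz (?h x))"
    by (rule poly_bounded_mono[OF poly_bounded_add[OF computable_sz[OF f] computable_sz[OF g]]]) auto
  ultimately show ?thesis unfolding computable_def
    by (intro conjI exI[of _ ?c] exI[of _ "k + 2"] exI[of _ ?T]) auto
qed

lemma computable_const: "computable b (\<lambda>_. k)"
proof -
  \<comment> \<open>The constant is wired into the program. The induction runs over arbitrary trees,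
    since a subtree of a code need not be a code of the same type, and \<open>t\<close> is chosen
    before the store so that one number serves all arguments.\<close>
  have "\<exists>p m t. m \<ge> 1 \<and> (\<forall>s. \<exists>s'. texec p s t s' \<and> s' 0 = d \<and> (\<forall>r\<ge>m. s' r = s r))" for d
  proof (induction d)
    case Leaf
    have "texec (SetLeaf 0) s 1 (s(0 := Leaf))" for s by (rule texec_basic)
    then show ?case by (intro exI[of _ "SetLeaf 0"] exI[of _ 1] exI[of _ 1]) fastforce
  next
    case (Node d e)
    obtain p m t where p: "m \<ge> 1" "\<And>s. \<exists>s'. texec p s t s' \<and> s' 0 = d \<and> (\<forall>r\<ge>m. s' r = s r)"
      using Node.IH(1) by blast
    obtain q n u where q: "n \<ge> 1" "\<And>s. \<exists>s'. texec q s u s' \<and> s' 0 = e \<and> (\<forall>r\<ge>n. s' r = s r)"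
      using Node.IH(2) by blast
    let ?c = "Seq p (Seq (Copy (m + n) 0) (Seq q (SetNode 0 (m + n) 0)))"
    have "\<exists>s'. texec ?c s (t + (1 + (u + 1))) s' \<and> s' 0 = Node d e \<and> (\<forall>r\<ge>m + n + 1. s' r = s r)" for s
    proof -
      obtain s1 where 1: "texec p s t s1" "s1 0 = d" "\<forall>r\<ge>m. s1 r = s r" using p(2) by blast
      define s2 where "s2 = s1(m + n := s1 0)"
      obtain s3 where 3: "texec q s2 u s3" "s3 0 = e" "\<forall>r\<ge>n. s3 r = s2 r" using q(2) by blast
      have "texec ?c s (t + (1 + (u + 1))) (s3(0 := Node (s3 (m + n)) (s3 0)))"
        using 1(1) 3(1) unfolding s2_def by (intro texec_Seq) (assumption | rule texec_basic)+
      then show ?thesis using 1 3 p(1) q(1)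
        by (intro exI[of _ "s3(0 := Node (s3 (m + n)) (s3 0))"]) (auto simp: s2_def)
    qed
    then show ?case
      by (intro exI[of _ ?c] exI[of _ "m + n + 1"] exI[of _ "t + (1 + (u + 1))"]) auto
  qed
  then obtain p m t where p: "m \<ge> 1"
    "\<And>s. \<exists>s'. texec p s t s' \<and> s' 0 = enc k \<and> (\<forall>r\<ge>m. s' r = s r)" by meson
  then have "implements p m (\<lambda>_. t) (\<lambda>_. k)" unfolding implements_def by blast
  then show ?thesis unfolding computable_def using p(1) by (auto intro!: poly_bounded_const)
qed

section \<open>Bounded loops\<close>

lemma texec_fold_loop:
  fixes h :: "'e :: encodable \<Rightarrow> 'a :: encodable \<Rightarrow> 'c :: encodable \<Rightarrow> 'c"
  assumes p: "implements p m T (\<lambda>z. h (fst z) (fst (snd z)) (snd (snd z)))" "m \<ge> 1"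
    and s: "s M = enc x" "s (M + 1) = enc xs" "s (M + 2) = enc acc"
    and M: "m \<le> M"
    and B: "\<And>k. k < length xs \<Longrightarrow> T (x, xs ! k, fold (h x) (take k xs) acc) \<le> B"
  shows "\<exists>t s'. texec (While (M + 1) (Seq (SetCar 0 (M + 1)) (Seq (SetNode 0 0 (M + 2))
      (Seq (SetNode 0 M 0) (Seq p (Seq (Copy (M + 2) 0) (SetCdr (M + 1) (M + 1)))))))) s t s' \<and>
      t \<le> 1 + length xs * (6 + B) \<and> s' (M + 2) = enc (fold (h x) xs acc) \<and>
      (\<forall>r\<ge>M + 3. s' r = s r)"
    (is "\<exists>t s'. texec (While _ ?body) s t s' \<and> _")
  using s B
proof (induction xs arbitrary: s acc)
  case Nil
  then have "texec (While (M + 1) ?body) s 1 s" by (intro texec_WhileFalse) auto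
  then show ?case using Nil by (intro exI[of _ 1] exI[of _ s]) auto
next
  case (Cons a xs)
  define s1 where "s1 = s(0 := car (s (M + 1)))"
  define s2 where "s2 = s1(0 := Node (s1 0) (s1 (M + 2)))"
  define s3 where "s3 = s2(0 := Node (s2 M) (s2 0))"
  have M1: "M \<ge> 1" using p(2) M by simp
  have "s3 0 = enc (x, a, acc)" using Cons.prems M1 by (simp add: s3_def s2_def s1_def)
  with p(1) obtain t s4 where 1: "texec p s3 t s4" "t \<le> T (x, a, acc)"
    "s4 0 = enc (h (fst (x, a, acc)) (fst (snd (x, a, acc))) (snd (snd (x, a, acc))))"
    "\<forall>r\<ge>m. s4 r = s3 r" by (rule implementsE)
  define s5 where "s5 = s4(M + 2 := s4 0)"
  define s6 where "s6 = s5(M + 1 := cdr (s5 (M + 1)))"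
  have body: "texec ?body s (1 + (1 + (1 + (t + (1 + 1))))) s6"
    using 1(1) unfolding s1_def s2_def s3_def s5_def s6_def
    by (intro texec_Seq) (assumption | rule texec_basic)+
  have s6: "s6 M = enc x" "s6 (M + 1) = enc xs" "s6 (M + 2) = enc (h x a acc)"
    "\<forall>r\<ge>M + 3. s6 r = s r"
    using 1(3,4) Cons.prems M M1 by (auto simp: s6_def s5_def s3_def s2_def s1_def)
  have B: "T (x, xs ! k, fold (h x) (take k xs) (h x a acc)) \<le> B" if "k < length xs" for k
    using Cons.prems(4)[of "Suc k"] that by simp
  obtain u s7 where 2: "texec (While (M + 1) ?body) s6 u s7" "u \<le> 1 + length xs * (6 + B)"
    "s7 (M + 2) = enc (fold (h x) xs (h x a acc))" "\<forall>r\<ge>M + 3. s7 r = s6 r"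
    using Cons.IH[OF s6(1-3) B] by blast
  \<comment> \<open>One round consists of the loop test, five assignments and the call of
    \<open>p\<close>; this gives \<open>6 + B\<close> per element. The remaining 1 is the failing
    test at the end.\<close>
  have "texec (While (M + 1) ?body) s (Suc ((1 + (1 + (1 + (t + (1 + 1))))) + u)) s7"
    by (rule texec_WhileTrue[OF _ body 2(1)]) (use Cons.prems(2) in simp)
  moreover have "t \<le> B" using 1(2) Cons.prems(4)[of 0] by simp
  ultimately show ?case using 2 s6(4)
    by (intro exI[of _ "Suc ((1 + (1 + (1 + (t + (1 + 1))))) + u)"] exI[of _ s7]) auto
qed

lemma computable_fold:
  fixes h :: "'e :: encodable \<Rightarrow> 'a :: encodable \<Rightarrow> 'c :: encodable \<Rightarrow> 'c"
  assumes h: "FP (\<lambda>z. h (fst z) (fst (snd z)) (snd (snd z)))"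
    and l: "computable b l" and i: "computable b i" and b: "poly_bounded b sz"
    and S: "poly_bounded b S"
      "\<And>x k. k \<le> length (l x) \<Longrightarrow> sz (fold (h x) (take k (l x)) (i x)) \<le> S x"
  shows "computable b (\<lambda>x. fold (h x) (l x) (i x))"
proof -
  obtain p m T where p: "m \<ge> 1" "poly_bounded sz T"
    "implements p m T (\<lambda>z. h (fst z) (fst (snd z)) (snd (snd z)))"
    using h by (rule computableE)
  obtain pl ml Tl where pl: "ml \<ge> 1" "poly_bounded b Tl" "implements pl ml Tl l"
    using l by (rule computableE)
  obtain pi mi Ti where pi: "mi \<ge> 1" "poly_bounded b Ti" "implements pi mi Ti i"
    using i by (rule computableE)
  obtain c where c: "\<And>z. T z \<le> (sz z + 2) ^ c"
    using p(2) unfolding poly_bounded_def by blast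
  \<comment> \<open>The first 2 counts the two nodes that build the triple; the second belongs to
    the base in \<open>poly_bounded\<close>.\<close>
  define B where "B x = (sz x + sz (l x) + S x + 2 + 2) ^ c" for x
  have TB: "T (x, l x ! k, fold (h x) (take k (l x)) (i x)) \<le> B x" if "k < length (l x)" for x k
  proof -
    have "T (x, l x ! k, fold (h x) (take k (l x)) (i x))
        \<le> (sz (x, l x ! k, fold (h x) (take k (l x)) (i x)) + 2) ^ c" by (rule c)
    also have "\<dots> \<le> B x"
      unfolding B_def using sz_member[OF nth_mem[OF that]] S(2)[of k x] that
      by (intro power_mono) auto
    finally show ?thesis .
  qed
  define M where "M = max m (max ml mi)"
  have M: "M \<ge> 1" "m \<le> M" "ml \<le> M" "mi \<le> M" using p(1) by (auto simp: M_def)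
  define loop where "loop = While (M + 1) (Seq (SetCar 0 (M + 1)) (Seq (SetNode 0 0 (M + 2))
      (Seq (SetNode 0 M 0) (Seq p (Seq (Copy (M + 2) 0) (SetCdr (M + 1) (M + 1)))))))"
  let ?c = "Seq (Copy M 0) (Seq pl (Seq (Copy (M + 1) 0) (Seq (Copy 0 M) (Seq pi
    (Seq (Copy (M + 2) 0) (Seq loop (Copy 0 (M + 2))))))))"
  let ?T = "\<lambda>x. Tl x + Ti x + sz (l x) * (6 + B x) + 6"
  let ?f = "\<lambda>x. fold (h x) (l x) (i x)"
  have "implements ?c (M + 3) ?T ?f"
    unfolding implements_def
  proof (intro allI impI)
    fix x :: 'e and s :: store assume s: "s 0 = enc x"
    define s1 where "s1 = s(M := s 0)"
    have "s1 0 = enc x" using s M by (simp add: s1_def)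
    with pl(3) obtain t s2 where 1: "texec pl s1 t s2" "t \<le> Tl x" "s2 0 = enc (l x)"
      "\<forall>r\<ge>ml. s2 r = s1 r" by (rule implementsE)
    define s3 where "s3 = s2(M + 1 := s2 0)"
    define s4 where "s4 = s3(0 := s3 M)"
    have "s4 0 = enc x" using s M 1(4) by (simp add: s4_def s3_def s1_def)
    with pi(3) obtain u s5 where 2: "texec pi s4 u s5" "u \<le> Ti x" "s5 0 = enc (i x)"
      "\<forall>r\<ge>mi. s5 r = s4 r" by (rule implementsE)
    define s6 where "s6 = s5(M + 2 := s5 0)"
    have s6: "s6 M = enc x" "s6 (M + 1) = enc (l x)" "s6 (M + 2) = enc (i x)"
      using s M 1(3,4) 2(3,4) by (simp_all add: s6_def s4_def s3_def s1_def)
    obtain v s7 where 3: "texec loop s6 v s7" "v \<le> 1 + length (l x) * (6 + B x)"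
      "s7 (M + 2) = enc (?f x)" "\<forall>r\<ge>M + 3. s7 r = s6 r"
      using texec_fold_loop[where h = h, OF p(3,1) s6 M(2) TB] unfolding loop_def by blast
    define s8 where "s8 = s7(0 := s7 (M + 2))"
    have "texec ?c s (1 + (t + (1 + (1 + (u + (1 + (v + 1))))))) s8"
      using 1(1) 2(1) 3(1) unfolding s1_def s3_def s4_def s6_def s8_def
      by (intro texec_Seq) (assumption | rule texec_basic)+
    moreover have "s8 0 = enc (?f x)" using 3(3) by (simp add: s8_def)
    moreover have "\<forall>r\<ge>M + 3. s8 r = s r"
      using 1(4) 2(4) 3(4) M by (auto simp: s8_def s6_def s4_def s3_def s1_def)
    moreover have "1 + (t + (1 + (1 + (u + (1 + (v + 1)))))) \<le> ?T x"
    proof -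
      have "length (l x) * (6 + B x) \<le> sz (l x) * (6 + B x)"
        by (rule mult_right_mono[OF length_le_sz]) simp
      then show ?thesis using 1(2) 2(2) 3(2) by linarith
    qed
    ultimately show "\<exists>t s'. texec ?c s t s' \<and> t \<le> ?T x \<and> s' 0 = enc (?f x) \<and>
            (\<forall>r\<ge>M + 3. s' r = s r)" by blast
  qed
  moreover have "poly_bounded b B" unfolding B_def
    by (intro poly_bounded_intros b S(1) computable_sz l)
  then have "poly_bounded b ?T"
    by (intro poly_bounded_intros pl(2) pi(2) computable_sz l)
  moreover have "poly_bounded b (\<lambda>x. sz (?f x))"
  proof (rule poly_bounded_mono[OF S(1)])
    fix x show "sz (?f x) \<le> S x" using S(2)[of "length (l x)" x] by simp
  qed
  ultimately show ?thesis unfolding computable_def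
    by (intro conjI exI[of _ ?c] exI[of _ "M + 3"] exI[of _ ?T]) auto
qed

text \<open>If the increase per step is bounded independently of the accumulator, the sizes of the
  accumulators add up to a polynomial.\<close>

lemma FP_fold_add:
  fixes h :: "'e :: encodable \<Rightarrow> 'a :: encodable \<Rightarrow> 'c :: encodable \<Rightarrow> 'c"
  assumes h: "FP (\<lambda>z. h (fst z) (fst (snd z)) (snd (snd z)))"
    and l: "FP l" and i: "FP i"
    and d: "poly_bounded sz d" "\<And>x a acc. a \<in> set (l x) \<Longrightarrow> sz (h x a acc) \<le> sz acc + d x"
  shows "FP (\<lambda>x. fold (h x) (l x) (i x))"
proof (rule computable_fold[OF h l i poly_bounded_self])
  show "poly_bounded sz (\<lambda>x. sz (i x) + sz (l x) * d x)"
    by (intro poly_bounded_intros computable_sz l i d(1))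
  have bound: "sz (fold (h x) xs acc) \<le> sz acc + length xs * d x" if "set xs \<subseteq> set (l x)" for x xs acc
    using that
  proof (induction xs arbitrary: acc)
    case (Cons a xs)
    have "sz (fold (h x) xs (h x a acc)) \<le> sz (h x a acc) + length xs * d x"
      using Cons by simp
    moreover have "sz (h x a acc) \<le> sz acc + d x" using d(2) Cons.prems by simp
    ultimately show ?case by simp
  qed simp
  fix x k assume "k \<le> length (l x)"
  have "sz (fold (h x) (take k (l x)) (i x)) \<le> sz (i x) + length (take k (l x)) * d x"
    by (rule bound) (rule set_take_subset)
  also have "\<dots> \<le> sz (i x) + sz (l x) * d x"
    using length_le_sz[of "l x"] by (intro add_left_mono mult_right_mono) auto
  finally show "sz (fold (h x) (take k (l x)) (i x)) \<le> sz (i x) + sz (l x) * d x" .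
qed

section \<open>Polynomial-time functions\<close>

named_theorems FP_intros

lemma FP_id [FP_intros]: "FP (\<lambda>x. x)"
  by (rule computable_id[OF poly_bounded_self])

lemma FP_const [FP_intros]: "FP (\<lambda>_. k)"
  by (rule computable_const)

lemma FP_pair [FP_intros]: "FP f \<Longrightarrow> FP g \<Longrightarrow> FP (\<lambda>x. (f x, g x))"
  by (rule computable_pair)

lemma FP_if [FP_intros]: "FP c \<Longrightarrow> FP f \<Longrightarrow> FP g \<Longrightarrow> FP (\<lambda>x. if c x then f x else g x)"
  by (rule computable_if[OF _ _ _ poly_bounded_self])

lemma computable_comp2:
  "FP (\<lambda>p. c (fst p) (snd p)) \<Longrightarrow> computable b f \<Longrightarrow> computable b g \<Longrightarrow>
    computable b (\<lambda>x. c (f x) (g x))"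
  using computable_comp[OF _ computable_pair, of "\<lambda>p. c (fst p) (snd p)"] by simp

lemma FP_car: "(\<And>x. enc (f x) = car (enc x)) \<Longrightarrow> FP f"
  for f :: "'a :: encodable \<Rightarrow> 'b :: encodable"
proof (rule computable_basic[where p = "SetCar 0 0"])
  assume f: "\<And>x. enc (f x) = car (enc x)"
  show "\<exists>s'. texec (SetCar 0 0) s 1 s' \<and> s' 0 = enc (f x) \<and> (\<forall>r\<ge>1. s' r = s r)"
    if "s 0 = enc x" for s :: store and x
    using texec_basic(3)[of 0 0 s] that f by (intro exI[of _ "s(0 := car (s 0))"]) auto
  have "size (car t) \<le> size t" for t by (cases t) auto
  then show "poly_bounded sz (\<lambda>x. sz (f x))"
    by (intro poly_bounded_mono[OF poly_bounded_self]) (simp add: f)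
qed

lemma FP_cdr: "(\<And>x. enc (f x) = cdr (enc x)) \<Longrightarrow> FP f"
  for f :: "'a :: encodable \<Rightarrow> 'b :: encodable"
proof (rule computable_basic[where p = "SetCdr 0 0"])
  assume f: "\<And>x. enc (f x) = cdr (enc x)"
  show "\<exists>s'. texec (SetCdr 0 0) s 1 s' \<and> s' 0 = enc (f x) \<and> (\<forall>r\<ge>1. s' r = s r)"
    if "s 0 = enc x" for s :: store and x
    using texec_basic(4)[of 0 0 s] that f by (intro exI[of _ "s(0 := cdr (s 0))"]) auto
  have "size (cdr t) \<le> size t" for t by (cases t) auto
  then show "poly_bounded sz (\<lambda>x. sz (f x))"
    by (intro poly_bounded_mono[OF poly_bounded_self]) (simp add: f)
qed

lemma FP_is_Leaf: "(\<And>x. f x \<longleftrightarrow> enc x = Leaf) \<Longrightarrow> FP f"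
  for f :: "'a :: encodable \<Rightarrow> bool"
proof -
  assume f: "\<And>x. f x \<longleftrightarrow> enc x = Leaf"
  \<comment> \<open>In the else branch register 0 holds \<open>Leaf\<close>, so
    \<open>SetNode 0 0 0\<close> builds \<open>Node Leaf Leaf\<close>, the code of
    \<open>True\<close>.\<close>
  let ?p = "IfThen 0 (SetLeaf 0) (SetNode 0 0 0)"
  have "implements ?p 1 (\<lambda>_. 2) f"
    unfolding implements_def
  proof (intro allI impI)
    fix x :: 'a and s :: store assume s: "s 0 = enc x"
    show "\<exists>t s'. texec ?p s t s' \<and> t \<le> 2 \<and> s' 0 = enc (f x) \<and> (\<forall>r\<ge>1. s' r = s r)"
    proof (cases "enc x = Leaf")
      case True
      then show ?thesis using s f[of x] texec_IfFalse[OF _ texec_basic(5)[of 0 0 0 s], of 0]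
        by (intro exI[of _ 2] exI[of _ "s(0 := Node (s 0) (s 0))"]) (auto simp: numeral_2_eq_2)
    next
      case False
      then show ?thesis using s f[of x] texec_IfTrue[OF _ texec_basic(1)[of 0 s], of 0]
        by (intro exI[of _ 2] exI[of _ "s(0 := Leaf)"]) (auto simp: numeral_2_eq_2)
    qed
  qed
  moreover have "poly_bounded sz (\<lambda>x. sz (f x))"
    by (rule poly_bounded_mono[OF poly_bounded_const[of _ 1] sz_bool_le])
  ultimately show ?thesis unfolding computable_def using poly_bounded_const[of sz 2] by blast
qed

lemma FP_enc_id: "(\<And>x. enc (f x) = enc x) \<Longrightarrow> FP f"
  by (rule computable_cong_enc[OF FP_id])

lemma FP_fst [FP_intros]: "FP f \<Longrightarrow> FP (\<lambda>x. fst (f x))"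
  by (rule computable_comp[where g = fst], rule FP_car) (auto simp: enc_prod_def)

lemma FP_snd [FP_intros]: "FP f \<Longrightarrow> FP (\<lambda>x. snd (f x))"
  by (rule computable_comp[where g = snd], rule FP_cdr) (auto simp: enc_prod_def)

lemma FP_Cons [FP_intros]: "FP f \<Longrightarrow> FP g \<Longrightarrow> FP (\<lambda>x. f x # g x)"
  by (rule computable_cong_enc[where g = "\<lambda>x. (f x, g x)"]) (auto intro: FP_intros)

lemma FP_Suc [FP_intros]: "FP f \<Longrightarrow> FP (\<lambda>x. Suc (f x))"
  by (rule computable_cong_enc[where g = "\<lambda>x. ((), f x)"]) (auto intro: FP_intros)

lemma FP_tl [FP_intros]: "FP f \<Longrightarrow> FP (\<lambda>x. tl (f x))"
proof (rule computable_comp[where g = tl], rule FP_cdr)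
  show "enc (tl xs) = cdr (enc xs)" for xs :: "'b list" by (cases xs) auto
qed

lemma FP_pred: "FP f \<Longrightarrow> FP (\<lambda>x. f x - 1)" for f :: "_ \<Rightarrow> nat"
proof (rule computable_comp[where g = "\<lambda>n. n - 1"], rule FP_cdr)
  show "enc (n - 1) = cdr (enc n)" for n :: nat by (cases n) auto
qed

section \<open>Logic and arithmetic\<close>

lemma FP_Not [FP_intros]: "FP f \<Longrightarrow> FP (\<lambda>x. \<not> f x)"
  by (rule computable_comp[where g = Not], rule FP_is_Leaf) auto

lemma FP_conj [FP_intros]: "FP f \<Longrightarrow> FP g \<Longrightarrow> FP (\<lambda>x. f x \<and> g x)"
proof -
  assume "FP f" "FP g"
  then have "FP (\<lambda>x. if f x then g x else False)" by (intro FP_if FP_const)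
  moreover have "(\<lambda>x. if f x then g x else False) = (\<lambda>x. f x \<and> g x)" by auto
  ultimately show ?thesis by simp
qed

lemma FP_disj [FP_intros]: "FP f \<Longrightarrow> FP g \<Longrightarrow> FP (\<lambda>x. f x \<or> g x)"
  using FP_Not[OF FP_conj[OF FP_Not FP_Not], of f g] by simp

lemma FP_imp [FP_intros]: "FP f \<Longrightarrow> FP g \<Longrightarrow> FP (\<lambda>x. f x \<longrightarrow> g x)"
  using FP_disj[OF FP_Not, of f g] by (simp only: imp_conv_disj)

lemma FP_eq_bool [FP_intros]: "FP f \<Longrightarrow> FP g \<Longrightarrow> FP (\<lambda>x. f x = (g x :: bool))"
  using FP_conj[OF FP_imp FP_imp, of f g g f] by (simp only: iff_conv_conj_imp)

lemma FP_null [FP_intros]: "FP f \<Longrightarrow> FP (\<lambda>x. f x = [])"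
  by (rule computable_comp[where g = "\<lambda>xs. xs = []"], rule FP_is_Leaf) auto

lemma FP_replicate_unit [FP_intros]: "FP f \<Longrightarrow> FP (\<lambda>x. replicate (f x) ())"
  by (rule computable_comp[where g = "\<lambda>n. replicate n ()"], rule FP_enc_id)
    (auto simp: enc_replicate_unit)

text \<open>Truncated subtraction is the predecessor iterated along the unary subtrahend. All
  comparisons of numbers derive from it, because \<open>m - n = 0\<close> means
  \<open>m \<le> n\<close>.\<close>

lemma FP_diff [FP_intros]:
  assumes "FP f" "FP g" shows "FP (\<lambda>x. f x - g x :: nat)"
proof -
  have "FP (\<lambda>x. fold (\<lambda>_ n. n - 1) (replicate (g x) ()) (f x))"
    by (rule FP_fold_add[where d = "\<lambda>_. 0"]) (intro FP_intros FP_pred poly_bounded_const assms | simp)+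
  moreover have "((\<lambda>n. n - 1) ^^ k) n = n - k" for k n :: nat
    by (induction k) auto
  ultimately show ?thesis by simp
qed

lemma FP_le [FP_intros]: "FP f \<Longrightarrow> FP g \<Longrightarrow> FP (\<lambda>x. f x \<le> (g x :: nat))"
  using computable_comp[OF FP_is_Leaf FP_diff, of "\<lambda>n. n = 0" f g] by simp

lemma FP_less [FP_intros]: "FP f \<Longrightarrow> FP g \<Longrightarrow> FP (\<lambda>x. f x < (g x :: nat))"
  using FP_Not[OF FP_le, of g f] by (simp only: not_le)

lemma FP_eq_nat [FP_intros]: "FP f \<Longrightarrow> FP g \<Longrightarrow> FP (\<lambda>x. f x = (g x :: nat))"
  using FP_conj[OF FP_le FP_le, of f g g f] by (simp only: eq_iff)

section \<open>Lists\<close>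

lemma FP_drop [FP_intros]:
  assumes "FP f" "FP g" shows "FP (\<lambda>x. drop (f x) (g x))"
proof -
  have tl: "sz (tl xs) \<le> sz xs" for xs :: "'b list" by (cases xs) auto
  have "FP (\<lambda>x. fold (\<lambda>_ xs. tl xs) (replicate (f x) ()) (g x))"
    by (rule FP_fold_add[where d = "\<lambda>_. 0"])
      (intro FP_intros poly_bounded_const assms | simp add: tl)+
  moreover have "(tl ^^ n) xs = drop n xs" for n and xs :: "'b list"
    by (induction n) (auto simp: drop_Suc tl_drop)
  ultimately show ?thesis by simp
qed

text \<open>A fold builds its list back to front, so reversing onto a second list is the natural
  primitive; \<open>rev\<close> and \<open>@\<close> follow from it.\<close>

lemma FP_rev_append:
  assumes "FP f" "FP g" shows "FP (\<lambda>x. rev (f x) @ g x)"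
proof -
  have "FP (\<lambda>x. fold (\<lambda>a acc. a # acc) (f x) (g x))"
    by (rule FP_fold_add[where d = "\<lambda>x. sz (f x) + 1"])
      (intro FP_intros poly_bounded_add poly_bounded_const computable_sz assms
        | use sz_member in force)+
  then show ?thesis by (simp add: fold_Cons_rev)
qed

lemma FP_rev [FP_intros]: "FP f \<Longrightarrow> FP (\<lambda>x. rev (f x))"
  using FP_rev_append[OF _ FP_const[of "[]"]] by simp

lemma FP_append [FP_intros]: "FP f \<Longrightarrow> FP g \<Longrightarrow> FP (\<lambda>x. f x @ g x)"
  using FP_rev_append[OF FP_rev, of f g] by simp

lemma FP_length [FP_intros]:
  assumes "FP f" shows "FP (\<lambda>x. length (f x))"
proof -
  have "FP (\<lambda>x. fold (\<lambda>_ n. Suc n) (f x) 0)"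
    by (rule FP_fold_add[where d = "\<lambda>x. 1"])
      (intro FP_intros poly_bounded_const assms | simp)+
  moreover have "fold (\<lambda>_ n. Suc n) xs k = length xs + k" for xs :: "'b list" and k
    by (induction xs arbitrary: k) auto
  ultimately show ?thesis by simp
qed

lemma FP_Ball [FP_intros]:
  fixes h :: "'a :: encodable \<Rightarrow> 'b :: encodable \<Rightarrow> bool"
  assumes l: "FP l" and h: "FP (\<lambda>z. h (fst z) (snd z))"
  shows "FP (\<lambda>x. \<forall>a\<in>set (l x). h x a)"
proof -
  have "FP (\<lambda>z :: 'a \<times> 'b \<times> bool. (fst z, fst (snd z)))" by (intro FP_intros)
  from computable_comp[OF h this] have "FP (\<lambda>z :: 'a \<times> 'b \<times> bool. h (fst z) (fst (snd z)))" by simp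
  then have "FP (\<lambda>x. fold (\<lambda>a acc. acc \<and> h x a) (l x) True)"
    by (intro FP_fold_add[where d = "\<lambda>_. 1"] FP_intros poly_bounded_const l)
      (use sz_bool_le in \<open>auto intro: le_trans\<close>)
  moreover have "fold (\<lambda>a acc. acc \<and> P a) xs b \<longleftrightarrow> b \<and> (\<forall>a\<in>set xs. P a)" for P :: "'b \<Rightarrow> bool" and xs b
    by (induction xs arbitrary: b) auto
  ultimately show ?thesis by simp
qed

lemma FP_Bex [FP_intros]:
  "FP l \<Longrightarrow> FP (\<lambda>z. h (fst z) (snd z)) \<Longrightarrow> FP (\<lambda>x. \<exists>a\<in>set (l x). h x a)"
  using FP_Not[OF FP_Ball[OF _ FP_Not], of l h] by simp

text \<open>Each entry is smaller than the whole list, so the results for single entries have a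
  common bound \<open>d x\<close>, and the accumulator grows by at most that much per step.\<close>

lemma FP_concat_map:
  fixes h :: "'e :: encodable \<Rightarrow> 'a :: encodable \<Rightarrow> 'c :: encodable list"
  assumes l: "FP l" and h: "FP (\<lambda>z. h (fst z) (snd z))"
  shows "FP (\<lambda>x. concat (map (h x) (l x)))"
proof -
  obtain c where c: "\<And>x a. sz (h x a) \<le> (sz x + sz a + 1 + 2) ^ c"
    using computable_sz[OF h] unfolding poly_bounded_def by (auto simp: split_paired_all)
  define d where "d x = (sz x + sz (l x) + 1 + 2) ^ c" for x
  have "poly_bounded sz d"
    unfolding d_def by (intro poly_bounded_intros computable_sz l poly_bounded_self)
  moreover have "sz (h x a) \<le> d x" if "a \<in> set (l x)" for x a
    unfolding d_def using sz_member[OF that] by (intro order_trans[OF c] power_mono) auto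
  moreover have "FP (\<lambda>z :: 'e \<times> 'a \<times> 'c list. (fst z, fst (snd z)))" by (intro FP_intros)
  from computable_comp[OF h this]
  have "FP (\<lambda>z :: 'e \<times> 'a \<times> 'c list. h (fst z) (fst (snd z)))" by simp
  then have "FP (\<lambda>z :: 'e \<times> 'a \<times> 'c list. rev (h (fst z) (fst (snd z))) @ snd (snd z))"
    by (intro FP_rev_append FP_intros)
  ultimately have "FP (\<lambda>x. fold (\<lambda>a acc. rev (h x a) @ acc) (l x) [])"
    by (intro FP_fold_add[where d = d]) (auto intro: FP_intros l)
  then have "FP (\<lambda>x. rev (fold (\<lambda>a acc. rev (h x a) @ acc) (l x) []))"
    by (rule FP_rev)
  moreover have "rev (fold (\<lambda>a acc. rev (k a) @ acc) xs acc) = rev acc @ concat (map k xs)"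
    for k :: "'a \<Rightarrow> 'c list" and xs acc
    by (induction xs arbitrary: acc) auto
  ultimately show ?thesis by simp
qed

lemma FP_map [FP_intros]:
  assumes "FP l" "FP (\<lambda>z. h (fst z) (snd z))"
  shows "FP (\<lambda>x. map (h x) (l x))"
proof -
  have "FP (\<lambda>x. concat (map (\<lambda>a. [h x a]) (l x)))"
    by (intro FP_concat_map FP_intros assms)
  moreover have "concat (map (\<lambda>a. [k a]) xs) = map k xs" for k :: "'b \<Rightarrow> 'c" and xs
    by (induction xs) auto
  ultimately show ?thesis by simp
qed

lemma FP_filter [FP_intros]:
  assumes "FP l" "FP (\<lambda>z. P (fst z) (snd z))"
  shows "FP (\<lambda>x. filter (P x) (l x))"
proof -
  have "FP (\<lambda>x. concat (map (\<lambda>a. if P x a then [a] else []) (l x)))"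
    by (intro FP_concat_map FP_intros assms)
  moreover have "concat (map (\<lambda>a. if Q a then [a] else []) xs) = filter Q xs" for Q :: "'b \<Rightarrow> bool" and xs
    by (induction xs) auto
  ultimately show ?thesis by simp
qed

text \<open>The step prepends the length of the accumulator, so its growth does depend on the
  accumulator. Hence the general fold rule is used, with the quadratic size of
  \<open>[0..<k]\<close> as the bound.\<close>

lemma FP_upt [FP_intros]:
  assumes "FP f" shows "FP (\<lambda>x. [0..<f x])"
proof -
  have eq: "((\<lambda>acc. length acc # acc) ^^ k) [] = rev [0..<k]" for k
    by (induction k) auto
  have "FP (\<lambda>x. fold (\<lambda>_ acc. length acc # acc) (replicate (f x) ()) [])"
  proof (rule computable_fold[where S = "\<lambda>x. sz (f x) * (sz (f x) + 1)"])
    fix x k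
    assume "k \<le> length (replicate (f x) ())"
    moreover have "sz [0..<k] \<le> k * (k + 1)" using sz_list_le[of "[0..<k]" k] by simp
    moreover have "k * (k + 1) \<le> f x * (f x + 1)" if "k \<le> f x" using that by (intro mult_mono) auto
    ultimately show "sz (fold (\<lambda>_ acc. length acc # acc) (take k (replicate (f x) ())) [])
        \<le> sz (f x) * (sz (f x) + 1)"
      by (simp add: eq min_def)
  qed (intro FP_intros poly_bounded_intros poly_bounded_self computable_sz assms)+
  then have "FP (\<lambda>x. rev (fold (\<lambda>_ acc. length acc # acc) (replicate (f x) ()) []))"
    by (rule FP_rev)
  then show ?thesis by (simp add: eq)
qed

section \<open>Depth-first enumeration of leaves\<close>

lemma gaps_nonempty [simp]: "gaps tr \<noteq> []"
  by (induction tr rule: gaps.induct) auto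

lemma gaps_append:
  "gaps (xs @ ys) = butlast (gaps xs) @ (last (gaps xs) + hd (gaps ys)) # tl (gaps ys)"
proof (induction xs rule: gaps.induct)
  case (2 tr)
  then show ?case by (cases "gaps tr") auto
qed auto

lemma gaps_replicate_Tick: "gaps (replicate t Tick) = [t]"
  by (induction t) auto

lemma gaps_ticks_append: "gaps (replicate t Tick @ tr) = (t + hd (gaps tr)) # tl (gaps tr)"
  by (simp add: gaps_append gaps_replicate_Tick)

lemma outputs_append [simp]: "outputs (xs @ ys) = outputs xs @ outputs ys"
  by (induction xs rule: outputs.induct) auto

lemma outputs_replicate_Tick [simp]: "outputs (replicate t Tick) = []"
  by (induction t) auto

lemma length_gaps: "length (gaps tr) = Suc (length (outputs tr))"
  by (induction tr rule: gaps.induct) auto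

lemma sum_list_gaps: "sum_list (gaps tr) = total_time tr"
proof (induction tr rule: gaps.induct)
  case (2 tr)
  then show ?case by (cases "gaps tr") (auto simp: total_time_def)
qed (auto simp: total_time_def)

lemma total_time_le_delay: "total_time tr \<le> (length (outputs tr) + 1) * delay tr"
proof -
  have "sum_list (gaps tr) \<le> length (gaps tr) * Max (set (gaps tr))"
    using sum_list_mono[of "gaps tr" "\<lambda>x. x" "\<lambda>_. Max (set (gaps tr))"]
    by (simp add: sum_list_triv)
  then show ?thesis by (simp add: sum_list_gaps length_gaps delay_def)
qed

text \<open>Such traces can be concatenated: as the last gap is zero, no two gaps add up.\<close>

definition gaps_within :: "nat \<Rightarrow> event list \<Rightarrow> bool" where
  "gaps_within B tr \<longleftrightarrow> (\<forall>g\<in>set (gaps tr). g \<le> B) \<and> last (gaps tr) = 0"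

lemma gaps_within_Nil: "gaps_within B []"
  by (simp add: gaps_within_def)

lemma gaps_within_append:
  assumes "gaps_within B xs" "gaps_within B ys"
  shows "gaps_within B (xs @ ys)"
proof -
  have "g \<le> B" if "g \<in> set (gaps (xs @ ys))" for g
    using that assms list.set_sel(1)[OF gaps_nonempty, of ys] list.set_sel(2)[OF gaps_nonempty, of _ ys]
    by (auto simp: gaps_within_def gaps_append dest: in_set_butlastD)
  moreover have "last (gaps (xs @ ys)) = 0"
    using assms by (cases "gaps ys") (auto simp: gaps_within_def gaps_append last_tl)
  ultimately show ?thesis by (simp add: gaps_within_def)
qed

lemma gaps_within_mono: "gaps_within B tr \<Longrightarrow> B \<le> B' \<Longrightarrow> gaps_within B' tr"
  by (auto simp: gaps_within_def)

text \<open>Ticks in front lengthen the first gap only. Without an output the first gap would also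
  be the last one, which has to stay zero.\<close>

lemma gaps_within_ticks:
  assumes "gaps_within B tr" "outputs tr \<noteq> []"
  shows "gaps_within (t + B) (replicate t Tick @ tr)"
proof -
  obtain g gs where g: "gaps tr = g # gs" using gaps_nonempty[of tr] by (cases "gaps tr") blast+
  moreover have "gs \<noteq> []" using assms(2) length_gaps[of tr] g by auto
  ultimately show ?thesis using assms(1) by (auto simp: gaps_within_def gaps_ticks_append)
qed

text \<open>A search tree without dead ends: every inner item has a child and the depth decreases,
  so an output lies below every item. Since children are no larger than their parents, one cost
  bound serves a whole subtree.\<close>

locale leaf_enumeration =
  fixes leaf :: "'i :: encodable \<Rightarrow> bool" and out :: "'i \<Rightarrow> 'o :: encodable"
    and children :: "'i \<Rightarrow> 'i list" and depth :: "'i \<Rightarrow> nat" and leaves :: "'i \<Rightarrow> 'o list"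
  assumes leaf: "FP leaf" and out: "FP out" and children: "FP children"
    and leaves_leaf: "leaf x \<Longrightarrow> leaves x = [out x]"
    \<comment> \<open>reversed, as pushing the children onto the stack reverses their order\<close>
    and leaves_node: "\<not> leaf x \<Longrightarrow> leaves x = concat (map leaves (rev (children x)))"
    and children_nonempty: "\<not> leaf x \<Longrightarrow> children x \<noteq> []"
    and child: "\<not> leaf x \<Longrightarrow> y \<in> set (children x) \<Longrightarrow> depth y < depth x \<and> sz y \<le> sz x"
begin

lemma texec_push_loop:
  fixes xs zs :: "'i list"
  assumes "s R = enc xs" "s K = enc zs" "R \<noteq> K" "Q \<noteq> K" "Q \<noteq> R"
  shows "\<exists>s'. texec (While R (Seq (SetCar Q R) (Seq (SetNode K Q K) (SetCdr R R))))
      s (1 + 4 * length xs) s' \<and> s' K = enc (rev xs @ zs)"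
  using assms
proof (induction xs arbitrary: s zs)
  case Nil
  then show ?case using texec_WhileFalse[of s R] by (intro exI[of _ s]) auto
next
  case (Cons x xs)
  let ?body = "Seq (SetCar Q R) (Seq (SetNode K Q K) (SetCdr R R))"
  define s1 where "s1 = s(Q := car (s R))"
  define s2 where "s2 = s1(K := Node (s1 Q) (s1 K))"
  define s3 where "s3 = s2(R := cdr (s2 R))"
  have body: "texec ?body s (1 + (1 + 1)) s3"
    unfolding s1_def s2_def s3_def by (intro texec_Seq) (rule texec_basic)+
  have "s3 R = enc xs" "s3 K = enc (x # zs)"
    using Cons.prems by (simp_all add: s1_def s2_def s3_def)
  with Cons.IH Cons.prems(3-5) obtain s4 where s4:
    "texec (While R ?body) s3 (1 + 4 * length xs) s4" "s4 K = enc (rev xs @ x # zs)" by blast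
  have "s R \<noteq> Leaf" using Cons.prems by simp
  from texec_WhileTrue[OF this body s4(1)]
  have "texec (While R ?body) s (1 + 4 * length (x # xs)) s4" by (simp add: eval_nat_numeral)
  then show ?case using s4(2) by (intro exI[of _ s4]) auto
qed

text \<open>The stack lies in register \<open>K\<close>. A child on top of the stack is treated at
  once and has smaller depth, so at most \<open>D + 1\<close> rounds of the loop separate
  consecutive outputs if \<open>D\<close> bounds the depths; the size of the initial stack bounds
  both \<open>D\<close> and the cost of a round.\<close>

theorem enumerate_leaves:
  assumes depth: "\<And>x. depth x \<le> sz x"
  shows "\<exists>q c. \<forall>s xs. s 0 = enc xs \<longrightarrow>
    (\<exists>tr s'. exec q s tr s' \<and> outputs tr = map enc (concat (map leaves xs)) \<and>
       (\<forall>g\<in>set (gaps tr). g \<le> (sz xs + 2) ^ c))"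
proof -
  obtain pl ml Tl where pl: "ml \<ge> 1" "poly_bounded sz Tl" "implements pl ml Tl leaf"
    using leaf by (rule computableE)
  obtain po mo To where po: "mo \<ge> 1" "poly_bounded sz To" "implements po mo To out"
    using out by (rule computableE)
  obtain pc mc Tc where pc: "mc \<ge> 1" "poly_bounded sz Tc" "implements pc mc Tc children"
    using children by (rule computableE)
  define K where "K = max ml (max mo mc)"
  have K: "K \<ge> 1" "ml \<le> K" "mo \<le> K" "mc \<le> K" using pl(1) by (auto simp: K_def)
  define push where
    "push = While (K + 2) (Seq (SetCar (K + 3) (K + 2)) (Seq (SetNode K (K + 3) K) (SetCdr (K + 2) (K + 2))))"
  define emit where "emit = Seq (Copy 0 (K + 1)) (Seq po (Output 0))"
  define expand where "expand = Seq (Copy 0 (K + 1)) (Seq pc (Seq (Copy (K + 2) 0) push))"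
  define pop where "pop = Seq (SetCar (K + 1) K) (Seq (SetCdr K K) (Seq (Copy 0 (K + 1)) pl))"
  define body where "body = Seq pop (IfThen 0 emit expand)"
  define cost where "cost x = Tl x + To x + sz (out x) + Tc x + 4 * sz (children x) + 10" for x
  have head: "\<exists>t s'. texec pop s t s' \<and>
      t \<le> Tl x + 3 \<and> s' 0 = enc (leaf x) \<and> s' K = enc zs \<and> s' (K + 1) = enc x"
    if "s K = enc (x # zs)" for s x zs
  proof -
    define s1 where "s1 = s(K + 1 := car (s K))"
    define s2 where "s2 = s1(K := cdr (s1 K))"
    define s3 where "s3 = s2(0 := s2 (K + 1))"
    have "s3 0 = enc x" using that K by (simp add: s1_def s2_def s3_def)
    with pl(3) obtain t s4 where 1: "texec pl s3 t s4" "t \<le> Tl x" "s4 0 = enc (leaf x)"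
      "\<forall>r\<ge>ml. s4 r = s3 r" by (rule implementsE)
    have "texec pop s
        (1 + (1 + (1 + t))) s4"
      using 1(1) unfolding pop_def s1_def s2_def s3_def
      by (intro texec_Seq) (assumption | rule texec_basic)+
    then show ?thesis using 1 that K
      by (intro exI[of _ "1 + (1 + (1 + t))"] exI[of _ s4]) (auto simp: s1_def s2_def s3_def)
  qed
  have head_body: "exec body s (replicate t Tick @ tr) s''"
    if "texec pop s t s'"
      "exec (IfThen 0 emit expand) s' tr s''" for s t s' tr s''
    using that unfolding texec_def body_def by (rule exec.Seq)
  have body_leaf: "\<exists>t s'. exec body s (replicate t Tick @ [Out (enc (out x))]) s' \<and>
      t + 1 \<le> cost x \<and> s' K = enc zs"
    if s: "s K = enc (x # zs)" and "leaf x" for s x zs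
  proof -
    obtain t s1 where 1: "texec pop s t s1"
      "t \<le> Tl x + 3" "s1 0 = enc (leaf x)" "s1 K = enc zs" "s1 (K + 1) = enc x"
      using head[of s x zs, OF s] by blast
    define s2 where "s2 = s1(0 := s1 (K + 1))"
    have "s2 0 = enc x" using 1 by (simp add: s2_def)
    with po(3) obtain u s3 where 2: "texec po s2 u s3" "u \<le> To x" "s3 0 = enc (out x)"
      "\<forall>r\<ge>mo. s3 r = s2 r" by (rule implementsE)
    have "exec emit s1 (replicate 1 Tick @ replicate u Tick @
        (replicate (Suc (size (s3 0))) Tick @ [Out (s3 0)])) s3"
      unfolding emit_def using texec_basic(2)[of 0 "K + 1" s1] 2(1)
        exec.Output[of 0 s3]
      unfolding texec_def s2_def by (intro exec.Seq)
    then have "exec (IfThen 0 emit expand) s1 (Tick # replicate 1 Tick @ replicate u Tick @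
        (replicate (Suc (size (s3 0))) Tick @ [Out (s3 0)])) s3"
      using 1(3) \<open>leaf x\<close> by (intro exec.IfTrue) auto
    from head_body[OF 1(1) this]
    have "exec body s (replicate (t + (1 + (1 + (u + Suc (sz (out x)))))) Tick @ [Out (enc (out x))]) s3"
      using 2(3) by (simp add: replicate_add replicate_app_Cons_same)
    then show ?thesis using 1 2 K
      by (intro exI[of _ "t + (1 + (1 + (u + Suc (sz (out x)))))"] exI[of _ s3])
        (auto simp: cost_def s2_def)
  qed
  have body_node: "\<exists>t s'. exec body s (replicate t Tick) s' \<and>
      t + 1 \<le> cost x \<and> s' K = enc (rev (children x) @ zs)"
    if s: "s K = enc (x # zs)" and "\<not> leaf x" for s x zs
  proof -
    obtain t s1 where 1: "texec pop s t s1"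
      "t \<le> Tl x + 3" "s1 0 = enc (leaf x)" "s1 K = enc zs" "s1 (K + 1) = enc x"
      using head[of s x zs, OF s] by blast
    define s2 where "s2 = s1(0 := s1 (K + 1))"
    have "s2 0 = enc x" using 1 by (simp add: s2_def)
    with pc(3) obtain u s3 where 2: "texec pc s2 u s3" "u \<le> Tc x" "s3 0 = enc (children x)"
      "\<forall>r\<ge>mc. s3 r = s2 r" by (rule implementsE)
    define s4 where "s4 = s3(K + 2 := s3 0)"
    have "s4 (K + 2) = enc (children x)" "s4 K = enc zs"
      using 1 2 K by (simp_all add: s4_def s2_def)
    from texec_push_loop[OF this, of "K + 3"] obtain s5 where 3:
      "texec push s4 (1 + 4 * length (children x)) s5" "s5 K = enc (rev (children x) @ zs)"
      unfolding push_def by auto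
    have "texec expand s1 (1 + (u + (1 + (1 + 4 * length (children x))))) s5"
      using 2(1) 3(1) unfolding expand_def s2_def s4_def
      by (intro texec_Seq) (assumption | rule texec_basic)+
    from texec_IfFalse[OF _ this, of 0 emit]
    have "exec (IfThen 0 emit expand) s1
        (replicate (Suc (1 + (u + (1 + (1 + 4 * length (children x)))))) Tick) s5"
      using 1(3) \<open>\<not> leaf x\<close> unfolding texec_def by auto
    from head_body[OF 1(1) this]
    have "exec body s (replicate (t + Suc (1 + (u + (1 + (1 + 4 * length (children x)))))) Tick) s5"
      by (simp only: replicate_add)
    then show ?thesis using 1 2 3 length_le_sz[of "children x"]
      by (intro exI[of _ "t + Suc (1 + (u + (1 + (1 + 4 * length (children x)))))"] exI[of _ s5])
        (auto simp: cost_def)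
  qed
  \<comment> \<open>A loop has an execution only as a whole, up to its end. \<open>reach\<close>
    describes finitely many rounds of it by saying that every run of the loop from \<open>s'\<close>
    extends to one from \<open>s\<close>.\<close>
  define reach where "reach s tr s' \<longleftrightarrow>
    (\<forall>tr' s''. exec (While K body) s' tr' s'' \<longrightarrow> exec (While K body) s (tr @ tr') s'')" for s tr s'
  have reach_refl: "reach s [] s" for s by (simp add: reach_def)
  have reach_trans: "reach s (tr @ tr') s''" if "reach s tr s'" "reach s' tr' s''" for s s' s'' tr tr'
    using that by (simp add: reach_def)
  have reach_step: "reach s (Tick # tr) s'" if "s K \<noteq> Leaf" "exec body s tr s'" for s s' tr
    unfolding reach_def using that exec.WhileTrue[of s K] by auto
  have reach_item: "\<exists>tr s'. reach s tr s' \<and> s' K = enc zs \<and> outputs tr = map enc (leaves x) \<and>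
      leaves x \<noteq> [] \<and> gaps_within ((D + 1) * C) tr"
    if "depth x \<le> D" "sz x \<le> B" "s K = enc (x # zs)" and C: "\<And>y. sz y \<le> B \<Longrightarrow> cost y \<le> C"
    for D B C x zs s
    using that(1-3)
  proof (induction D arbitrary: x zs s rule: less_induct)
    case (less D)
    show ?case
    proof (cases "leaf x")
      case True
      obtain t s' where 1: "exec body s (replicate t Tick @ [Out (enc (out x))]) s'"
        "t + 1 \<le> cost x" "s' K = enc zs" using body_leaf[of s x zs, OF less.prems(3) True] by blast
      have "reach s (replicate (Suc t) Tick @ [Out (enc (out x))]) s'"
        using reach_step[OF _ 1(1)] less.prems(3) by simp
      moreover have "gaps_within (t + 1) (replicate (Suc t) Tick @ [Out (enc (out x))])"
        unfolding gaps_within_def gaps_ticks_append by simp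
      then have "gaps_within ((D + 1) * C) (replicate (Suc t) Tick @ [Out (enc (out x))])"
        by (rule gaps_within_mono) (use 1(2) C[OF less.prems(2)] in simp)
      ultimately show ?thesis using 1(3) leaves_leaf[OF True] by fastforce
    next
      case False
      obtain t s1 where 1: "exec body s (replicate t Tick) s1"
        "t + 1 \<le> cost x" "s1 K = enc (rev (children x) @ zs)"
        using body_node[of s x zs, OF less.prems(3) False] by blast
      \<comment> \<open>The traces of the children end with an output, so their concatenation keeps
        all gaps within \<open>D * C\<close>. Only the first gap is lengthened afterwards, by the
        expansion of \<open>x\<close>, at a cost of at most \<open>C\<close>.\<close>
      have "\<exists>tr s'. reach s1 tr s' \<and> s' K = enc zs \<and> outputs tr = map enc (concat (map leaves ys)) \<and>
          (ys \<noteq> [] \<longrightarrow> concat (map leaves ys) \<noteq> []) \<and> gaps_within (D * C) tr"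
        if "s1 K = enc (ys @ zs)" "set ys \<subseteq> set (children x)" for ys s1
        using that
      proof (induction ys arbitrary: s1)
        case Nil
        then show ?case using reach_refl gaps_within_Nil by (intro exI[of _ "[]"] exI[of _ s1]) auto
      next
        case (Cons y ys)
        have y: "depth y < depth x" "sz y \<le> sz x" using child[OF False] Cons.prems(2) by auto
        have "depth y + 1 \<le> D" using y(1) less.prems(1) by simp
        then have D: "depth y < D" "(depth y + 1) * C \<le> D * C" by (simp, rule mult_right_mono) auto
        obtain tr s2 where 2: "reach s1 tr s2" "s2 K = enc (ys @ zs)" "outputs tr = map enc (leaves y)"
          "leaves y \<noteq> []" "gaps_within ((depth y + 1) * C) tr"
          using less.IH[OF D(1), of y s1 "ys @ zs"] y(2) less.prems(2) Cons.prems(1) by auto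
        obtain tr' s3 where 3: "reach s2 tr' s3" "s3 K = enc zs"
          "outputs tr' = map enc (concat (map leaves ys))" "gaps_within (D * C) tr'"
          using Cons.IH[of s2, OF 2(2)] Cons.prems(2) by auto
        show ?case
          using reach_trans[OF 2(1) 3(1)] 2(3,4) 3(2,3)
            gaps_within_append[OF gaps_within_mono[OF 2(5) D(2)] 3(4)]
          by (intro exI[of _ "tr @ tr'"] exI[of _ s3]) auto
      qed
      from this[of s1 "rev (children x)", OF 1(3)] children_nonempty[OF False] obtain tr s2 where 2: "reach s1 tr s2" "s2 K = enc zs"
        "outputs tr = map enc (leaves x)" "leaves x \<noteq> []" "gaps_within (D * C) tr"
        unfolding leaves_node[OF False] by auto
      have "reach s (replicate (Suc t) Tick @ tr) s2"
        using reach_trans[OF reach_step[OF _ 1(1)] 2(1)] less.prems(3) by simp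
      moreover have "gaps_within (Suc t + D * C) (replicate (Suc t) Tick @ tr)"
        using 2(3-5) by (intro gaps_within_ticks) auto
      then have "gaps_within ((D + 1) * C) (replicate (Suc t) Tick @ tr)"
        by (rule gaps_within_mono) (use 1(2) C[OF less.prems(2)] in simp)
      ultimately show ?thesis using 2(2-4) by (intro exI[of _ "replicate (Suc t) Tick @ tr"] exI[of _ s2]) auto
    qed
  qed
  have reach_items: "\<exists>tr s'. reach s tr s' \<and> s' K = Leaf \<and>
      outputs tr = map enc (concat (map leaves xs)) \<and> gaps_within ((D + 1) * C) tr"
    if "\<And>x. x \<in> set xs \<Longrightarrow> depth x \<le> D \<and> sz x \<le> B" "s K = enc xs" and C: "\<And>y. sz y \<le> B \<Longrightarrow> cost y \<le> C"
    for D B C xs s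
    using that(1,2)
  proof (induction xs arbitrary: s)
    case Nil
    then show ?case using reach_refl gaps_within_Nil by (intro exI[of _ "[]"] exI[of _ s]) auto
  next
    case (Cons x xs)
    obtain tr s2 where 2: "reach s tr s2" "s2 K = enc xs" "outputs tr = map enc (leaves x)"
      "gaps_within ((D + 1) * C) tr"
      using reach_item[of x D B s xs C] C Cons.prems by auto
    obtain tr' s3 where 3: "reach s2 tr' s3" "s3 K = Leaf"
      "outputs tr' = map enc (concat (map leaves xs))" "gaps_within ((D + 1) * C) tr'"
      using Cons.IH[of s2, OF _ 2(2)] Cons.prems(1) by auto
    show ?case
      using reach_trans[OF 2(1) 3(1)] 2(3) 3(2,3) gaps_within_append[OF 2(4) 3(4)]
      by (intro exI[of _ "tr @ tr'"] exI[of _ s3]) auto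
  qed
  have "poly_bounded sz cost" unfolding cost_def
    by (intro poly_bounded_intros pl(2) po(2) pc(2) computable_sz out children)
  then obtain c where c: "\<And>x. cost x \<le> (sz x + 2) ^ c" unfolding poly_bounded_def by blast
  show ?thesis
  proof (rule exI[of _ "Seq (Copy K 0) (While K body)"], rule exI[of _ "c + 3"], intro allI impI)
    fix s :: store and xs :: "'i list" assume s: "s 0 = enc xs"
    define X where "X = sz xs + 2"
    have bound: "depth x \<le> sz xs \<and> sz x \<le> sz xs" if "x \<in> set xs" for x
      using sz_member[OF that] depth[of x] by simp
    have C: "cost y \<le> X ^ c" if "sz y \<le> sz xs" for y
      unfolding X_def using that by (intro order_trans[OF c] power_mono) auto
    define s1 where "s1 = s(K := s 0)"
    obtain tr s2 where 1: "reach s1 tr s2" "s2 K = Leaf" "outputs tr = map enc (concat (map leaves xs))"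
      "gaps_within ((sz xs + 1) * X ^ c) tr"
      using reach_items[of xs "sz xs" "sz xs" s1 "X ^ c"] bound C s by (auto simp: s1_def)
    have "exec (While K body) s1 (tr @ [Tick]) s2"
      using 1(1,2) exec.WhileFalse[of s2 K body] unfolding reach_def by blast
    moreover have "exec (Copy K 0) s [Tick] s1" unfolding s1_def by (rule exec.Copy)
    ultimately have "exec (Seq (Copy K 0) (While K body)) s ([Tick] @ tr @ [Tick]) s2"
      using exec.Seq by blast
    moreover have "outputs ([Tick] @ tr @ [Tick]) = map enc (concat (map leaves xs))"
      using 1(3) by simp
    moreover have "\<forall>g\<in>set (gaps ([Tick] @ tr @ [Tick])). g \<le> X ^ (c + 3)"
    proof
      fix g assume "g \<in> set (gaps ([Tick] @ tr @ [Tick]))"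
      \<comment> \<open>The 2 stands for the initial \<open>Copy\<close> and the final loop test;
        both fall into the same gap when nothing is printed.\<close>
      then have "g \<le> (sz xs + 1) * X ^ c + 2"
        using 1(4) list.set_sel(1)[OF gaps_nonempty, of tr] list.set_sel(2)[OF gaps_nonempty, of _ tr]
        by (cases "gaps tr") (fastforce simp: gaps_within_def gaps_append dest: in_set_butlastD split: if_splits)+
      also have "\<dots> \<le> X * X ^ c + X * X ^ c"
      proof (rule add_mono)
        have "2 * 1 \<le> X * X ^ c" unfolding X_def by (rule mult_mono) auto
        then show "2 \<le> X * X ^ c" by simp
      qed (simp add: X_def)
      also have "\<dots> = 2 * X ^ (c + 1)" by simp
      also have "\<dots> \<le> X * X ^ (c + 1)" unfolding X_def by (rule mult_right_mono) auto
      also have "\<dots> = X ^ (c + 2)" by simp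
      also have "\<dots> \<le> X ^ (c + 3)" unfolding X_def by (rule power_increasing) auto
      finally show "g \<le> X ^ (c + 3)" .
    qed
    ultimately show "\<exists>tr s'. exec (Seq (Copy K 0) (While K body)) s tr s' \<and>
        outputs tr = map enc (concat (map leaves xs)) \<and> (\<forall>g\<in>set (gaps tr). g \<le> (sz xs + 2) ^ (c + 3))"
      unfolding X_def by blast
  qed
qed

end

section \<open>The enumeration algorithm\<close>

type_synonym matrix = "bool list list"
type_synonym colouring = "(nat \<times> bool) list"
type_synonym item = "(matrix \<times> matrix) \<times> nat list \<times> nat list list"

text \<open>The default follows \<open>car Leaf = Leaf\<close>: an empty list yields the value with
  code \<open>Leaf\<close>, so one instruction computes the function. It also makes
  \<open>entry\<close> return \<open>False\<close> outside the matrix.\<close>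

definition hd_or_Nil :: "'a list list \<Rightarrow> 'a list" where
  "hd_or_Nil xss = (case xss of [] \<Rightarrow> [] | xs # _ \<Rightarrow> xs)"

definition hd_or_False :: "bool list \<Rightarrow> bool" where
  "hd_or_False bs = (case bs of [] \<Rightarrow> False | b # _ \<Rightarrow> b)"

definition entry :: "matrix \<Rightarrow> nat \<Rightarrow> nat \<Rightarrow> bool" where
  "entry M i j = hd_or_False (drop j (hd_or_Nil (drop i M)))"

definition verts :: "matrix \<Rightarrow> nat list" where
  "verts G = [0..<length G]"

definition nbrs :: "matrix \<Rightarrow> nat \<Rightarrow> nat list" where
  "nbrs G v = filter (entry G v) (verts G)"

definition pendant :: "matrix \<Rightarrow> nat \<Rightarrow> bool" where
  "pendant G v \<longleftrightarrow> length (nbrs G v) = 1"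

text \<open>These are the vertices that \<open>rep\<close> moves; no canonical cut contains the edge
  at such a vertex.\<close>

definition redundant :: "matrix \<Rightarrow> nat \<Rightarrow> bool" where
  "redundant G v \<longleftrightarrow> pendant G v \<and> (\<exists>a\<in>set (nbrs G v). \<exists>u\<in>set (nbrs G a). u < v \<and> pendant G u)"

definition cover_step :: "matrix \<Rightarrow> nat \<times> nat \<Rightarrow> nat list \<Rightarrow> nat list" where
  "cover_step G e S =
     (if entry G (fst e) (snd e) \<and> (\<forall>x\<in>set S. x \<noteq> fst e \<and> x \<noteq> snd e) then fst e # snd e # S else S)"

definition greedy_cover :: "matrix \<Rightarrow> nat list" where
  "greedy_cover G =
     fold (cover_step G) (concat (map (\<lambda>i. map (\<lambda>j. (i, j)) (verts G)) (verts G))) []"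

definition cover_first :: "matrix \<Rightarrow> nat list" where
  "cover_first G = greedy_cover G @ filter (\<lambda>v. \<forall>x\<in>set (greedy_cover G). x \<noteq> v) (verts G)"

definition crossing :: "matrix \<Rightarrow> colouring \<Rightarrow> nat \<times> bool \<Rightarrow> colouring" where
  "crossing G P x = filter (\<lambda>y. entry G (fst x) (fst y) \<and> snd x \<noteq> snd y) P"

text \<open>Complementary colourings give the same cut and isolated vertices have no influence on it. The
  conditions on vertex \<open>0\<close> and on isolated vertices remove this freedom, while keeping a
  nonconstant colouring nonconstant.\<close>

definition proper :: "matrix \<Rightarrow> colouring \<Rightarrow> bool" where
  "proper G P \<longleftrightarrow> (\<forall>x\<in>set P.
     (if fst x = 0 then \<not> snd x else nbrs G (fst x) = [] \<longrightarrow> snd x) \<and>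
     length (crossing G P x) \<le> 1 \<and> (redundant G (fst x) \<longrightarrow> crossing G P x = []))"

definition extend :: "matrix \<Rightarrow> nat \<Rightarrow> colouring list \<Rightarrow> colouring list" where
  "extend G v Ps = filter (proper G) (concat (map (\<lambda>P. [(v, True) # P, (v, False) # P]) Ps))"

definition colourings :: "matrix \<Rightarrow> colouring list" where
  "colourings G = fold (extend G) (cover_first G) [[]]"

definition cut_matrix :: "matrix \<Rightarrow> colouring \<Rightarrow> matrix" where
  "cut_matrix G P = map (\<lambda>i. map (\<lambda>j. entry G i j \<and>
     (\<exists>x\<in>set P. \<exists>y\<in>set P. fst x = i \<and> fst y = j \<and> snd x \<noteq> snd y)) (verts G)) (verts G)"

definition submatrix :: "matrix \<Rightarrow> matrix \<Rightarrow> matrix \<Rightarrow> bool" where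
  "submatrix G M N \<longleftrightarrow> (\<forall>i\<in>set (verts G). \<forall>j\<in>set (verts G). entry M i j \<longrightarrow> entry N i j)"

text \<open>Duplicates do occur: flipping the colours on a connected component with at least two
  vertices that avoids vertex \<open>0\<close> does not change the cut. Equality of cuts is tested
  by inclusion in both directions.\<close>

definition insert_new :: "matrix \<Rightarrow> matrix \<Rightarrow> matrix list \<Rightarrow> matrix list" where
  "insert_new G M Ms = (if \<exists>N\<in>set Ms. submatrix G M N \<and> submatrix G N M then Ms else M # Ms)"

text \<open>A proper colouring of all vertices gives \<open>False\<close> to vertex
  \<open>0\<close>, so an entry \<open>True\<close> is what makes both sides of the partition
  nonempty.\<close>

definition canonical_cuts :: "matrix \<Rightarrow> colouring list \<Rightarrow> matrix list" where
  "canonical_cuts G Ps = fold (insert_new G) (map (cut_matrix G) (filter (\<lambda>P. \<exists>x\<in>set P. snd x) Ps)) []"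

definition minimal_cuts :: "matrix \<Rightarrow> matrix list \<Rightarrow> matrix list" where
  "minimal_cuts G Ms = filter (\<lambda>M. \<forall>N\<in>set Ms. submatrix G N M \<longrightarrow> submatrix G M N) Ms"

definition maximal_cuts :: "matrix \<Rightarrow> matrix list \<Rightarrow> matrix list" where
  "maximal_cuts G Ms = filter (\<lambda>M. \<forall>N\<in>set Ms. submatrix G M N \<longrightarrow> submatrix G N M) Ms"

definition pendant_rows :: "matrix \<Rightarrow> matrix \<Rightarrow> nat list list" where
  "pendant_rows G M = map (\<lambda>a. filter (pendant G) (nbrs G a))
     (filter (\<lambda>a. \<exists>u\<in>set (nbrs G a). pendant G u \<and> entry M a u) (verts G))"

definition swap_pendants :: "matrix \<Rightarrow> matrix \<Rightarrow> nat list \<Rightarrow> matrix" where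
  "swap_pendants G M ch = map (\<lambda>i. map (\<lambda>j.
     if pendant G i \<or> pendant G j then entry G i j \<and> (\<exists>c\<in>set ch. c = i \<or> c = j) else entry M i j)
     (verts G)) (verts G)"

text \<open>The accumulator \<open>ch\<close> and the reversal of \<open>us\<close> imitate the
  stack of the search, so that the list has the order in which the program prints.\<close>

fun choices :: "nat list \<Rightarrow> nat list list \<Rightarrow> nat list list" where
  "choices ch [] = [ch]"
| "choices ch (us # uss) =
     (if us = [] then [ch] else concat (map (\<lambda>u. choices (u # ch) uss) (rev us)))"

text \<open>An item holds the graph, a canonical cut, the pendant vertices chosen so far, and the
  rows still to choose from. An empty row does not arise; it is treated as a leaf so that
  every other item has a child.\<close>

definition item_leaf :: "item \<Rightarrow> bool" where
  "item_leaf x \<longleftrightarrow> hd_or_Nil (snd (snd x)) = []"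

definition item_out :: "item \<Rightarrow> matrix" where
  "item_out x = swap_pendants (fst (fst x)) (snd (fst x)) (fst (snd x))"

definition item_children :: "item \<Rightarrow> item list" where
  "item_children x = map (\<lambda>u. (fst x, u # fst (snd x), tl (snd (snd x)))) (hd_or_Nil (snd (snd x)))"

definition item_leaves :: "item \<Rightarrow> matrix list" where
  "item_leaves x = map (swap_pendants (fst (fst x)) (snd (fst x))) (choices (fst (snd x)) (snd (snd x)))"

definition initial_item :: "matrix \<Rightarrow> matrix \<Rightarrow> item" where
  "initial_item G M = ((G, M), ([], pendant_rows G M))"

definition enumeration :: "(matrix \<Rightarrow> matrix list \<Rightarrow> matrix list) \<Rightarrow> matrix \<Rightarrow> matrix list" where
  "enumeration sel G = concat (map (\<lambda>M. map (swap_pendants G M) (choices [] (pendant_rows G M)))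
     (sel G (canonical_cuts G (colourings G))))"

subsection \<open>Running time\<close>

lemma FP_hd_or_Nil [FP_intros]: "FP f \<Longrightarrow> FP (\<lambda>x. hd_or_Nil (f x))"
  by (rule computable_comp[where g = hd_or_Nil], rule FP_car)
    (auto simp: hd_or_Nil_def split: list.split)

lemma FP_entry [FP_intros]: "FP f \<Longrightarrow> FP g \<Longrightarrow> FP h \<Longrightarrow> FP (\<lambda>x. entry (f x) (g x) (h x))"
  unfolding entry_def
  by (rule computable_comp[where g = hd_or_False], rule FP_car)
    (auto simp: hd_or_False_def split: list.split intro!: FP_intros)

lemma FP_verts [FP_intros]: "FP f \<Longrightarrow> FP (\<lambda>x. verts (f x))"
  unfolding verts_def by (intro FP_intros)

lemma FP_nbrs [FP_intros]: "FP f \<Longrightarrow> FP g \<Longrightarrow> FP (\<lambda>x. nbrs (f x) (g x))"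
  by (rule computable_comp2) (unfold nbrs_def, intro FP_intros)

lemma FP_pendant [FP_intros]: "FP f \<Longrightarrow> FP g \<Longrightarrow> FP (\<lambda>x. pendant (f x) (g x))"
  unfolding pendant_def by (intro FP_intros)

lemma FP_redundant [FP_intros]: "FP f \<Longrightarrow> FP g \<Longrightarrow> FP (\<lambda>x. redundant (f x) (g x))"
  by (rule computable_comp2) (unfold redundant_def, intro FP_intros)

lemma FP_greedy_cover [FP_intros]:
  assumes "FP f" shows "FP (\<lambda>x. greedy_cover (f x))"
proof (rule computable_comp[where g = greedy_cover, OF _ assms])
  let ?l = "\<lambda>G. concat (map (\<lambda>i. map (\<lambda>j. (i, j)) (verts G)) (verts G))"
  have l: "FP ?l" by (intro FP_concat_map FP_intros)
  show "FP greedy_cover"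
    unfolding greedy_cover_def
  proof (rule FP_fold_add[where d = "\<lambda>G. 2 * sz (?l G) + 2"])
    show "sz (cover_step G e S) \<le> sz S + (2 * sz (?l G) + 2)" if "e \<in> set (?l G)" for G e S
      using sz_member[OF that] by (cases e) (auto simp: cover_step_def)
    show "FP (\<lambda>z. cover_step (fst z) (fst (snd z)) (snd (snd z)))"
      unfolding cover_step_def by (intro FP_intros)
  qed (intro poly_bounded_intros computable_sz FP_intros l)+
qed

lemma FP_cover_first [FP_intros]: "FP f \<Longrightarrow> FP (\<lambda>x. cover_first (f x))"
  by (rule computable_comp[where g = cover_first]) (unfold cover_first_def, intro FP_intros)

lemma FP_crossing [FP_intros]: "FP f \<Longrightarrow> FP g \<Longrightarrow> FP h \<Longrightarrow> FP (\<lambda>x. crossing (f x) (g x) (h x))"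
  unfolding crossing_def by (intro FP_intros) (auto intro!: FP_intros computable_comp[where f = fst])

lemma FP_proper [FP_intros]: "FP f \<Longrightarrow> FP g \<Longrightarrow> FP (\<lambda>x. proper (f x) (g x))"
  by (rule computable_comp2) (unfold proper_def, intro FP_intros FP_le FP_length)

lemma FP_extend: "FP (\<lambda>z. extend (fst z) (fst (snd z)) (snd (snd z)))"
  unfolding extend_def by (intro FP_intros FP_concat_map)

lemma FP_cut_matrix [FP_intros]: "FP f \<Longrightarrow> FP g \<Longrightarrow> FP (\<lambda>x. cut_matrix (f x) (g x))"
  by (rule computable_comp2) (unfold cut_matrix_def, intro FP_intros)

lemma FP_submatrix [FP_intros]:
  assumes "FP f" "FP g" "FP h" shows "FP (\<lambda>x. submatrix (f x) (g x) (h x))"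
proof -
  have "FP (\<lambda>p. submatrix (fst p) (fst (snd p)) (snd (snd p)))"
    unfolding submatrix_def by (intro FP_intros)
  from computable_comp[OF this FP_pair[OF assms(1) FP_pair[OF assms(2,3)]]] show ?thesis by simp
qed

lemma FP_canonical_cuts: "FP (\<lambda>z. canonical_cuts (fst z) (snd z))"
proof -
  let ?l = "\<lambda>z. map (cut_matrix (fst z)) (filter (\<lambda>P. \<exists>x\<in>set P. snd x) (snd z))"
  have l: "FP ?l" by (intro FP_intros)
  show ?thesis
    unfolding canonical_cuts_def
  proof (rule FP_fold_add[where d = "\<lambda>z. sz (?l z)"])
    show "sz (insert_new (fst z) M Ms) \<le> sz Ms + sz (?l z)" if "M \<in> set (?l z)" for z M Ms
      using sz_member[OF that] by (auto simp: insert_new_def)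
    show "FP (\<lambda>z. insert_new (fst (fst z)) (fst (snd z)) (snd (snd z)))"
      unfolding insert_new_def by (intro FP_intros)
  qed (intro computable_sz FP_intros l)+
qed

lemma FP_minimal_cuts: "FP (\<lambda>z. minimal_cuts (fst z) (snd z))"
  unfolding minimal_cuts_def by (intro FP_intros)

lemma FP_maximal_cuts: "FP (\<lambda>z. maximal_cuts (fst z) (snd z))"
  unfolding maximal_cuts_def by (intro FP_intros)

lemma FP_pendant_rows [FP_intros]: "FP f \<Longrightarrow> FP g \<Longrightarrow> FP (\<lambda>x. pendant_rows (f x) (g x))"
  by (rule computable_comp2) (unfold pendant_rows_def, intro FP_intros)

lemma FP_item_out: "FP item_out"
  unfolding item_out_def swap_pendants_def by (intro FP_intros)

lemma FP_item_children: "FP item_children"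
  unfolding item_children_def by (intro FP_intros)

lemma FP_item_leaf: "FP item_leaf"
  unfolding item_leaf_def by (intro FP_intros)

interpretation leaf_enumeration item_leaf item_out item_children
  "\<lambda>x. length (snd (snd x))" item_leaves
proof
  fix x y :: item
  obtain e ch todo where x: "x = (e, ch, todo)" by (cases x)
  show "item_leaves x = [item_out x]" if "item_leaf x"
    using that unfolding x
    by (cases todo) (auto simp: item_leaf_def item_leaves_def item_out_def hd_or_Nil_def)
  assume "\<not> item_leaf x"
  then obtain us uss where todo: "todo = us # uss" "us \<noteq> []"
    unfolding x by (cases todo) (auto simp: item_leaf_def hd_or_Nil_def)
  show "item_leaves x = concat (map item_leaves (rev (item_children x)))"
    unfolding x todo(1) using todo(2)
    by (simp add: item_leaves_def item_children_def hd_or_Nil_def map_concat rev_map o_def)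
  show "item_children x \<noteq> []"
    unfolding x todo(1) using todo(2) by (simp add: item_children_def hd_or_Nil_def)
  \<comment> \<open>The chosen vertex is paid for by the row that is dropped, so items do not
    grow.\<close>
  show "length (snd (snd y)) < length (snd (snd x)) \<and> sz y \<le> sz x" if "y \<in> set (item_children x)"
    using that sz_member[of _ us] unfolding x todo(1)
    by (fastforce simp: item_children_def hd_or_Nil_def)
qed (rule FP_item_leaf FP_item_out FP_item_children)+

text \<open>The sizes of the intermediate lists of colourings are exponential in the input, so the search
  is polynomial only relative to them.\<close>

definition search_bound :: "matrix \<Rightarrow> nat" where
  "search_bound G = sz G + (\<Sum>k\<le>length (cover_first G). sz (fold (extend G) (take k (cover_first G)) [[]]))"

lemma computable_colourings: "computable search_bound colourings"
  unfolding colourings_def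
proof (rule computable_fold[where S = search_bound])
  have b: "poly_bounded search_bound sz"
    by (rule poly_bounded_mono[OF poly_bounded_self]) (simp add: search_bound_def)
  then show "poly_bounded search_bound sz" .
  show "computable search_bound cover_first"
    by (rule computable_comp[OF _ computable_id[OF b]]) (intro FP_intros)
  fix G k assume "k \<le> length (cover_first G)"
  then have "sz (fold (extend G) (take k (cover_first G)) [[]])
      \<le> (\<Sum>k\<le>length (cover_first G). sz (fold (extend G) (take k (cover_first G)) [[]]))"
    by (intro member_le_sum) auto
  then show "sz (fold (extend G) (take k (cover_first G)) [[]]) \<le> search_bound G"
    by (simp add: search_bound_def)
qed (intro FP_extend computable_const poly_bounded_self)+

text \<open>Computing and selecting the canonical cuts is silent, so the time it takes is added to
  the first gap alone; all other gaps come from the search.\<close>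

theorem enumeration_program:
  assumes sel: "FP (\<lambda>z. sel (fst z) (snd z))"
  shows "\<exists>p c. \<forall>G. \<exists>tr. run p (enc G) tr \<and> outputs tr = map enc (enumeration sel G) \<and>
    delay tr \<le> (search_bound G + 2) ^ c"
proof -
  define items where "items z = map (initial_item (fst z)) (sel (fst z) (canonical_cuts (fst z) (snd z)))" for z
  have can: "FP (\<lambda>z. sel (fst z) (canonical_cuts (fst z) (snd z)))"
    by (rule computable_comp2[OF sel]) (intro FP_intros FP_canonical_cuts)+
  have "FP items" unfolding items_def initial_item_def by (intro FP_intros can)
  moreover have "poly_bounded search_bound sz"
    by (rule poly_bounded_mono[OF poly_bounded_self]) (simp add: search_bound_def)
  ultimately have comp: "computable search_bound (\<lambda>G. items (G, colourings G))"
    by (rule computable_comp[OF _ computable_pair[OF computable_id computable_colourings]])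
  then obtain p m T where p: "poly_bounded search_bound T" "implements p m T (\<lambda>G. items (G, colourings G))"
    by (rule computableE)
  have "length (snd (snd x)) \<le> sz x" for x :: item
    using length_le_sz[of "snd (snd x)"] by (simp add: enc_prod_def)
  from enumerate_leaves[OF this] obtain q c where q: "\<And>s xs. s 0 = enc xs \<Longrightarrow>
    \<exists>tr s'. exec q s tr s' \<and> outputs tr = map enc (concat (map item_leaves xs)) \<and>
       (\<forall>g\<in>set (gaps tr). g \<le> (sz xs + 2) ^ c)"
    by blast
  have "poly_bounded search_bound (\<lambda>G. T G + (sz (items (G, colourings G)) + 2) ^ c)"
    by (intro poly_bounded_intros p(1) computable_sz[OF comp])
  then obtain d where d: "\<And>G. T G + (sz (items (G, colourings G)) + 2) ^ c \<le> (search_bound G + 2) ^ d"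
    unfolding poly_bounded_def by blast
  have "\<exists>tr. run (Seq p q) (enc G) tr \<and> outputs tr = map enc (enumeration sel G) \<and>
      delay tr \<le> (search_bound G + 2) ^ d" for G
  proof -
    obtain t s' where 1: "texec p ((\<lambda>_. Leaf)(0 := enc G)) t s'" "t \<le> T G"
      "s' 0 = enc (items (G, colourings G))"
      using p(2) by (rule implementsE[of _ _ _ _ "(\<lambda>_. Leaf)(0 := enc G)" G]) auto
    obtain tr s'' where 2: "exec q s' tr s''"
      "outputs tr = map enc (concat (map item_leaves (items (G, colourings G))))"
      "\<And>g. g \<in> set (gaps tr) \<Longrightarrow> g \<le> (sz (items (G, colourings G)) + 2) ^ c"
      using q[of s', OF 1(3)] by blast
    have "run (Seq p q) (enc G) (replicate t Tick @ tr)"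
      using exec.Seq[OF 1(1)[unfolded texec_def] 2(1)] unfolding run_def by blast
    moreover have "concat (map item_leaves (items (G, colourings G))) = enumeration sel G"
      by (simp add: items_def enumeration_def initial_item_def item_leaves_def o_def)
    moreover have "g \<le> (search_bound G + 2) ^ d" if "g \<in> set (gaps (replicate t Tick @ tr))" for g
    proof -
      have "g \<le> t + (sz (items (G, colourings G)) + 2) ^ c"
        using that 2(3) list.set_sel(1)[OF gaps_nonempty, of tr] list.set_sel(2)[OF gaps_nonempty, of _ tr]
        unfolding gaps_ticks_append by (auto intro: trans_le_add2)
      then show ?thesis using 1(2) d[of G] by linarith
    qed
    then have "delay (replicate t Tick @ tr) \<le> (search_bound G + 2) ^ d"
      unfolding delay_def by (intro Max.boundedI) auto
    ultimately show ?thesis using 2(2) by (intro exI[of _ "replicate t Tick @ tr"]) auto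
  qed
  then show ?thesis by blast
qed

section \<open>Matching cuts and pendant vertices\<close>

definition cut :: "nat set set \<Rightarrow> (nat \<Rightarrow> bool) \<Rightarrow> nat set set" where
  "cut E c = {{u, v} | u v. {u, v} \<in> E \<and> c u \<noteq> c v}"

definition nb :: "nat set set \<Rightarrow> nat \<Rightarrow> nat set" where
  "nb E v = {u. {u, v} \<in> E}"

definition pend :: "nat set set \<Rightarrow> nat \<Rightarrow> bool" where
  "pend E v \<longleftrightarrow> card (nb E v) = 1"

text \<open>For pendant vertices, equal neighbour sets mean a common neighbour. The map thus
  contracts all pendant vertices at a vertex to the least of them.\<close>

definition rep :: "nat set set \<Rightarrow> nat \<Rightarrow> nat" where
  "rep E v = (if pend E v then LEAST u. pend E u \<and> nb E u = nb E v else v)"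

locale graph =
  fixes n :: nat and E :: "nat set set"
  assumes graph: "simple_graph {..<n} E"
begin

abbreviation "mc \<equiv> matching_cuts {..<n} E"
abbreviation rep_edges :: "nat set set \<Rightarrow> nat set set" where "rep_edges M \<equiv> (`) (rep E) ` M"

lemma edgeE:
  assumes "e \<in> E"
  obtains u v where "e = {u, v}" "u \<noteq> v" "u < n" "v < n"
proof -
  from assms graph have "e \<subseteq> {..<n}" "card e = 2" by (auto simp: simple_graph_def)
  then show thesis using that by (auto simp: card_2_iff)
qed

lemma edge_lt: "{u, v} \<in> E \<Longrightarrow> u < n \<and> v < n \<and> u \<noteq> v"
  using edgeE[of "{u, v}"] by (auto simp: doubleton_eq_iff)

lemma finite_E: "finite E"
proof (rule finite_subset)
  show "E \<subseteq> Pow {..<n}" using graph by (auto simp: simple_graph_def)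
qed simp

lemma nb_sym: "u \<in> nb E v \<longleftrightarrow> v \<in> nb E u"
  by (simp add: nb_def insert_commute)

lemma nb_lt: "u \<in> nb E v \<Longrightarrow> u < n \<and> v < n \<and> u \<noteq> v"
  by (simp add: nb_def edge_lt)

lemma finite_nb: "finite (nb E v)"
  by (rule finite_subset[of _ "{..<n}"]) (auto dest: nb_lt)

lemma pend_nb: "pend E v \<Longrightarrow> a \<in> nb E v \<Longrightarrow> nb E v = {a}"
  unfolding pend_def by (metis card_1_singletonE singletonD)

lemma pendE:
  assumes "pend E v" obtains a where "nb E v = {a}" "{a, v} \<in> E"
  using assms that unfolding pend_def by (metis card_1_singletonE insertI1 mem_Collect_eq nb_def)

lemma matching_cuts_iff:
  "M \<in> mc \<longleftrightarrow> pairwise disjnt M \<and> (\<exists>c. M = cut E c \<and> (\<exists>u<n. \<exists>v<n. c u \<noteq> c v))"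
proof
  assume "M \<in> mc"
  then obtain A B where AB: "A \<noteq> {}" "B \<noteq> {}" "A \<inter> B = {}" "A \<union> B = {..<n}" "M = edges_between E A B"
    and M: "pairwise disjnt M" unfolding matching_cuts_def matching_def by auto
  have "edges_between E A B = cut E (\<lambda>v. v \<in> A)"
  proof
    show "edges_between E A B \<subseteq> cut E (\<lambda>v. v \<in> A)"
      using AB(3) by (fastforce simp: edges_between_def cut_def)
    show "cut E (\<lambda>v. v \<in> A) \<subseteq> edges_between E A B"
    proof
      fix e assume "e \<in> cut E (\<lambda>v. v \<in> A)"
      then obtain u v where e: "e = {u, v}" "{u, v} \<in> E" "(u \<in> A) \<noteq> (v \<in> A)" by (auto simp: cut_def)
      have "u \<in> A \<union> B" "v \<in> A \<union> B" using edge_lt[OF e(2)] AB(4) by auto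
      then show "e \<in> edges_between E A B"
        using e unfolding edges_between_def by (auto simp: insert_commute)
    qed
  qed
  moreover have "\<exists>u<n. \<exists>v<n. (u \<in> A) \<noteq> (v \<in> A)" using AB(1-4) by blast
  ultimately show "pairwise disjnt M \<and> (\<exists>c. M = cut E c \<and> (\<exists>u<n. \<exists>v<n. c u \<noteq> c v))"
    using M AB(5) by (intro conjI exI[of _ "\<lambda>v. v \<in> A"]) auto
next
  assume "pairwise disjnt M \<and> (\<exists>c. M = cut E c \<and> (\<exists>u<n. \<exists>v<n. c u \<noteq> c v))"
  then obtain c u v where M: "pairwise disjnt M" "M = cut E c" and uv: "u < n" "v < n" "c u \<noteq> c v" by auto
  define A where "A = {v. v < n \<and> c v}"
  define B where "B = {v. v < n \<and> \<not> c v}"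
  have "cut E c = edges_between E A B"
  proof
    show "cut E c \<subseteq> edges_between E A B"
    proof
      fix e assume "e \<in> cut E c"
      then obtain u v where e: "e = {u, v}" "{u, v} \<in> E" "c u \<noteq> c v" by (auto simp: cut_def)
      then show "e \<in> edges_between E A B"
        using edge_lt[OF e(2)] unfolding edges_between_def A_def B_def by (auto simp: insert_commute)
    qed
    show "edges_between E A B \<subseteq> cut E c"
      by (fastforce simp: edges_between_def cut_def A_def B_def)
  qed
  moreover have "A \<noteq> {}" "B \<noteq> {}" "A \<inter> B = {}" "A \<union> B = {..<n}"
    using uv by (auto simp: A_def B_def)
  moreover have "M \<subseteq> E" using M(2) by (auto simp: cut_def)
  ultimately show "M \<in> mc" unfolding matching_cuts_def matching_def using M by blast
qed

lemma cut_iff: "{u, v} \<in> cut E c \<longleftrightarrow> {u, v} \<in> E \<and> c u \<noteq> c v"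
  unfolding cut_def by (auto simp: doubleton_eq_iff insert_commute)

lemma eq_cutI:
  assumes "N \<subseteq> E" "\<And>u v. {u, v} \<in> E \<Longrightarrow> {u, v} \<in> N \<longleftrightarrow> c u \<noteq> c v"
  shows "N = cut E c"
proof (rule set_eqI)
  fix e
  show "e \<in> N \<longleftrightarrow> e \<in> cut E c"
  proof (cases "e \<in> E")
    case True
    then obtain u v where "e = {u, v}" by (rule edgeE)
    then show ?thesis using True assms(2)[of u v] by (simp add: cut_iff)
  next
    case False
    then show ?thesis using assms(1) by (auto simp: cut_def)
  qed
qed

lemma matching_cut_subset: "M \<in> mc \<Longrightarrow> M \<subseteq> E"
  by (auto simp: matching_cuts_def matching_def)

lemma matching_cut_disjnt: "M \<in> mc \<Longrightarrow> pairwise disjnt M"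
  by (auto simp: matching_cuts_def matching_def)

section \<open>Contracting pendant vertices to representatives\<close>

lemma rep_pend:
  assumes "pend E v"
  shows "pend E (rep E v)" "nb E (rep E v) = nb E v" "rep E v \<le> v"
proof -
  have "pend E (rep E v) \<and> nb E (rep E v) = nb E v"
    unfolding rep_def using assms LeastI[of "\<lambda>u. pend E u \<and> nb E u = nb E v" v] by simp
  then show "pend E (rep E v)" "nb E (rep E v) = nb E v" by auto
  show "rep E v \<le> v" unfolding rep_def using assms by (auto intro: Least_le)
qed

lemma rep_not_pend: "\<not> pend E v \<Longrightarrow> rep E v = v"
  by (simp add: rep_def)

lemma nb_rep: "nb E (rep E v) = nb E v"
  by (cases "pend E v") (simp_all add: rep_pend rep_not_pend)

lemma pend_rep_iff: "pend E (rep E v) \<longleftrightarrow> pend E v"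
  by (simp add: pend_def nb_rep)

lemma rep_cong: "pend E u \<Longrightarrow> nb E u = nb E v \<Longrightarrow> rep E u = rep E v"
  unfolding rep_def pend_def by simp

lemma rep_rep: "rep E (rep E v) = rep E v"
  by (cases "pend E v") (auto intro: rep_cong simp: rep_pend nb_rep rep_not_pend)

lemma rep_eqD: "rep E u = rep E v \<Longrightarrow> u = v \<or> pend E u \<and> pend E v \<and> nb E u = nb E v"
  by (metis nb_rep pend_rep_iff rep_not_pend)

text \<open>Two adjacent pendant vertices form a component, so neither of them shares its neighbour
  with another pendant vertex.\<close>

lemma rep_pend_pend:
  assumes "{u, v} \<in> E" "pend E u" "pend E v"
  shows "rep E u = u"
proof -
  have "v \<in> nb E u" "u \<in> nb E v" using assms(1) by (simp_all add: nb_def insert_commute)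
  then have "nb E u = {v}" "nb E v = {u}" using pend_nb assms(2,3) by blast+
  moreover from this have "v \<in> nb E (rep E u)" by (simp add: nb_rep)
  then have "rep E u \<in> nb E v" using nb_sym[of v] by simp
  ultimately show ?thesis by simp
qed

lemma rep_edge:
  assumes "{u, v} \<in> E"
  shows "rep E ` {u, v} =
    (if pend E u \<and> \<not> pend E v then {rep E u, v} else if pend E v \<and> \<not> pend E u then {u, rep E v} else {u, v})"
proof -
  have "{v, u} \<in> E" using assms by (simp add: insert_commute)
  then have "pend E u \<Longrightarrow> pend E v \<Longrightarrow> rep E u = u \<and> rep E v = v"
    using rep_pend_pend assms by blast
  then show ?thesis by (cases "pend E u"; cases "pend E v") (simp_all add: rep_not_pend)
qed

lemma rep_edge_same:
  assumes "{u, v} \<in> E" "pend E u = pend E v"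
  shows "rep E ` {u, v} = {u, v}"
  using assms(2) by (subst rep_edge[OF assms(1)]) auto

lemma rep_in_E:
  assumes "e \<in> E" shows "rep E ` e \<in> E"
proof -
  obtain u v where e: "e = {u, v}" using assms by (rule edgeE)
  have uv: "u \<in> nb E v" "v \<in> nb E u" using assms e by (auto simp: nb_def insert_commute)
  have "v \<in> nb E (rep E u)" "u \<in> nb E (rep E v)" using uv by (simp_all add: nb_rep)
  then have "{rep E u, v} \<in> E" "{u, rep E v} \<in> E" by (simp_all add: nb_def insert_commute)
  then show ?thesis using assms unfolding e by (simp only: rep_edge split: if_split) simp
qed

lemma rep_edges_subset: "M \<subseteq> E \<Longrightarrow> rep_edges M \<subseteq> E"
  using rep_in_E by blast

text \<open>If the images meet although the vertices behind the common point differ, then these are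
  pendant twins, and both edges contain the common neighbour of the twins.\<close>

lemma rep_disjoint:
  assumes "e \<in> E" "f \<in> E" "rep E ` e \<inter> rep E ` f \<noteq> {}"
  shows "e \<inter> f \<noteq> {}"
proof -
  obtain x y where xy: "x \<in> e" "y \<in> f" "rep E x = rep E y" using assms(3) by blast
  from rep_eqD[OF xy(3)] show ?thesis
  proof (elim disjE conjE)
    assume p: "pend E x" "pend E y" "nb E x = nb E y"
    have other: "a \<in> e" if "pend E x" "nb E x = {a}" "x \<in> e" "e \<in> E" for e x a
    proof -
      from that(4) obtain u v where "e = {u, v}" by (rule edgeE)
      moreover from this that(4) have "u \<in> nb E v" "v \<in> nb E u"
        by (simp_all add: nb_def insert_commute)
      ultimately show ?thesis using that by auto
    qed
    from p(1) obtain a where "nb E x = {a}" by (rule pendE)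
    then show ?thesis using other[of x a e] other[of y a f] p xy assms(1,2) by auto
  qed (use xy in auto)
qed

lemma rep_edge_eq_iff:
  assumes "pairwise disjnt M" "M \<subseteq> E" "e \<in> M" "f \<in> M"
  shows "rep E ` e = rep E ` f \<longleftrightarrow> e = f"
proof
  assume "rep E ` e = rep E ` f"
  moreover have "e \<noteq> {}" using assms(2,3) edgeE by blast
  ultimately have "e \<inter> f \<noteq> {}" using assms rep_disjoint[of e f] by auto
  then show "e = f" using assms by (auto simp: pairwise_def disjnt_def)
qed simp

lemma rep_edges_disjnt:
  assumes "pairwise disjnt M" "M \<subseteq> E"
  shows "pairwise disjnt (rep_edges M)"
proof (rule pairwiseI)
  fix a b assume "a \<in> rep_edges M" "b \<in> rep_edges M" "a \<noteq> b"
  then obtain e f where ef: "e \<in> M" "f \<in> M" "a = rep E ` e" "b = rep E ` f" "e \<noteq> f" by auto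
  then have "e \<inter> f = {}" using assms(1) by (auto simp: pairwise_def disjnt_def)
  then show "disjnt a b" using rep_disjoint[of e f] ef assms(2) by (auto simp: disjnt_def)
qed

lemma rep_edges_idem: "rep_edges (rep_edges M) = rep_edges M"
  by (simp add: image_image rep_rep)

text \<open>A pendant vertex can be recoloured without affecting any edge but its own.\<close>

lemma matching_cut_transfer:
  assumes M: "M \<in> mc" and N: "N \<subseteq> E" "pairwise disjnt N" "rep_edges N = rep_edges M"
  shows "N \<in> mc"
proof -
  obtain c u0 v0 where c: "M = cut E c" and ne: "u0 < n" "v0 < n" "c u0 \<noteq> c v0"
    using M unfolding matching_cuts_iff by blast
  define d where "d v = (if \<exists>a\<in>nb E v. pend E v \<and> \<not> pend E a
    then \<exists>a\<in>nb E v. (c a \<noteq> ({a, v} \<in> N)) else c v)" for v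
  have d1: "d v = (c a \<noteq> ({a, v} \<in> N))" if "{a, v} \<in> E" "pend E v" "\<not> pend E a" for a v
  proof -
    have "nb E v = {a}" using that by (intro pend_nb) (auto simp: nb_def)
    then show ?thesis using that by (simp add: d_def)
  qed
  have d2: "d v = c v" if "{a, v} \<in> E" "pend E v \<longrightarrow> pend E a" for a v
  proof (cases "pend E v")
    case True
    then have "nb E v = {a}" using that by (intro pend_nb) (auto simp: nb_def)
    then show ?thesis using that True by (auto simp: d_def)
  qed (auto simp: d_def)
  \<comment> \<open>The contraction fixes an edge if both or none of its ends are pendant, and it
    preserves being of this kind. So on such edges \<open>L\<close> can be recovered from its
    image.\<close>
  have same: "{u, v} \<in> L \<longleftrightarrow> {u, v} \<in> rep_edges L"
    if "L \<subseteq> E" "{u, v} \<in> E" "pend E u = pend E v" for L u v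
  proof
    assume "{u, v} \<in> rep_edges L"
    then obtain e where e: "e \<in> L" "{u, v} = rep E ` e" by auto
    from e(1) that(1) have "e \<in> E" by auto
    then obtain x y where xy: "e = {x, y}" by (rule edgeE)
    have "rep E x = u \<and> rep E y = v \<or> rep E x = v \<and> rep E y = u"
      using e(2) unfolding xy by (simp add: doubleton_eq_iff) metis
    then have "pend E x = pend E y" using pend_rep_iff[of x] pend_rep_iff[of y] that(3) by auto
    then have "rep E ` e = e" using rep_edge_same \<open>e \<in> E\<close> unfolding xy by blast
    then show "{u, v} \<in> L" using e by simp
  next
    assume "{u, v} \<in> L"
    moreover have "rep E ` {u, v} = {u, v}" using that(2,3) by (rule rep_edge_same)
    ultimately show "{u, v} \<in> rep_edges L" by (metis imageI)
  qed
  have "N = cut E d"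
  proof (rule eq_cutI[OF N(1)])
    fix u v assume uv: "{u, v} \<in> E"
    then have vu: "{v, u} \<in> E" by (simp add: insert_commute)
    consider "pend E u" "\<not> pend E v" | "pend E v" "\<not> pend E u" | "pend E u = pend E v" by blast
    then show "{u, v} \<in> N \<longleftrightarrow> d u \<noteq> d v"
    proof cases
      case 1
      then show ?thesis using d1[OF vu] d2[OF uv] insert_commute[of u v "{}"] by simp blast
    next
      case 2
      then show ?thesis using d1[OF uv] d2[OF vu] by simp blast
    next
      case 3
      then have "{u, v} \<in> N \<longleftrightarrow> {u, v} \<in> M"
        using same[OF N(1) uv] same[OF matching_cut_subset[OF M] uv] N(3) by simp
      moreover have "d u = c u" "d v = c v" using 3 d2[OF uv] d2[OF vu] by simp_all
      ultimately show ?thesis using uv by (simp add: c cut_iff)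
    qed
  qed
  moreover have "\<exists>u<n. \<exists>v<n. d u \<noteq> d v"
  \<comment> \<open>An edge of \<open>N\<close> shows that \<open>d\<close> takes both values. The
    empty cut has no edge to show this, but then \<open>M\<close> is empty too and \<open>d\<close>
    coincides with the nonconstant \<open>c\<close>.\<close>
  proof (cases "N = {}")
    case True
    then have M0: "M = {}" using N(3) by auto
    have "d v = c v" for v
    proof (cases "\<exists>a\<in>nb E v. pend E v \<and> \<not> pend E a")
      case True
      then obtain a where a: "{a, v} \<in> E" "pend E v" "\<not> pend E a" by (auto simp: nb_def)
      then show ?thesis using d1[OF a] \<open>N = {}\<close> M0 cut_iff[of a v c] c by simp
    next
      case False
      then show ?thesis unfolding d_def by (rule if_not_P)
    qed
    then show ?thesis using ne by auto
  next
    case False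
    then obtain e where "e \<in> N" by blast
    then obtain u v where "{u, v} \<in> E" "d u \<noteq> d v" unfolding \<open>N = cut E d\<close> by (auto simp: cut_def)
    then show ?thesis using edge_lt by blast
  qed
  ultimately show ?thesis unfolding matching_cuts_iff using N(2) by blast
qed

lemma rep_matching_cut: "M \<in> mc \<Longrightarrow> rep_edges M \<in> mc"
  by (rule matching_cut_transfer)
    (auto simp: rep_edges_idem matching_cut_disjnt matching_cut_subset rep_edges_subset rep_edges_disjnt)

section \<open>Canonical matching cuts and their lifts\<close>

definition canonical :: "nat set set set" where
  "canonical = {M \<in> mc. rep_edges M = M}"

lemma rep_canonical: "M \<in> mc \<Longrightarrow> rep_edges M \<in> canonical"
  by (simp add: canonical_def rep_matching_cut rep_edges_idem)

text \<open>If \<open>M\<close> is a matching cut, then \<open>matching_cut_transfer\<close> makes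
  every lift a matching cut as well, so that lifting is a purely local choice of edges.\<close>

definition lifts :: "nat set set \<Rightarrow> nat set set set" where
  "lifts M = {N. N \<subseteq> E \<and> pairwise disjnt N \<and> rep_edges N = M}"

lemma matching_cuts_lifts: "mc = \<Union> (lifts ` canonical)"
proof
  show "mc \<subseteq> \<Union> (lifts ` canonical)"
    using rep_canonical matching_cut_subset matching_cut_disjnt by (fastforce simp: lifts_def)
  show "\<Union> (lifts ` canonical) \<subseteq> mc"
    using matching_cut_transfer by (auto simp: lifts_def canonical_def)
qed

lemma mem_lifts_canonical_iff:
  "M \<in> \<Union> (lifts ` {M \<in> canonical. P M}) \<longleftrightarrow> M \<in> mc \<and> P (rep_edges M)"
proof -
  have "M \<in> mc \<longleftrightarrow> M \<subseteq> E \<and> pairwise disjnt M \<and> rep_edges M \<in> canonical"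
    unfolding matching_cuts_lifts by (simp add: lifts_def)
  then show ?thesis by (simp add: lifts_def)
qed

text \<open>The contraction is injective on the matching \<open>M\<close>, so strictness of the
  inclusion survives.\<close>

lemma rep_psubset:
  assumes "M \<in> mc" "N \<subset> M"
  shows "rep_edges N \<subset> rep_edges M"
proof -
  from assms(2) obtain e where e: "e \<in> M" "e \<notin> N" by blast
  have "rep E ` e \<notin> rep_edges N"
    using rep_edge_eq_iff[OF matching_cut_disjnt[OF assms(1)] matching_cut_subset[OF assms(1)] e(1)] e(2) assms(2)
    by blast
  then show ?thesis using assms(2) e(1) by blast
qed

text \<open>A canonical cut \<open>N\<close> strictly below \<open>rep_edges M\<close> pulls back to
  the edges of \<open>M\<close> whose image lies in \<open>N\<close>; they form a lift of
  \<open>N\<close> and thus a smaller matching cut.\<close>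

lemma minimal_lifts:
  "minimal_matching_cuts {..<n} E =
     \<Union> (lifts ` {M \<in> canonical. \<forall>N\<in>canonical. N \<subseteq> M \<longrightarrow> M \<subseteq> N})"
proof -
  have key: "(\<exists>N\<in>mc. N \<subset> M) \<longleftrightarrow> (\<exists>N\<in>canonical. N \<subset> rep_edges M)" if M: "M \<in> mc" for M
  proof
    assume "\<exists>N\<in>mc. N \<subset> M"
    then obtain N where "N \<in> mc" "N \<subset> M" by (elim bexE)
    then show "\<exists>N\<in>canonical. N \<subset> rep_edges M"
      using rep_psubset[OF M] by (intro bexI[of _ "rep_edges N"] rep_canonical)
  next
    assume "\<exists>N\<in>canonical. N \<subset> rep_edges M"
    then obtain N where N: "N \<in> mc" "rep_edges N = N" "N \<subset> rep_edges M"
      unfolding canonical_def by (elim bexE CollectE conjE)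
    define L where "L = {e \<in> M. rep E ` e \<in> N}"
    have L: "rep_edges L = N" unfolding L_def using N(3) by blast
    have LM: "L \<subseteq> M" unfolding L_def by blast
    moreover have "L \<noteq> M" using L N(3) by blast
    moreover have "L \<in> mc"
    proof (rule matching_cut_transfer[OF N(1)])
      show "L \<subseteq> E" using LM matching_cut_subset[OF M] by (rule subset_trans)
      show "pairwise disjnt L" using matching_cut_disjnt[OF M] LM by (rule pairwise_subset)
      show "rep_edges L = rep_edges N" by (simp only: L N(2))
    qed
    ultimately show "\<exists>N\<in>mc. N \<subset> M" by blast
  qed
  have "M \<in> minimal_matching_cuts {..<n} E \<longleftrightarrow> M \<in> mc \<and> \<not> (\<exists>N\<in>canonical. N \<subset> rep_edges M)" for M
    unfolding minimal_matching_cuts_def mem_Collect_eq by (rule conj_cong[OF refl]) (simp only: key)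
  then show ?thesis
    by (intro set_eqI) (simp only: mem_lifts_canonical_iff less_le_not_le bex_simps not_not simp_thms de_Morgan_conj imp_conv_disj ball_simps)
qed

text \<open>A canonical cut \<open>N\<close> strictly above \<open>rep_edges M\<close> is pulled
  back by adding its new edges \<open>N - rep_edges M\<close> to \<open>M\<close>. The contraction
  fixes them, so the result is a lift of \<open>N\<close>.\<close>

lemma maximal_lifts:
  "maximal_matching_cuts {..<n} E =
     \<Union> (lifts ` {M \<in> canonical. \<forall>N\<in>canonical. M \<subseteq> N \<longrightarrow> N \<subseteq> M})"
proof -
  have key: "(\<exists>N\<in>mc. M \<subset> N) \<longleftrightarrow> (\<exists>N\<in>canonical. rep_edges M \<subset> N)" if M: "M \<in> mc" for M
  proof
    assume "\<exists>N\<in>mc. M \<subset> N"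
    then obtain N where "N \<in> mc" "M \<subset> N" by blast
    then show "\<exists>N\<in>canonical. rep_edges M \<subset> N"
      using rep_psubset[of N M] by (intro bexI[of _ "rep_edges N"] rep_canonical)
  next
    assume "\<exists>N\<in>canonical. rep_edges M \<subset> N"
    then obtain N where N: "N \<in> mc" "rep_edges N = N" "rep_edges M \<subset> N"
      unfolding canonical_def by (elim bexE CollectE conjE)
    define L where "L = M \<union> (N - rep_edges M)"
    have E: "M \<subseteq> E" "N \<subseteq> E" using M N(1) by (simp_all only: matching_cut_subset)
    have fixed: "rep E ` f = f" if "f \<in> N" for f
    proof -
      have "f \<in> rep_edges N" using that by (simp only: N(2))
      then obtain e where "f = rep E ` e" by (elim imageE)
      then show ?thesis by (simp add: image_image rep_rep)
    qed
    have "rep_edges (N - rep_edges M) = (\<lambda>f. f) ` (N - rep_edges M)"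
      by (intro image_cong refl fixed) blast
    then have "rep_edges (N - rep_edges M) = N - rep_edges M" by simp
    then have "rep_edges L = rep_edges M \<union> (N - rep_edges M)" by (simp only: L_def image_Un)
    also have "\<dots> = N" using N(3) by blast
    finally have L: "rep_edges L = N" .
    \<comment> \<open>If \<open>e\<close> met \<open>f\<close>, the image of \<open>e\<close> would
      meet \<open>f\<close> as well; but these are two distinct edges of the matching
      \<open>N\<close>.\<close>
    have cross: "disjnt e f" if "e \<in> M" "f \<in> N - rep_edges M" for e f
    proof (rule ccontr)
      assume "\<not> disjnt e f"
      then have "rep E ` e \<inter> rep E ` f \<noteq> {}" by (auto simp: disjnt_def)
      moreover have "rep E ` e \<in> N" "f \<in> N" "rep E ` e \<noteq> f" using that N(3) by blast+
      moreover have "rep E ` f = f" by (rule fixed) fact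
      ultimately show False using matching_cut_disjnt[OF N(1)]
        by (metis disjnt_def pairwiseD)
    qed
    have "pairwise disjnt L"
      unfolding L_def
    proof (rule pairwiseI)
      fix e f assume "e \<in> M \<union> (N - rep_edges M)" "f \<in> M \<union> (N - rep_edges M)" "e \<noteq> f"
      then show "disjnt e f"
        using cross[of e f] cross[of f e] pairwiseD[OF matching_cut_disjnt[OF M], of e f]
          pairwiseD[OF matching_cut_disjnt[OF N(1)], of e f] disjnt_sym[of f e]
        by (elim UnE) simp_all
    qed
    moreover have "L \<subseteq> E" using E unfolding L_def by blast
    moreover have "rep_edges L = rep_edges N" by (simp only: L N(2))
    ultimately have "L \<in> mc" by (intro matching_cut_transfer[OF N(1)])
    moreover have "M \<noteq> L" using N(3) L by blast
    moreover have "M \<subseteq> L" unfolding L_def by blast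
    ultimately show "\<exists>N\<in>mc. M \<subset> N" by blast
  qed
  have "M \<in> maximal_matching_cuts {..<n} E \<longleftrightarrow> M \<in> mc \<and> \<not> (\<exists>N\<in>canonical. rep_edges M \<subset> N)" for M
    unfolding maximal_matching_cuts_def mem_Collect_eq by (rule conj_cong[OF refl]) (simp only: key)
  then show ?thesis
    by (intro set_eqI) (simp only: mem_lifts_canonical_iff less_le_not_le bex_simps not_not simp_thms de_Morgan_conj imp_conv_disj ball_simps)
qed

section \<open>Lifts as choices of pendant vertices\<close>

lemma pend_edge:
  assumes "pend E v" "v \<in> e" "e \<in> E"
  obtains a where "e = {a, v}" "nb E v = {a}" "v \<in> nb E a"
proof -
  from assms(3) obtain x y where xy: "e = {x, y}" by (rule edgeE)
  then obtain a where a: "e = {a, v}" using assms(2) by (auto simp: insert_commute)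
  then have "a \<in> nb E v" using assms(3) by (simp add: nb_def)
  then show thesis using that[OF a] pend_nb[OF assms(1)] nb_sym[of a v] by simp
qed

lemma pend_edge_unique:
  "pend E v \<Longrightarrow> v \<in> e \<Longrightarrow> e \<in> E \<Longrightarrow> v \<in> f \<Longrightarrow> f \<in> E \<Longrightarrow> e = f"
  by (metis pend_edge singleton_insert_inj_eq)

lemma rep_nb_pend:
  assumes "pend E v" "a \<in> nb E v" shows "rep E ` {a, v} = {a, rep E v}"
proof -
  have "{a, v} \<in> E" using assms(2) by (simp add: nb_def)
  then have "rep E a = a" using rep_pend_pend rep_not_pend assms(1) by blast
  then show ?thesis by simp
qed

lemma canonical_edge:
  assumes "M \<in> canonical" "e \<in> M" shows "rep E ` e = e"
proof -
  have "rep_edges M = M" using assms(1) by (simp add: canonical_def)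
  with assms(2) obtain f where "e = rep E ` f" by blast
  then show ?thesis by (simp add: image_image rep_rep)
qed

lemma canonical_rep:
  assumes "M \<in> canonical" "{a, u} \<in> M" "pend E u"
  shows "rep E u = u"
proof -
  have e: "{a, u} \<in> E" using assms(1,2) matching_cut_subset by (auto simp: canonical_def)
  then have a: "a \<in> nb E u" by (simp add: nb_def)
  have "{a, rep E u} = {a, u}"
    using canonical_edge[OF assms(1,2)] rep_nb_pend[OF assms(3) a] by simp
  then show ?thesis by (auto simp: doubleton_eq_iff)
qed

definition active :: "nat set set \<Rightarrow> nat set" where
  "active M = {a. \<exists>u\<in>nb E a. pend E u \<and> {a, u} \<in> M}"

text \<open>If an edge of \<open>M\<close> is a whole component, both of its ends are active and
  every valid set contains both. This case needs separate care wherever an edge may have two pendant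
  ends.\<close>

definition valid :: "nat set set \<Rightarrow> nat set \<Rightarrow> bool" where
  "valid M C \<longleftrightarrow> (\<forall>v\<in>C. pend E v \<and> (\<exists>a\<in>active M. v \<in> nb E a)) \<and>
     (\<forall>a\<in>active M. \<exists>!v. v \<in> C \<and> v \<in> nb E a)"

definition swap :: "nat set set \<Rightarrow> nat set \<Rightarrow> nat set set" where
  "swap M C = {e \<in> E. if \<exists>v\<in>e. pend E v then e \<inter> C \<noteq> {} else e \<in> M}"

lemma swap_edge:
  assumes M: "M \<in> canonical" and C: "valid M C" and e: "e \<in> swap M C" "v \<in> e" "pend E v"
  obtains a c u where "e = {a, c}" "a \<in> active M" "c \<in> C" "c \<in> nb E a" "u \<in> nb E a" "pend E u"
    "{a, u} \<in> M" "rep E ` e = {a, u}"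
proof -
  have eE: "e \<in> E" and "e \<inter> C \<noteq> {}" using e by (auto simp: swap_def split: if_splits)
  then obtain c where c: "c \<in> C" "c \<in> e" by blast
  with C obtain a where a: "pend E c" "a \<in> active M" "c \<in> nb E a" by (auto simp: valid_def)
  obtain a' where a': "e = {a', c}" "nb E c = {a'}" using pend_edge[OF a(1) c(2) eE] by blast
  have aa: "a' = a" using a(3) nb_sym[of c a] a'(2) by simp
  from a(2) obtain u where u: "u \<in> nb E a" "pend E u" "{a, u} \<in> M" by (auto simp: active_def)
  have "nb E u = {a}" using pend_nb[OF u(2), of a] u(1) nb_sym[of u a] by simp
  then have "rep E c = rep E u" using a'(2) aa a(1) by (intro rep_cong) auto
  then have "rep E ` e = {a, u}"
    using rep_nb_pend[OF a(1), of a] a'(2) aa a'(1) canonical_rep[OF M u(3,2)] by simp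
  then show thesis using that[of a c u] a' aa a(2,3) c(1) u by simp
qed

lemma swap_lifts:
  assumes M: "M \<in> canonical" and C: "valid M C"
  shows "swap M C \<in> lifts M"
proof -
  let ?N = "swap M C"
  have ME: "M \<subseteq> E" "pairwise disjnt M"
    using M matching_cut_subset matching_cut_disjnt by (auto simp: canonical_def)
  have nopend: "e \<in> M" "rep E ` e = e" if "e \<in> ?N" "\<forall>v\<in>e. \<not> pend E v" for e
    using that canonical_edge[OF M] by (auto simp: swap_def)
  have repM: "rep E ` e \<in> M" if "e \<in> ?N" for e
  proof (cases "\<exists>v\<in>e. pend E v")
    case True
    then show ?thesis using swap_edge[OF M C that] by metis
  next
    case False
    then show ?thesis using nopend[OF that] by simp
  qed
  have "rep_edges ?N = M"
  proof
    show "rep_edges ?N \<subseteq> M" using repM by blast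
    show "M \<subseteq> rep_edges ?N"
    proof
      fix f assume f: "f \<in> M"
      show "f \<in> rep_edges ?N"
      proof (cases "\<exists>v\<in>f. pend E v")
        case False
        then have "f \<in> ?N" using f ME by (auto simp: swap_def)
        then show ?thesis using canonical_edge[OF M f] by (metis imageI)
      next
        case True
        then obtain u where u: "u \<in> f" "pend E u" by blast
        then obtain a where a: "f = {a, u}" "nb E u = {a}" "u \<in> nb E a"
          using pend_edge f ME(1) by (metis subsetD)
        then have "a \<in> active M" using u f by (auto simp: active_def)
        then obtain c where c: "c \<in> C" "c \<in> nb E a" using C by (auto simp: valid_def)
        have pc: "pend E c" using C c(1) by (auto simp: valid_def)
        have ca: "nb E c = {a}" using pend_nb[OF pc, of a] c(2) nb_sym[of c a] by simp
        then have "{a, c} \<in> E" by (auto simp: nb_def)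
        then have "{a, c} \<in> ?N" using pc c(1) by (auto simp: swap_def)
        moreover have "rep E c = rep E u" using ca a(2) pc by (intro rep_cong) auto
        then have "rep E ` {a, c} = f"
          using rep_nb_pend[OF pc, of a] ca a(1) canonical_rep[OF M, of a u] f u(2) by simp
        ultimately show ?thesis by (metis imageI)
      qed
    qed
  qed
  moreover have "pairwise disjnt ?N"
  proof (rule pairwiseI, rule ccontr)
    \<comment> \<open>Edges that meet have images in the matching \<open>M\<close> that meet, hence
      equal images. Equal images name the same active vertex, where \<open>C\<close> has a single
      element.\<close>
    fix e f assume ef: "e \<in> ?N" "f \<in> ?N" "e \<noteq> f" "\<not> disjnt e f"
    have "rep E ` e \<inter> rep E ` f \<noteq> {}" using ef(4) by (auto simp: disjnt_def)
    then have eq: "rep E ` e = rep E ` f"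
      using repM[OF ef(1)] repM[OF ef(2)] ME(2) by (metis disjnt_def pairwiseD)
    have pend_image: "(\<exists>v\<in>rep E ` e. pend E v) \<longleftrightarrow> (\<exists>v\<in>e. pend E v)" for e
      by (simp add: pend_rep_iff)
    show False
    proof (cases "\<exists>v\<in>e. pend E v")
      case False
      then have "\<not> (\<exists>v\<in>f. pend E v)" using eq pend_image by metis
      then show False using False nopend(2) ef eq by metis
    next
      case True
      then have "\<exists>v\<in>f. pend E v" using eq pend_image by metis
      then obtain b d w where f: "f = {b, d}" "b \<in> active M" "d \<in> C" "d \<in> nb E b" "w \<in> nb E b" "pend E w"
        "rep E ` f = {b, w}" using swap_edge[OF M C ef(2)] by metis
      from True obtain a c u where e: "e = {a, c}" "a \<in> active M" "c \<in> C" "c \<in> nb E a" "u \<in> nb E a" "pend E u"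
        "rep E ` e = {a, u}" using swap_edge[OF M C ef(1)] by metis
      have "{a, u} = {b, w}" using eq e f by simp
      then consider "a = b" | "a = w" "u = b" by (auto simp: doubleton_eq_iff)
      then show False
      proof cases
        case 1
        then have "c = d" using C e f by (auto simp: valid_def)
        then show False using 1 e f ef(3) by simp
      next
        \<comment> \<open>Here the common image has two pendant ends and is a component, so that
          \<open>e\<close> and \<open>f\<close> both equal it.\<close>
        case 2
        then have "nb E a = {u}" "nb E b = {w}" using pend_nb e(5,6) f(5,6) by auto
        then have "c = u" "d = w" using e(4) f(4) by auto
        then show False using 2 e(1) f(1) ef(3) by (simp add: insert_commute)
      qed
    qed
  qed
  moreover have "?N \<subseteq> E" by (auto simp: swap_def)
  ultimately show ?thesis by (simp add: lifts_def)
qed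

lemma lifts_swap:
  assumes M: "M \<in> canonical" and N: "N \<in> lifts M"
  shows "\<exists>C. valid M C \<and> N = swap M C"
proof -
  define C where "C = {v. pend E v \<and> (\<exists>e\<in>N. v \<in> e)}"
  have NE: "N \<subseteq> E" "pairwise disjnt N" "rep_edges N = M" using N by (auto simp: lifts_def)
  have C_edge: "{a, v} \<in> N" if "v \<in> C" "a \<in> nb E v" for a v
  proof -
    from that(1) obtain e where e: "pend E v" "e \<in> N" "v \<in> e" by (auto simp: C_def)
    moreover have "{a, v} \<in> E" using that(2) by (simp add: nb_def)
    ultimately have "e = {a, v}" using NE(1) by (intro pend_edge_unique[of v]) auto
    then show ?thesis using e by simp
  qed
  have "valid M C"
    unfolding valid_def
  proof (intro conjI ballI)
    fix v assume v: "v \<in> C"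
    then show p: "pend E v" by (simp add: C_def)
    obtain a where a: "nb E v = {a}" "{a, v} \<in> E" using p by (rule pendE)
    then have "{a, v} \<in> N" using C_edge[OF v] by simp
    then have "{a, rep E v} \<in> M" using NE(3) rep_nb_pend[OF p, of a] a(1) by (metis imageI singletonI)
    moreover have "rep E v \<in> nb E a" using nb_sym[of "rep E v" a] nb_rep[of v] a(1) by simp
    ultimately have "a \<in> active M" using rep_pend(1)[OF p] by (auto simp: active_def)
    moreover have "v \<in> nb E a" using nb_sym[of v a] a(1) by simp
    ultimately show "\<exists>a\<in>active M. v \<in> nb E a" by blast
  next
    fix a assume "a \<in> active M"
    then obtain u where u: "u \<in> nb E a" "pend E u" "{a, u} \<in> M" by (auto simp: active_def)
    then obtain e where e: "e \<in> N" "rep E ` e = {a, u}" using NE(3) by (metis imageE)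
    then obtain y where y: "y \<in> e" "rep E y = u" by (metis imageE insertI1 insert_commute)
    have py: "pend E y" using y(2) u(2) pend_rep_iff[of y] by simp
    have "nb E y = nb E u" using y(2) nb_rep[of y] by simp
    also have "\<dots> = {a}" using pend_nb[OF u(2), of a] u(1) nb_sym[of u a] by simp
    finally have ya: "y \<in> nb E a" using nb_sym[of y a] by simp
    moreover have "y \<in> C" using py e(1) y(1) by (auto simp: C_def)
    moreover have "v = y" if "v \<in> C" "v \<in> nb E a" for v
    proof -
      have "{a, v} \<in> N" "{a, y} \<in> N"
        using C_edge that ya \<open>y \<in> C\<close> nb_sym[of v a] nb_sym[of y a] by auto
      then have "{a, v} = {a, y}" using pairwiseD[OF NE(2), of "{a, v}" "{a, y}"] by (auto simp: disjnt_def)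
      then show ?thesis by (auto simp: doubleton_eq_iff)
    qed
    ultimately show "\<exists>!v. v \<in> C \<and> v \<in> nb E a" by blast
  qed
  moreover have "N = swap M C"
  proof (rule set_eqI)
    fix e
    show "e \<in> N \<longleftrightarrow> e \<in> swap M C"
    proof (cases "\<exists>v\<in>e. pend E v")
      case True
      have "e \<in> N" if "e \<in> E" "c \<in> e" "c \<in> C" for c
      proof -
        from that(3) obtain f where "pend E c" "f \<in> N" "c \<in> f" by (auto simp: C_def)
        moreover from this have "e = f" using that NE(1) by (intro pend_edge_unique[of c]) auto
        ultimately show ?thesis by simp
      qed
      then show ?thesis using True NE(1) by (auto simp: swap_def C_def)
    next
      case False
      have "e \<in> N \<longleftrightarrow> e \<in> M"
      proof
        assume "e \<in> N"
        moreover have "rep E ` e = e" using False by (simp add: rep_not_pend cong: image_cong)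
        ultimately show "e \<in> M" using NE(3) by (metis imageI)
      next
        assume "e \<in> M"
        then obtain f where f: "f \<in> N" "e = rep E ` f" using NE(3) by (metis imageE)
        then have "\<forall>v\<in>f. \<not> pend E v" using False pend_rep_iff by auto
        then have "rep E ` f = f" by (simp add: rep_not_pend cong: image_cong)
        then show "e \<in> N" using f by simp
      qed
      then show ?thesis using False NE(1) by (auto simp: swap_def)
    qed
  qed
  ultimately show ?thesis by blast
qed

text \<open>This makes \<open>swap M\<close> injective on valid sets. The delicate case is a pendant
  \<open>v\<close> whose edge meets \<open>C\<close> only in the other end: then this edge is a
  component that belongs to \<open>M\<close>, both ends are active, and validity puts
  \<open>v\<close> into \<open>C\<close> too.\<close>

lemma valid_recover:
  assumes C: "valid M C"
  shows "v \<in> C \<longleftrightarrow> pend E v \<and> (\<exists>e\<in>swap M C. v \<in> e)"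
proof
  assume v: "v \<in> C"
  then obtain a where a: "pend E v" "v \<in> nb E a" using C by (auto simp: valid_def)
  then have "{v, a} \<in> swap M C" using v by (auto simp: swap_def nb_def)
  then show "pend E v \<and> (\<exists>e\<in>swap M C. v \<in> e)" using a by blast
next
  assume "pend E v \<and> (\<exists>e\<in>swap M C. v \<in> e)"
  then obtain e where e: "pend E v" "e \<in> swap M C" "v \<in> e" by blast
  then have eE: "e \<in> E" and "e \<inter> C \<noteq> {}" by (auto simp: swap_def split: if_splits)
  then obtain c where c: "c \<in> e" "c \<in> C" by blast
  show "v \<in> C"
  proof (cases "c = v")
    case False
    obtain a where a: "e = {a, v}" "nb E v = {a}" using pend_edge[OF e(1,3) eE] by blast
    then have ca: "c = a" using c False by auto
    have pc: "pend E c" using C c(2) by (auto simp: valid_def)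
    obtain b where b: "e = {b, c}" "nb E c = {b}" using pend_edge[OF pc c(1) eE] by blast
    have bv: "b = v" using a(1) b(1) ca False by (auto simp: doubleton_eq_iff)
    obtain x where x: "x \<in> active M" "c \<in> nb E x" using C c(2) by (auto simp: valid_def)
    then have "x = v" using nb_sym[of c x] b(2) bv by simp
    then have "v \<in> active M" using x by simp
    then obtain u where u: "u \<in> nb E v" "{v, u} \<in> M" by (auto simp: active_def)
    then have "{c, v} \<in> M" using a(2) ca by (simp add: insert_commute)
    then have "c \<in> active M" using e(1) b(2) bv by (auto simp: active_def)
    then obtain w where "w \<in> C" "w \<in> nb E c" using C by (auto simp: valid_def)
    then show ?thesis using b(2) bv by simp
  qed (use c in simp)
qed

lemma lifts_eq: "M \<in> canonical \<Longrightarrow> lifts M = swap M ` {C. valid M C}"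
  using swap_lifts lifts_swap by blast

lemma swap_inj: "inj_on (swap M) {C. valid M C}"
  by (rule inj_onI) (metis mem_Collect_eq set_eqI valid_recover)

lemma lifts_disjoint: "M \<noteq> M' \<Longrightarrow> lifts M \<inter> lifts M' = {}"
  by (auto simp: lifts_def)

text \<open>Separating one pendant vertex from all others is a matching cut with a single edge, so a
  minimal cut that contains a pendant edge consists of it. A cut without pendant edges is fixed by
  the contraction.\<close>

lemma minimal_subset:
  "minimal_matching_cuts {..<n} E \<subseteq> canonical \<union> (\<lambda>e. {e}) ` E"
proof
  fix M assume M: "M \<in> minimal_matching_cuts {..<n} E"
  then have mc: "M \<in> mc" by (simp add: minimal_matching_cuts_def)
  show "M \<in> canonical \<union> (\<lambda>e. {e}) ` E"
  proof (cases "\<exists>e\<in>M. \<exists>v\<in>e. pend E v")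
    case True
    then obtain e v where e: "e \<in> M" "v \<in> e" "pend E v" by blast
    then have eE: "e \<in> E" using matching_cut_subset[OF mc] by blast
    obtain a where a: "e = {a, v}" "nb E v = {a}" using pend_edge[OF e(3,2) eE] by blast
    have "{e} = cut E (\<lambda>x. x = v)"
    proof (rule eq_cutI)
      fix x y assume xy: "{x, y} \<in> E"
      have "x \<noteq> y" using edge_lt[OF xy] by simp
      moreover have "x \<in> nb E y" "y \<in> nb E x" using xy by (simp_all add: nb_def insert_commute)
      then have "y = v \<Longrightarrow> x = a" "x = v \<Longrightarrow> y = a" using a(2) by auto
      ultimately show "{x, y} \<in> {e} \<longleftrightarrow> (x = v) \<noteq> (y = v)"
        unfolding a(1) by (auto simp: doubleton_eq_iff)
    qed (use eE in simp)
    moreover have "a < n" "v < n" "a \<noteq> v" using edge_lt[of a v] eE a(1) by auto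
    ultimately have "{e} \<in> mc" unfolding matching_cuts_iff by (auto simp: pairwise_def)
    then have "\<not> {e} \<subset> M" using M unfolding minimal_matching_cuts_def by blast
    then have "M = {e}" using e(1) by blast
    then show ?thesis using eE by blast
  next
    case False
    then have "rep E ` e = e" if "e \<in> M" for e
      using that by (simp add: rep_not_pend cong: image_cong)
    then have "rep_edges M = (\<lambda>e. e) ` M" by (intro image_cong) auto
    then show ?thesis using mc by (simp add: canonical_def)
  qed
qed

lemma card_E: "card E \<le> n ^ 2"
proof -
  have "E \<subseteq> (\<lambda>(u, v). {u, v}) ` ({..<n} \<times> {..<n})"
  proof
    fix e assume e: "e \<in> E"
    then obtain u v where "e = {u, v}" "u < n" "v < n" by (rule edgeE)
    then show "e \<in> (\<lambda>(u, v). {u, v}) ` ({..<n} \<times> {..<n})" by force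
  qed
  then have "card E \<le> card ((\<lambda>(u, v). {u, v}) ` ({..<n} \<times> {..<n}))" by (intro card_mono) auto
  also have "\<dots> \<le> card ({..<n} \<times> {..<n})" by (rule card_image_le) auto
  finally show ?thesis by (simp add: power2_eq_square)
qed

section \<open>Counting normal colourings\<close>

definition crossing_nbs :: "nat set \<Rightarrow> nat set \<Rightarrow> nat \<Rightarrow> nat set" where
  "crossing_nbs W T x = {y \<in> W. y \<in> nb E x \<and> (x \<in> T) \<noteq> (y \<in> T)}"

text \<open>The counterpart of \<open>proper\<close> for sets: \<open>W\<close> is the set of
  vertices coloured so far and \<open>T\<close> the set of those with colour
  \<open>True\<close>.\<close>

definition normal :: "nat set \<Rightarrow> nat set \<Rightarrow> bool" where
  "normal W T \<longleftrightarrow> (\<forall>x\<in>W. (if x = 0 then x \<notin> T else nb E x = {} \<longrightarrow> x \<in> T) \<and>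
     card (crossing_nbs W T x) \<le> 1 \<and> (rep E x \<noteq> x \<longrightarrow> crossing_nbs W T x = {}))"

lemma finite_crossing_nbs: "finite (crossing_nbs W T x)"
  by (rule finite_subset[OF _ finite_nb[of x]]) (auto simp: crossing_nbs_def)

lemma crossing_nbs_unique:
  "normal W T \<Longrightarrow> x \<in> W \<Longrightarrow> y \<in> crossing_nbs W T x \<Longrightarrow> z \<in> crossing_nbs W T x \<Longrightarrow> y = z"
  unfolding normal_def using card_le_Suc0_iff_eq[OF finite_crossing_nbs, of W T x] by auto

lemma same_colour_if_rep_neq:
  assumes "normal W T" "x \<in> W" "y \<in> W" "y \<in> nb E x" "rep E x \<noteq> x"
  shows "x \<in> T \<longleftrightarrow> y \<in> T"
  using assms unfolding normal_def crossing_nbs_def by blast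

lemma card_normal:
  assumes W: "finite W" "S \<subseteq> W" and nbS: "\<And>v. v \<in> W - S \<Longrightarrow> nb E v \<subseteq> S"
  shows "card {T. T \<subseteq> W \<and> normal W T} \<le> 2 ^ (3 * card S)"
proof -
  have S: "finite S" using W by (rule finite_subset[rotated])
  define F where "F D = {T. T \<subseteq> W \<and> normal W T \<and> T \<inter> S = D}" for D
  have fin: "finite (F D)" for D
    by (rule finite_subset[of _ "Pow W"]) (auto simp: F_def W(1))
  define P where "P = {v \<in> W - S. pend E v \<and> rep E v = v}"
  define X where "X D = {v \<in> W - S. \<exists>a\<in>nb E v. \<exists>b\<in>nb E v. a \<in> D \<and> b \<notin> D}" for D
  have finX: "finite (P \<union> X D)" for D using W(1) by (auto simp: P_def X_def)
  have cardP: "card P \<le> card S"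
  proof -
    have sub: "(\<lambda>v. THE a. nb E v = {a}) ` P \<subseteq> S"
      using nbS by (fastforce simp: P_def elim: pendE)
    have "inj_on (\<lambda>v. THE a. nb E v = {a}) P"
    proof (rule inj_onI)
      fix u v assume uv: "u \<in> P" "v \<in> P" "(THE a. nb E u = {a}) = (THE a. nb E v = {a})"
      then obtain a b where ab: "nb E u = {a}" "nb E v = {b}" by (auto simp: P_def elim!: pendE)
      then have "nb E u = nb E v" using uv(3) by simp
      then have "rep E u = rep E v" using uv(1) by (intro rep_cong) (auto simp: P_def)
      then show "u = v" using uv(1,2) by (simp add: P_def)
    qed
    then show ?thesis using sub S by (rule card_inj_on_le)
  qed
  \<comment> \<open>\<open>X D\<close> is defined without \<open>T\<close>, but a witness with trace
    \<open>D\<close> is needed to bound it: under \<open>T\<close>, each vertex of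
    \<open>X D\<close> differs in colour from one of its neighbours in \<open>S\<close>, and such a
    neighbour admits no second crossing edge.\<close>
  have cardX: "card (X D) \<le> card S" if T: "T \<in> F D" for T D
  proof -
    have nT: "normal W T" and D: "T \<inter> S = D" using T by (auto simp: F_def)
    have ex: "\<exists>a. a \<in> S \<and> v \<in> crossing_nbs W T a" if v: "v \<in> X D" for v
    proof -
      from v obtain a b where ab: "a \<in> nb E v" "b \<in> nb E v" "a \<in> D" "b \<notin> D" by (auto simp: X_def)
      have vW: "v \<in> W - S" using v by (simp add: X_def)
      have "a \<in> S" "b \<in> S" using nbS[OF vW] ab by auto
      moreover have "v \<in> nb E a" "v \<in> nb E b" using ab nb_sym by blast+
      ultimately show ?thesis using ab D vW by (cases "v \<in> T") (auto simp: crossing_nbs_def)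
    qed
    define f where "f v = (SOME a. a \<in> S \<and> v \<in> crossing_nbs W T a)" for v
    have f: "f v \<in> S" "v \<in> crossing_nbs W T (f v)" if "v \<in> X D" for v
      using someI_ex[OF ex[OF that]] by (simp_all add: f_def)
    have "inj_on f (X D)"
    proof (rule inj_onI)
      fix u v assume uv: "u \<in> X D" "v \<in> X D" "f u = f v"
      then show "u = v" using f[OF uv(1)] f[OF uv(2)] W(2) by (intro crossing_nbs_unique[OF nT, of "f u"]) auto
    qed
    moreover have "f ` X D \<subseteq> S" using f(1) by blast
    ultimately show ?thesis using S by (rule card_inj_on_le)
  qed
  have determined: "v \<in> T \<longleftrightarrow> v \<in> T'"
    if T: "T \<in> F D" "T' \<in> F D" and v: "v \<in> W" "v \<notin> P \<union> X D" for T T' D v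
  proof (cases "v \<in> S")
    case True
    then show ?thesis using T by (auto simp: F_def)
  next
    case False
    then have vW: "v \<in> W - S" using v by simp
    show ?thesis
    proof (cases "nb E v = {}")
      case True
      then show ?thesis using T v(1) unfolding F_def normal_def by (cases "v = 0") auto
    next
      case ne: False
      then obtain a where a: "a \<in> nb E v" by blast
      have aS: "a \<in> S" using nbS[OF vW] a by blast
      have col: "v \<in> U \<longleftrightarrow> a \<in> D" if U: "U \<in> F D" for U
      proof -
        have nU: "normal W U" and D: "U \<inter> S = D" using U by (auto simp: F_def)
        show ?thesis
        proof (cases "pend E v")
          case True
          then have "rep E v \<noteq> v" using v(2) vW by (simp add: P_def)
          then show ?thesis using same_colour_if_rep_neq[OF nU v(1) _ a] aS W(2) D by auto
        next
          case False
          show ?thesis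
          proof (rule ccontr)
            assume neq: "\<not> ?thesis"
            \<comment> \<open>As \<open>v\<close> is not in \<open>X D\<close>, its neighbours lie
              all inside or all outside \<open>D\<close>, so a deviating colour makes all of them
              crossing. There are at least two of them, while normality allows one.\<close>
            have "crossing_nbs W U v = nb E v"
              using neq nbS[OF vW] W(2) D v(2) vW a unfolding crossing_nbs_def X_def by blast
            moreover have "card (nb E v) \<noteq> 0" using ne finite_nb by simp
            ultimately show False using nU v(1) False unfolding normal_def pend_def by fastforce
          qed
        qed
      qed
      show ?thesis using col T by simp
    qed
  qed
  have cardF: "card (F D) \<le> 2 ^ (2 * card S)" for D
  proof (cases "F D = {}")
    case False
    then obtain T where T: "T \<in> F D" by blast
    have "inj_on (\<lambda>T. T \<inter> (P \<union> X D)) (F D)"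
    proof (rule inj_onI)
      fix T T' assume TT: "T \<in> F D" "T' \<in> F D" "T \<inter> (P \<union> X D) = T' \<inter> (P \<union> X D)"
      have sub: "T \<subseteq> W" "T' \<subseteq> W" using TT by (auto simp: F_def)
      show "T = T'"
      proof (rule set_eqI)
        fix v show "v \<in> T \<longleftrightarrow> v \<in> T'"
          using determined[OF TT(1,2), of v] TT(3) sub by blast
      qed
    qed
    then have "card (F D) \<le> card (Pow (P \<union> X D))"
      by (rule card_inj_on_le) (use finX in auto)
    also have "\<dots> = 2 ^ card (P \<union> X D)" using finX by (simp add: card_Pow)
    also have "\<dots> \<le> 2 ^ (2 * card S)"
      using card_Un_le[of P "X D"] cardP cardX[OF T] by (intro power_increasing) auto
    finally show ?thesis .
  qed simp
  have "{T. T \<subseteq> W \<and> normal W T} = (\<Union>D\<in>Pow S. F D)" by (auto simp: F_def)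
  then have "card {T. T \<subseteq> W \<and> normal W T} \<le> (\<Sum>D\<in>Pow S. card (F D))"
    using card_UN_le[of "Pow S" F] S by simp
  also have "\<dots> \<le> (\<Sum>D\<in>Pow S. 2 ^ (2 * card S))" by (intro sum_mono cardF)
  also have "\<dots> = 2 ^ (3 * card S)" using S by (simp add: card_Pow flip: power_add)
  finally show ?thesis .
qed

section \<open>Canonical cuts as cuts of normal colourings\<close>

lemma normal_cut_canonical:
  assumes T: "T \<subseteq> {..<n}" "normal {..<n} T" "T \<noteq> {}"
  shows "cut E (\<lambda>v. v \<in> T) \<in> canonical"
proof -
  let ?M = "cut E (\<lambda>v. v \<in> T)"
  have cross: "v \<in> crossing_nbs {..<n} T u" if "{u, v} \<in> ?M" for u v
    using that edge_lt[of u v] unfolding cut_iff by (auto simp: crossing_nbs_def nb_def insert_commute)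
  have "pairwise disjnt ?M"
  proof (rule pairwiseI, rule ccontr)
    fix e f assume ef: "e \<in> ?M" "f \<in> ?M" "e \<noteq> f" "\<not> disjnt e f"
    from ef(4) obtain u where u: "u \<in> e" "u \<in> f" by (auto simp: disjnt_def)
    from ef(1) u(1) obtain v where v: "e = {u, v}" by (auto simp: cut_def insert_commute)
    from ef(2) u(2) obtain w where w: "f = {u, w}" by (auto simp: cut_def insert_commute)
    have "u < n" using ef(1) v edge_lt[of u v] by (simp add: cut_iff)
    then have "v = w"
      using crossing_nbs_unique[OF T(2), of u v w] cross ef(1,2) v w by auto
    then show False using ef(3) v w by simp
  qed
  moreover have "\<exists>u<n. \<exists>v<n. (u \<in> T) \<noteq> (v \<in> T)"
  proof -
    obtain v where v: "v \<in> T" "v < n" using T by blast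
    then have "0 \<notin> T" using T(2) unfolding normal_def by (auto split: if_splits)
    then show ?thesis using v by (intro exI[of _ 0] conjI exI[of _ v]) auto
  qed
  ultimately have mc: "?M \<in> mc" unfolding matching_cuts_iff by blast
  have "rep E u = u" if "{u, v} \<in> ?M" for u v
    using cross[OF that] that edge_lt[of u v] T(2) unfolding normal_def cut_iff by blast
  then have "rep E ` e = e" if "e \<in> ?M" for e
  proof -
    from that obtain u v where uv: "e = {u, v}" by (auto simp: cut_def)
    moreover have "{v, u} \<in> ?M" using that uv by (simp add: insert_commute)
    ultimately show ?thesis using \<open>\<And>u v. {u, v} \<in> ?M \<Longrightarrow> rep E u = u\<close> that by auto
  qed
  then have "rep_edges ?M = (\<lambda>e. e) ` ?M" by (intro image_cong refl)
  then show ?thesis using mc by (simp add: canonical_def)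
qed

lemma canonical_normal_cut:
  assumes M: "M \<in> canonical"
  shows "\<exists>T. T \<subseteq> {..<n} \<and> normal {..<n} T \<and> T \<noteq> {} \<and> M = cut E (\<lambda>v. v \<in> T)"
proof -
  have mc: "M \<in> mc" using M by (simp add: canonical_def)
  then obtain c u0 v0 where c: "M = cut E c" "u0 < n" "v0 < n" "c u0 \<noteq> c v0"
    unfolding matching_cuts_iff by blast
  \<comment> \<open>Comparing with \<open>c 0\<close> chooses between complementary colourings the
    one with \<open>False\<close> at vertex \<open>0\<close>. Isolated vertices other than
    \<open>0\<close> all go to the \<open>True\<close> side, which affects no edge.\<close>
  define T where "T = {v. v < n \<and> v \<noteq> 0 \<and> (nb E v = {} \<or> c v \<noteq> c 0)}"
  have edge_T: "u \<in> T \<longleftrightarrow> c u \<noteq> c 0" if "{u, v} \<in> E" for u v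
  proof -
    have "v \<in> nb E u" using that by (simp add: nb_def insert_commute)
    then show ?thesis using edge_lt[OF that] by (cases "u = 0") (auto simp: T_def)
  qed
  have "M = cut E (\<lambda>v. v \<in> T)"
  proof (rule eq_cutI[OF matching_cut_subset[OF mc]])
    fix u v assume uv: "{u, v} \<in> E"
    then have "{v, u} \<in> E" by (simp add: insert_commute)
    then show "{u, v} \<in> M \<longleftrightarrow> (u \<in> T) \<noteq> (v \<in> T)"
      using edge_T[OF uv] edge_T[of v u] uv unfolding c(1) cut_iff by auto
  qed
  moreover have cross: "{x, y} \<in> M" if "y \<in> crossing_nbs {..<n} T x" for x y
    using that \<open>M = cut E (\<lambda>v. v \<in> T)\<close> cut_iff[of x y "\<lambda>v. v \<in> T"]
    by (auto simp: crossing_nbs_def nb_def insert_commute)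
  have "normal {..<n} T"
    unfolding normal_def
  proof (intro ballI conjI impI)
    fix x assume x: "x \<in> {..<n}"
    then show "if x = 0 then x \<notin> T else nb E x = {} \<longrightarrow> x \<in> T" by (simp add: T_def)
    have "y = z" if "y \<in> crossing_nbs {..<n} T x" "z \<in> crossing_nbs {..<n} T x" for y z
    proof -
      have "{x, y} = {x, z}"
        using pairwiseD[OF matching_cut_disjnt[OF mc] cross[OF that(1)] cross[OF that(2)]]
        by (auto simp: disjnt_def)
      then show ?thesis by (auto simp: doubleton_eq_iff)
    qed
    then show "card (crossing_nbs {..<n} T x) \<le> 1"
      using card_le_Suc0_iff_eq[OF finite_crossing_nbs, of "{..<n}" T x] by auto
    assume red: "rep E x \<noteq> x"
    show "crossing_nbs {..<n} T x = {}"
    proof (rule ccontr)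
      assume "crossing_nbs {..<n} T x \<noteq> {}"
      then obtain y where "{y, x} \<in> M" using cross by (auto simp: insert_commute)
      moreover have "pend E x" using red rep_not_pend by blast
      ultimately show False using canonical_rep[OF M] red by blast
    qed
  qed
  moreover have "T \<noteq> {}"
  proof -
    obtain u where "u < n" "c u \<noteq> c 0" using c by metis
    then have "u \<in> T" by (cases "u = 0") (auto simp: T_def)
    then show ?thesis by blast
  qed
  ultimately show ?thesis by (intro exI[of _ T]) (auto simp: T_def)
qed

lemma canonical_eq:
  "canonical = (\<lambda>T. cut E (\<lambda>v. v \<in> T)) ` {T. T \<subseteq> {..<n} \<and> normal {..<n} T \<and> T \<noteq> {}}"
  using normal_cut_canonical canonical_normal_cut by blast

lemma card_canonical:
  assumes "S \<subseteq> {..<n}" "\<And>e. e \<in> E \<Longrightarrow> e \<inter> S \<noteq> {}"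
  shows "card canonical \<le> 2 ^ (3 * card S)"
proof -
  have fin: "finite {T. T \<subseteq> {..<n} \<and> normal {..<n} T}"
    by (rule finite_subset[of _ "Pow {..<n}"]) auto
  have "card canonical \<le> card {T. T \<subseteq> {..<n} \<and> normal {..<n} T \<and> T \<noteq> {}}"
    unfolding canonical_eq by (rule card_image_le) (rule finite_subset[OF _ fin], auto)
  also have "\<dots> \<le> card {T. T \<subseteq> {..<n} \<and> normal {..<n} T}" by (rule card_mono[OF fin]) auto
  also have "\<dots> \<le> 2 ^ (3 * card S)"
  proof (rule card_normal)
    show "nb E v \<subseteq> S" if "v \<in> {..<n} - S" for v
      using assms(2) that by (fastforce simp: nb_def)
  qed (use assms in auto)
  finally show ?thesis .
qed

end

section \<open>Correctness of the algorithm\<close>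

definition mat :: "nat \<Rightarrow> nat set set \<Rightarrow> matrix" where
  "mat n M = map (\<lambda>i. map (\<lambda>j. {i, j} \<in> M) [0..<n]) [0..<n]"

lemma encode_edges_eq: "encode_edges n M = enc (mat n M)"
  by (simp add: encode_edges_def mat_def enc_list_def enc_bool_def o_def)

lemma hd_or_Nil_drop: "i < length xss \<Longrightarrow> hd_or_Nil (drop i xss) = xss ! i"
  by (simp add: hd_or_Nil_def flip: Cons_nth_drop_Suc)

lemma hd_or_False_drop: "i < length bs \<Longrightarrow> hd_or_False (drop i bs) = bs ! i"
  by (simp add: hd_or_False_def flip: Cons_nth_drop_Suc)

lemma entry_mat: "i < n \<Longrightarrow> j < n \<Longrightarrow> entry (mat n M) i j \<longleftrightarrow> {i, j} \<in> M"
  by (simp add: entry_def mat_def hd_or_Nil_drop hd_or_False_drop)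

lemma verts_mat [simp]: "verts (mat n M) = [0..<n]"
  by (simp add: verts_def mat_def)

lemma distinct_concat_map:
  assumes "distinct xs" "\<And>x. x \<in> set xs \<Longrightarrow> distinct (f x)"
    "\<And>x y. x \<in> set xs \<Longrightarrow> y \<in> set xs \<Longrightarrow> x \<noteq> y \<Longrightarrow> set (f x) \<inter> set (f y) = {}"
  shows "distinct (concat (map f xs))"
  using assms
proof (induction xs)
  case (Cons x xs)
  have "set (f x) \<inter> set (f y) = {}" if "y \<in> set xs" for y
    using Cons.prems(1) Cons.prems(3)[of x y] that by auto
  moreover have "distinct (concat (map f xs))"
    using Cons.prems by (intro Cons.IH) auto
  ultimately show ?case using Cons.prems(2)[of x] by auto
qed simp

lemma fold_insert_set: "set (fold List.insert xs ys) = set xs \<union> set ys"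
  by (induction xs arbitrary: ys) auto

lemma fold_insert_distinct: "distinct ys \<Longrightarrow> distinct (fold List.insert xs ys)"
  by (induction xs arbitrary: ys) auto

text \<open>The rows are disjoint from each other and from \<open>ch\<close>, so the element taken
  from a row can be read off the resulting set. Different choices therefore give different sets,
  which later yields distinct outputs.\<close>

lemma choices_sets:
  assumes "\<And>r. r \<in> set rows \<Longrightarrow> r \<noteq> [] \<and> distinct r"
    and "sorted_wrt (\<lambda>r s. set r \<inter> set s = {}) rows"
    and "\<And>r. r \<in> set rows \<Longrightarrow> set r \<inter> set ch = {}"
  shows "distinct (map set (choices ch rows)) \<and> set (map set (choices ch rows)) =
    {C. set ch \<subseteq> C \<and> C \<subseteq> set ch \<union> (\<Union>r\<in>set rows. set r) \<and> (\<forall>r\<in>set rows. \<exists>!v. v \<in> C \<and> v \<in> set r)}"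
  using assms
proof (induction rows arbitrary: ch)
  case (Cons us rows)
  let ?R = "\<Union>r\<in>set rows. set r"
  define Q where "Q ch = {C. set ch \<subseteq> C \<and> C \<subseteq> set ch \<union> ?R \<and> (\<forall>r\<in>set rows. \<exists>!v. v \<in> C \<and> v \<in> set r)}" for ch
  have us: "us \<noteq> []" "distinct us" "set us \<inter> ?R = {}" "set us \<inter> set ch = {}" "?R \<inter> set ch = {}"
    using Cons.prems by auto
  have IH: "distinct (map set (choices (u # ch) rows))" "set (map set (choices (u # ch) rows)) = Q (u # ch)"
    if "u \<in> set us" for u
  proof -
    have "distinct (map set (choices (u # ch) rows)) \<and> set (map set (choices (u # ch) rows)) = Q (u # ch)"
      unfolding Q_def using Cons.prems that us(3) by (intro Cons.IH) auto
    then show "distinct (map set (choices (u # ch) rows))" "set (map set (choices (u # ch) rows)) = Q (u # ch)"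
      by auto
  qed
  have Qus: "v = u" if "u \<in> set us" "C \<in> Q (u # ch)" "v \<in> C" "v \<in> set us" for u v C
  proof -
    have "v \<in> insert u (set ch \<union> ?R)" using that(2,3) unfolding Q_def by auto
    moreover have "v \<notin> set ch" "v \<notin> ?R" using that(4) us(3,4) by blast+
    ultimately show ?thesis by blast
  qed
  have eq: "map set (choices ch (us # rows)) = concat (map (\<lambda>u. map set (choices (u # ch) rows)) (rev us))"
    using us(1) by (simp add: map_concat o_def)
  have "distinct (map set (choices ch (us # rows)))"
    unfolding eq
  proof (rule distinct_concat_map)
    fix u v assume uv: "u \<in> set (rev us)" "v \<in> set (rev us)" "u \<noteq> v"
    have "C \<notin> Q (v # ch)" if "C \<in> Q (u # ch)" for C
    proof
      assume "C \<in> Q (v # ch)"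
      moreover from this have "v \<in> C" by (simp add: Q_def)
      ultimately show False using Qus[of u C v] that uv by simp
    qed
    then show "set (map set (choices (u # ch) rows)) \<inter> set (map set (choices (v # ch) rows)) = {}"
      using IH(2) uv by auto
  qed (use us(2) IH(1) in auto)
  moreover have "set (map set (choices ch (us # rows))) = (\<Union>u\<in>set us. Q (u # ch))"
    unfolding eq using IH(2) by simp
  moreover have "(\<Union>u\<in>set us. Q (u # ch)) = {C. set ch \<subseteq> C \<and> C \<subseteq> set ch \<union> (set us \<union> ?R) \<and>
      (\<exists>!v. v \<in> C \<and> v \<in> set us) \<and> (\<forall>r\<in>set rows. \<exists>!v. v \<in> C \<and> v \<in> set r)}" (is "_ = ?rhs")
  proof
    show "(\<Union>u\<in>set us. Q (u # ch)) \<subseteq> ?rhs"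
    proof
      fix C assume "C \<in> (\<Union>u\<in>set us. Q (u # ch))"
      then obtain u where u: "u \<in> set us" "C \<in> Q (u # ch)" by blast
      then have "u \<in> C" by (simp add: Q_def)
      then have "\<exists>!v. v \<in> C \<and> v \<in> set us" using Qus[OF u] u(1) by blast
      moreover have "set ch \<subseteq> C" "C \<subseteq> set ch \<union> (set us \<union> ?R)" using u by (auto simp: Q_def)
      moreover have "\<forall>r\<in>set rows. \<exists>!v. v \<in> C \<and> v \<in> set r" using u(2) by (simp add: Q_def)
      ultimately show "C \<in> ?rhs" by (intro CollectI conjI)
    qed
    show "?rhs \<subseteq> (\<Union>u\<in>set us. Q (u # ch))"
    proof
      fix C assume C: "C \<in> ?rhs"
      then have ex: "\<exists>!v. v \<in> C \<and> v \<in> set us" by (elim CollectE conjE)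
      then obtain u where u: "u \<in> C" "u \<in> set us" by blast
      have uniq: "v = u" if "v \<in> C" "v \<in> set us" for v using ex u that by blast
      have "C \<subseteq> set ch \<union> (set us \<union> ?R)" using C by (elim CollectE conjE)
      then have "C \<subseteq> set (u # ch) \<union> ?R" using uniq by auto
      moreover have "set (u # ch) \<subseteq> C" using C u(1) by (elim CollectE conjE) simp
      moreover have "\<forall>r\<in>set rows. \<exists>!v. v \<in> C \<and> v \<in> set r" using C by (elim CollectE conjE)
      ultimately have "C \<in> Q (u # ch)" unfolding Q_def by (intro CollectI conjI)
      then show "C \<in> (\<Union>u\<in>set us. Q (u # ch))" using \<open>u \<in> set us\<close> by blast
    qed
  qed
  ultimately show ?case by simp
qed auto

context graph begin

section \<open>The input graph read from its matrix\<close>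

abbreviation "G \<equiv> mat n E"

lemma entry_G: "i < n \<Longrightarrow> j < n \<Longrightarrow> entry G i j \<longleftrightarrow> {i, j} \<in> E"
  by (rule entry_mat)

lemma set_nbrs: "v < n \<Longrightarrow> set (nbrs G v) = nb E v"
  using nb_lt by (auto simp: nbrs_def nb_def entry_G insert_commute dest: edge_lt)

lemma distinct_nbrs: "distinct (nbrs G v)"
  by (simp add: nbrs_def)

lemma pendant_iff: "v < n \<Longrightarrow> pendant G v \<longleftrightarrow> pend E v"
  using distinct_card[OF distinct_nbrs, of v] by (simp add: pendant_def pend_def set_nbrs)

lemma redundant_iff:
  assumes v: "v < n" shows "redundant G v \<longleftrightarrow> rep E v \<noteq> v"
proof
  assume "redundant G v"
  then obtain a u where p: "pend E v" and a: "a \<in> nb E v" and u: "u \<in> nb E a" "u < v" "pendant G u"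
    unfolding redundant_def using v nb_lt by (auto simp: set_nbrs pendant_iff)
  have pu: "pend E u" using u(2,3) v pendant_iff by simp
  have "nb E v = {a}" "nb E u = {a}"
    using pend_nb[OF p a] pend_nb[OF pu, of a] u(1) nb_sym[of u a] by auto
  then have "rep E v = rep E u" using p by (intro rep_cong) auto
  then show "rep E v \<noteq> v" using rep_pend(3)[OF pu] u(2) by simp
next
  assume ne: "rep E v \<noteq> v"
  then have p: "pend E v" using rep_not_pend by blast
  then obtain a where a: "nb E v = {a}" by (rule pendE)
  let ?u = "rep E v"
  have "?u < v" using ne rep_pend(3)[OF p] by simp
  moreover have "?u \<in> nb E a" using a nb_rep[of v] nb_sym[of ?u a] by simp
  moreover have "a < n" using a nb_lt[of a v] by simp
  moreover have "pendant G ?u" using rep_pend(1)[OF p] \<open>?u < v\<close> v pendant_iff by simp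
  ultimately show "redundant G v"
    unfolding redundant_def using p a v by (auto simp: set_nbrs pendant_iff)
qed

section \<open>The greedy vertex cover\<close>

lemma greedy_cover_invariant:
  assumes "set S \<subseteq> {..<n}" "distinct S" "\<And>C. vertex_cover {..<n} E C \<Longrightarrow> length S \<le> 2 * card (C \<inter> set S)"
    and "set es \<subseteq> {..<n} \<times> {..<n}" "S' = fold (cover_step G) es S"
  shows "set S' \<subseteq> {..<n} \<and> distinct S' \<and> (\<forall>C. vertex_cover {..<n} E C \<longrightarrow> length S' \<le> 2 * card (C \<inter> set S')) \<and>
    set S \<subseteq> set S' \<and> (\<forall>(i, j)\<in>set es. {i, j} \<in> E \<longrightarrow> i \<in> set S' \<or> j \<in> set S')"
  using assms
proof (induction es arbitrary: S)
  case (Cons e es)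
  obtain i j where e: "e = (i, j)" by (cases e)
  have ij: "i < n" "j < n" using Cons.prems(4) e by auto
  let ?T = "cover_step G e S"
  have T: "set S \<subseteq> set ?T \<and> set ?T \<subseteq> {..<n} \<and> distinct ?T \<and> ({i, j} \<in> E \<longrightarrow> i \<in> set ?T \<or> j \<in> set ?T) \<and>
    (\<forall>C. vertex_cover {..<n} E C \<longrightarrow> length ?T \<le> 2 * card (C \<inter> set ?T))"
  proof (cases "{i, j} \<in> E \<and> i \<notin> set S \<and> j \<notin> set S")
    case True
    then have T: "?T = i # j # S" using e ij by (auto simp: cover_step_def entry_G)
    \<comment> \<open>Two vertices are added, and every cover \<open>C\<close> contains one of them.
      Counting \<open>C\<close> only inside \<open>S\<close> makes the inequality inductive.\<close>
    have "length ?T \<le> 2 * card (C \<inter> set ?T)" if C: "vertex_cover {..<n} E C" for C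
    proof -
      from C True have "{i, j} \<inter> C \<noteq> {}" unfolding vertex_cover_def by blast
      then obtain x where x: "x \<in> C" "x \<in> {i, j}" by blast
      have "insert x (C \<inter> set S) \<subseteq> C \<inter> set ?T" using x T by auto
      then have "card (insert x (C \<inter> set S)) \<le> card (C \<inter> set ?T)" by (intro card_mono) auto
      moreover have "x \<notin> set S" using x(2) True by auto
      ultimately show ?thesis using Cons.prems(3)[OF C] T by simp
    qed
    then show ?thesis using T Cons.prems(1,2) True ij edge_lt[of i j] by auto
  next
    case False
    then have "?T = S" using e ij by (auto simp: cover_step_def entry_G)
    then show ?thesis using False Cons.prems(1-3) by auto
  qed
  have "set S' \<subseteq> {..<n} \<and> distinct S' \<and> (\<forall>C. vertex_cover {..<n} E C \<longrightarrow> length S' \<le> 2 * card (C \<inter> set S')) \<and>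
    set ?T \<subseteq> set S' \<and> (\<forall>(i, j)\<in>set es. {i, j} \<in> E \<longrightarrow> i \<in> set S' \<or> j \<in> set S')"
    using T Cons.prems(4,5) by (intro Cons.IH) auto
  then show ?case using T e by auto
qed auto

lemma greedy_cover:
  shows greedy_cover_lt: "set (greedy_cover G) \<subseteq> {..<n}"
    and greedy_cover_distinct: "distinct (greedy_cover G)"
    and greedy_cover_edge: "e \<in> E \<Longrightarrow> e \<inter> set (greedy_cover G) \<noteq> {}"
    and greedy_cover_length: "length (greedy_cover G) \<le> 2 * vertex_cover_number {..<n} E"
proof -
  let ?S = "greedy_cover G"
  let ?es = "concat (map (\<lambda>i. map (\<lambda>j. (i, j)) (verts G)) (verts G))"
  have es: "set ?es = {..<n} \<times> {..<n}" by auto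
  have inv: "set ?S \<subseteq> {..<n} \<and> distinct ?S \<and> (\<forall>C. vertex_cover {..<n} E C \<longrightarrow> length ?S \<le> 2 * card (C \<inter> set ?S)) \<and>
    set [] \<subseteq> set ?S \<and> (\<forall>(i, j)\<in>set ?es. {i, j} \<in> E \<longrightarrow> i \<in> set ?S \<or> j \<in> set ?S)"
    by (rule greedy_cover_invariant[of "[]"]) (auto simp: greedy_cover_def)
  then show "set ?S \<subseteq> {..<n}" "distinct ?S" by auto
  show "e \<inter> set ?S \<noteq> {}" if e: "e \<in> E" for e
  proof -
    obtain i j where ij: "e = {i, j}" "i < n" "j < n" using e by (rule edgeE)
    then have "(i, j) \<in> set ?es" unfolding es by simp
    then show ?thesis using inv e ij(1) by fastforce
  qed
  have "vertex_cover {..<n} E {..<n}" unfolding vertex_cover_def by (auto elim!: edgeE)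
  then have "\<exists>k. \<exists>S. vertex_cover {..<n} E S \<and> card S = k" by blast
  note LeastI_ex[OF this]
  then obtain C where C: "vertex_cover {..<n} E C" "card C = vertex_cover_number {..<n} E"
    unfolding vertex_cover_number_def by blast
  have "length ?S \<le> 2 * card (C \<inter> set ?S)" using inv C(1) by blast
  also have "card (C \<inter> set ?S) \<le> card C"
    using C(1) by (intro card_mono) (auto simp: vertex_cover_def intro: finite_subset)
  finally show "length ?S \<le> 2 * vertex_cover_number {..<n} E" using C(2) by simp
qed

lemma set_cover_first: "set (cover_first G) = {..<n}"
  using greedy_cover_lt by (auto simp: cover_first_def)

lemma distinct_cover_first: "distinct (cover_first G)"
  using greedy_cover_distinct by (auto simp: cover_first_def)

section \<open>Lists of proper partial colourings\<close>

definition true_set :: "colouring \<Rightarrow> nat set" where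
  "true_set P = {v. (v, True) \<in> set P}"

lemma colouring_eq:
  assumes "distinct (map fst P)"
  shows "P = map (\<lambda>v. (v, v \<in> true_set P)) (map fst P)"
proof (rule nth_equalityI)
  fix i assume i: "i < length P"
  obtain v b where vb: "P ! i = (v, b)" by (cases "P ! i")
  have "b \<longleftrightarrow> v \<in> true_set P"
    using eq_key_imp_eq_value[OF assms, of v b True] nth_mem[OF i] vb by (cases b) (auto simp: true_set_def)
  then show "P ! i = map (\<lambda>v. (v, v \<in> true_set P)) (map fst P) ! i" using i vb by simp
qed simp

lemma true_set_map: "true_set (map (\<lambda>v. (v, v \<in> T)) vs) = set vs \<inter> T"
  by (auto simp: true_set_def)

lemma true_set_subset: "true_set P \<subseteq> set (map fst P)"
  by (force simp: true_set_def)

lemma proper_iff: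
  assumes P: "distinct (map fst P)" "set (map fst P) \<subseteq> {..<n}"
  shows "proper G P \<longleftrightarrow> normal (set (map fst P)) (true_set P)"
proof -
  let ?W = "set (map fst P)" and ?T = "true_set P"
  have val: "b \<longleftrightarrow> v \<in> ?T" if "(v, b) \<in> set P" for v b
    using eq_key_imp_eq_value[OF P(1), of v b True] that by (cases b) (auto simp: true_set_def)
  have mem: "(v, b) \<in> set P \<longleftrightarrow> v \<in> ?W \<and> b = (v \<in> ?T)" for v b
  proof
    assume "(v, b) \<in> set P"
    then show "v \<in> ?W \<and> b = (v \<in> ?T)" using val by force
  next
    assume vb: "v \<in> ?W \<and> b = (v \<in> ?T)"
    then obtain b' where "(v, b') \<in> set P" by auto
    then show "(v, b) \<in> set P" using val vb by blast
  qed
  have cross: "length (crossing G P (v, v \<in> ?T)) = card (crossing_nbs ?W ?T v)"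
    "crossing G P (v, v \<in> ?T) = [] \<longleftrightarrow> crossing_nbs ?W ?T v = {}" if "v \<in> ?W" for v
  proof -
    have "set (map fst (crossing G P (v, v \<in> ?T))) = crossing_nbs ?W ?T v" (is "?l = ?r")
    proof (rule set_eqI)
      fix y
      have "y \<in> ?l \<longleftrightarrow> (\<exists>b. (y, b) \<in> set P \<and> entry G v y \<and> (v \<in> ?T) \<noteq> b)"
        by (force simp: crossing_def)
      also have "\<dots> \<longleftrightarrow> y \<in> ?W \<and> entry G v y \<and> (v \<in> ?T) \<noteq> (y \<in> ?T)" unfolding mem by auto
      also have "\<dots> \<longleftrightarrow> y \<in> ?r"
      proof (cases "y \<in> ?W")
        case True
        then have "v < n" "y < n" using that P(2) by auto
        then show ?thesis using True by (simp add: crossing_nbs_def nb_def entry_G insert_commute)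
      qed (simp add: crossing_nbs_def)
      finally show "y \<in> ?l \<longleftrightarrow> y \<in> ?r" .
    qed
    moreover have "distinct (map fst (crossing G P (v, v \<in> ?T)))"
      unfolding crossing_def by (rule distinct_map_filter[OF P(1)])
    ultimately show "length (crossing G P (v, v \<in> ?T)) = card (crossing_nbs ?W ?T v)"
      "crossing G P (v, v \<in> ?T) = [] \<longleftrightarrow> crossing_nbs ?W ?T v = {}"
      by (metis distinct_card length_map, auto)
  qed
  have nbrs: "nbrs G v = [] \<longleftrightarrow> nb E v = {}" if "v \<in> ?W" for v
    using set_nbrs[of v] that P(2) by (metis lessThan_iff set_empty subsetD)
  have "proper G P \<longleftrightarrow> (\<forall>v\<in>?W. (if v = 0 then v \<notin> ?T else nbrs G v = [] \<longrightarrow> v \<in> ?T) \<and>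
     length (crossing G P (v, v \<in> ?T)) \<le> 1 \<and> (redundant G v \<longrightarrow> crossing G P (v, v \<in> ?T) = []))"
    (is "_ = (\<forall>v\<in>?W. ?Q v)")
  proof -
    have "proper G P \<longleftrightarrow> (\<forall>v b. (v, b) \<in> set P \<longrightarrow> (if v = 0 then \<not> b else nbrs G v = [] \<longrightarrow> b) \<and>
      length (crossing G P (v, b)) \<le> 1 \<and> (redundant G v \<longrightarrow> crossing G P (v, b) = []))"
      unfolding proper_def by (simp add: Ball_def split_paired_All)
    then show ?thesis unfolding mem by blast
  qed
  also have "\<dots> \<longleftrightarrow> normal ?W ?T"
    unfolding normal_def
  proof (rule ball_cong[OF refl])
    fix v assume v: "v \<in> ?W"
    then have "v < n" using P(2) by auto
    then show "?Q v \<longleftrightarrow> (if v = 0 then v \<notin> ?T else nb E v = {} \<longrightarrow> v \<in> ?T) \<and>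
      card (crossing_nbs ?W ?T v) \<le> 1 \<and> (rep E v \<noteq> v \<longrightarrow> crossing_nbs ?W ?T v = {})"
      by (simp only: cross[OF v] nbrs[OF v] redundant_iff)
  qed
  finally show ?thesis .
qed

text \<open>Uncolouring a vertex only shrinks the crossing lists. Hence filtering after every
  extension loses no proper colouring of the full vertex set.\<close>

lemma proper_tl:
  assumes "proper G (x # P)" shows "proper G P"
  unfolding proper_def
proof
  fix y assume y: "y \<in> set P"
  have le: "length (crossing G P y) \<le> length (crossing G (x # P) y)"
    by (simp add: crossing_def)
  then have "crossing G (x # P) y = [] \<Longrightarrow> crossing G P y = []" by simp
  with le y show "(if fst y = 0 then \<not> snd y else nbrs G (fst y) = [] \<longrightarrow> snd y) \<and>
      length (crossing G P y) \<le> 1 \<and> (redundant G (fst y) \<longrightarrow> crossing G P y = [])"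
    using assms le_trans[OF le] unfolding proper_def by simp
qed

lemma fold_extend:
  assumes "distinct vs" "set vs \<subseteq> {..<n}" "Ps = fold (extend G) vs [[]]"
  shows "distinct Ps \<and> set Ps = {P. map fst P = rev vs \<and> proper G P}"
  using assms
proof (induction vs arbitrary: Ps rule: rev_induct)
  case Nil
  then show ?case by (auto simp: proper_def)
next
  case (snoc v vs)
  define Qs where "Qs = fold (extend G) vs [[]]"
  have Qs: "distinct Qs" "set Qs = {P. map fst P = rev vs \<and> proper G P}"
    using snoc.IH[of Qs] snoc.prems by (auto simp: Qs_def)
  have Ps: "Ps = filter (proper G) (concat (map (\<lambda>P. [(v, True) # P, (v, False) # P]) Qs))"
    unfolding extend_def[symmetric] by (simp add: snoc.prems(3) Qs_def)
  have "distinct (concat (map (\<lambda>P. [(v, True) # P, (v, False) # P]) Qs))"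
    by (rule distinct_concat_map[OF Qs(1)]) auto
  then have "distinct Ps" unfolding Ps by simp
  moreover have "set Ps = {P. map fst P = rev (vs @ [v]) \<and> proper G P}"
  proof (rule set_eqI)
    fix P
    have "P \<in> set Ps \<longleftrightarrow> proper G P \<and> (\<exists>Q b. P = (v, b) # Q \<and> Q \<in> set Qs)"
      unfolding Ps by (auto simp: ex_bool_eq)
    also have "\<dots> \<longleftrightarrow> proper G P \<and> (\<exists>Q b. P = (v, b) # Q \<and> map fst Q = rev vs)"
      unfolding Qs(2) using proper_tl by blast
    also have "\<dots> \<longleftrightarrow> P \<in> {P. map fst P = rev (vs @ [v]) \<and> proper G P}"
      by (cases P) auto
    finally show "P \<in> set Ps \<longleftrightarrow> P \<in> {P. map fst P = rev (vs @ [v]) \<and> proper G P}" .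
  qed
  ultimately show ?case by simp
qed

text \<open>A colouring whose vertices are prescribed is determined by its \<open>true_set\<close>,
  which is normal, so that \<open>card_normal\<close> bounds the list.\<close>

lemma length_fold_extend:
  assumes vs: "distinct vs" "set vs \<subseteq> {..<n}"
    and S: "S \<subseteq> set vs" "\<And>v. v \<in> set vs - S \<Longrightarrow> nb E v \<subseteq> S"
  shows "length (fold (extend G) vs [[]]) \<le> 2 ^ (3 * card S)"
proof -
  let ?Ps = "fold (extend G) vs [[]]"
  have Ps: "distinct ?Ps" "set ?Ps = {P. map fst P = rev vs \<and> proper G P}"
    using fold_extend[OF vs refl] by auto
  have fin: "finite {T. T \<subseteq> set vs \<and> normal (set vs) T}"
    by (rule finite_subset[of _ "Pow (set vs)"]) auto
  have "inj_on true_set (set ?Ps)"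
  proof (rule inj_onI)
    fix P Q assume PQ: "P \<in> set ?Ps" "Q \<in> set ?Ps" "true_set P = true_set Q"
    then have "map fst P = rev vs" "map fst Q = rev vs" unfolding Ps(2) by auto
    then show "P = Q" using colouring_eq[of P] colouring_eq[of Q] vs(1) PQ(3) by simp
  qed
  moreover have "true_set ` set ?Ps \<subseteq> {T. T \<subseteq> set vs \<and> normal (set vs) T}"
  proof
    fix T assume "T \<in> true_set ` set ?Ps"
    then obtain P where P: "map fst P = rev vs" "proper G P" "T = true_set P" unfolding Ps(2) by auto
    then show "T \<in> {T. T \<subseteq> set vs \<and> normal (set vs) T}"
      using proper_iff[of P] true_set_subset[of P] vs by simp
  qed
  ultimately have "card (set ?Ps) \<le> card {T. T \<subseteq> set vs \<and> normal (set vs) T}"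
    using fin by (rule card_inj_on_le)
  also have "\<dots> \<le> 2 ^ (3 * card S)" by (rule card_normal[OF _ S]) auto
  finally show ?thesis using distinct_card[OF Ps(1)] by simp
qed

lemma set_colourings: "set (colourings G) = {P. map fst P = rev (cover_first G) \<and> proper G P}"
  using fold_extend[OF distinct_cover_first _ refl] set_cover_first by (simp add: colourings_def)

lemma cut_matrix_eq:
  assumes "map fst P = rev (cover_first G)"
  shows "cut_matrix G P = mat n (cut E (\<lambda>v. v \<in> true_set P))"
proof -
  have d: "distinct (map fst P)" using assms distinct_cover_first by simp
  have W: "set (map fst P) = {..<n}" using assms set_cover_first by simp
  have mem: "(v, b) \<in> set P \<longleftrightarrow> b = (v \<in> true_set P)" if "v < n" for v b
  proof -
    have "set P = set (map (\<lambda>v. (v, v \<in> true_set P)) (map fst P))"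
      using colouring_eq[OF d] by (rule arg_cong)
    also have "\<dots> = (\<lambda>v. (v, v \<in> true_set P)) ` {..<n}" unfolding W[symmetric] by (rule set_map)
    finally show ?thesis using that by auto
  qed
  have "entry G i j \<and> (\<exists>x\<in>set P. \<exists>y\<in>set P. fst x = i \<and> fst y = j \<and> snd x \<noteq> snd y) \<longleftrightarrow>
      {i, j} \<in> cut E (\<lambda>v. v \<in> true_set P)"
    if "i < n" "j < n" for i j
  proof -
    have "(\<exists>x\<in>set P. \<exists>y\<in>set P. fst x = i \<and> fst y = j \<and> snd x \<noteq> snd y) \<longleftrightarrow>
        (\<exists>b c. (i, b) \<in> set P \<and> (j, c) \<in> set P \<and> b \<noteq> c)" by force
    then show ?thesis using mem that by (simp add: entry_G cut_iff)
  qed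
  then show ?thesis
    unfolding cut_matrix_def verts_mat mat_def[of n "cut E (\<lambda>v. v \<in> true_set P)"]
    by (intro map_cong refl) simp
qed

section \<open>The computed list of canonical cuts\<close>

definition canonical_list :: "nat set set list" where
  "canonical_list = fold List.insert (map (\<lambda>P. cut E (\<lambda>v. v \<in> true_set P))
     (filter (\<lambda>P. true_set P \<noteq> {}) (colourings G))) []"

lemma submatrix_iff: "M \<subseteq> E \<Longrightarrow> submatrix G (mat n M) (mat n N) \<longleftrightarrow> M \<subseteq> N"
proof
  assume M: "M \<subseteq> E" and sub: "submatrix G (mat n M) (mat n N)"
  show "M \<subseteq> N"
  proof
    fix e assume e: "e \<in> M"
    with M have "e \<in> E" by blast
    then obtain i j where "e = {i, j}" "i < n" "j < n" by (rule edgeE)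
    then show "e \<in> N" using sub e by (auto simp: submatrix_def entry_mat)
  qed
next
  assume "M \<subseteq> N"
  then show "submatrix G (mat n M) (mat n N)" by (auto simp: submatrix_def entry_mat)
qed

lemma insert_new_eq:
  assumes "M \<subseteq> E" "\<And>N. N \<in> set Ns \<Longrightarrow> N \<subseteq> E"
  shows "insert_new G (mat n M) (map (mat n) Ns) = map (mat n) (List.insert M Ns)"
proof -
  have "(\<exists>N\<in>set (map (mat n) Ns). submatrix G (mat n M) N \<and> submatrix G N (mat n M)) \<longleftrightarrow> M \<in> set Ns"
    using assms by (auto simp: submatrix_iff)
  then show ?thesis by (simp add: insert_new_def List.insert_def)
qed

lemma fold_insert_new:
  assumes "\<And>M. M \<in> set Ms \<Longrightarrow> M \<subseteq> E" "\<And>N. N \<in> set Ns \<Longrightarrow> N \<subseteq> E"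
  shows "fold (insert_new G) (map (mat n) Ms) (map (mat n) Ns) = map (mat n) (fold List.insert Ms Ns)"
  using assms
proof (induction Ms arbitrary: Ns)
  case (Cons M Ms)
  have "insert_new G (mat n M) (map (mat n) Ns) = map (mat n) (List.insert M Ns)"
    using Cons.prems by (intro insert_new_eq) auto
  moreover have "fold (insert_new G) (map (mat n) Ms) (map (mat n) (List.insert M Ns)) =
      map (mat n) (fold List.insert Ms (List.insert M Ns))"
    using Cons.prems by (intro Cons.IH) auto
  ultimately show ?case by simp
qed simp

lemma canonical_cuts_eq: "canonical_cuts G (colourings G) = map (mat n) canonical_list"
proof -
  let ?Ps = "filter (\<lambda>P. true_set P \<noteq> {}) (colourings G)"
  have eq1: "filter (\<lambda>P. \<exists>x\<in>set P. snd x) (colourings G) = ?Ps"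
    by (intro filter_cong refl) (force simp: true_set_def)
  have eq2: "map (cut_matrix G) ?Ps = map (mat n) (map (\<lambda>P. cut E (\<lambda>v. v \<in> true_set P)) ?Ps)"
    using cut_matrix_eq by (simp add: set_colourings)
  have "fold (insert_new G) (map (mat n) (map (\<lambda>P. cut E (\<lambda>v. v \<in> true_set P)) ?Ps)) (map (mat n) []) =
      map (mat n) (fold List.insert (map (\<lambda>P. cut E (\<lambda>v. v \<in> true_set P)) ?Ps) [])"
    by (rule fold_insert_new) (auto simp: cut_def)
  then show ?thesis
    unfolding canonical_cuts_def canonical_list_def eq1 eq2 by (simp only: list.map)
qed

lemma distinct_canonical_list: "distinct canonical_list"
  by (simp add: canonical_list_def fold_insert_distinct)

lemma set_canonical_list: "set canonical_list = canonical"
proof -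
  have *: "true_set ` {P. map fst P = rev (cover_first G) \<and> proper G P} = {T. T \<subseteq> {..<n} \<and> normal {..<n} T}"
    (is "_ ` ?A = ?B")
  proof
    show "true_set ` ?A \<subseteq> ?B"
    proof
      fix T assume "T \<in> true_set ` ?A"
      then obtain P where P: "map fst P = rev (cover_first G)" "proper G P" "T = true_set P" by auto
      have "distinct (map fst P)" "set (map fst P) = {..<n}"
        using P(1) distinct_cover_first set_cover_first by simp_all
      then show "T \<in> ?B" using P(2,3) proper_iff[of P] true_set_subset[of P] by simp
    qed
    show "?B \<subseteq> true_set ` ?A"
    proof
      fix T assume T: "T \<in> ?B"
      define P where "P = map (\<lambda>v. (v, v \<in> T)) (rev (cover_first G))"
      have fst: "map fst P = rev (cover_first G)" by (simp add: P_def o_def)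
      have tr: "true_set P = T" using T set_cover_first by (auto simp: P_def true_set_map)
      have "distinct (map fst P)" "set (map fst P) = {..<n}"
        using fst distinct_cover_first set_cover_first by simp_all
      then have "proper G P" using proper_iff[of P] T tr by simp
      then show "T \<in> true_set ` ?A" using fst tr by blast
    qed
  qed
  have "set canonical_list = (\<lambda>T. cut E (\<lambda>v. v \<in> T)) ` {T \<in> true_set ` set (colourings G). T \<noteq> {}}"
    by (auto simp: canonical_list_def fold_insert_set)
  also have "\<dots> = canonical" unfolding set_colourings * canonical_eq by (intro image_cong) auto
  finally show ?thesis .
qed

lemma minimal_cuts_eq:
  "minimal_cuts G (map (mat n) canonical_list) =
     map (mat n) (filter (\<lambda>M. \<forall>N\<in>canonical. N \<subseteq> M \<longrightarrow> M \<subseteq> N) canonical_list)"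
proof -
  have E: "M \<subseteq> E" if "M \<in> canonical" for M
    using that matching_cut_subset by (auto simp: canonical_def)
  show ?thesis unfolding minimal_cuts_def filter_map o_def
    by (rule arg_cong[of _ _ "map (mat n)"], rule filter_cong[OF refl])
      (simp add: set_canonical_list submatrix_iff E)
qed

lemma maximal_cuts_eq:
  "maximal_cuts G (map (mat n) canonical_list) =
     map (mat n) (filter (\<lambda>M. \<forall>N\<in>canonical. M \<subseteq> N \<longrightarrow> N \<subseteq> M) canonical_list)"
proof -
  have E: "M \<subseteq> E" if "M \<in> canonical" for M
    using that matching_cut_subset by (auto simp: canonical_def)
  show ?thesis unfolding maximal_cuts_def filter_map o_def
    by (rule arg_cong[of _ _ "map (mat n)"], rule filter_cong[OF refl])
      (simp add: set_canonical_list submatrix_iff E)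
qed

section \<open>Expanding a canonical cut\<close>

lemma swap_pendants_eq:
  assumes M: "M \<subseteq> E"
  shows "swap_pendants G (mat n M) ch = mat n (swap M (set ch))"
proof -
  have "(if pendant G i \<or> pendant G j then entry G i j \<and> (\<exists>c\<in>set ch. c = i \<or> c = j) else entry (mat n M) i j)
      \<longleftrightarrow> {i, j} \<in> swap M (set ch)" if "i < n" "j < n" for i j
    using that M by (auto simp: pendant_iff entry_mat swap_def)
  then show ?thesis unfolding swap_pendants_def verts_mat mat_def[of n "swap M (set ch)"]
    by (intro map_cong refl) auto
qed

lemma choices_valid:
  assumes M: "M \<in> canonical"
  defines "Cs \<equiv> map set (choices [] (pendant_rows G (mat n M)))"
  shows "distinct Cs" "set Cs = {C. valid M C}"
proof -
  define As where "As = filter (\<lambda>a. \<exists>u\<in>set (nbrs G a). pendant G u \<and> entry (mat n M) a u) [0..<n]"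
  have opts: "pendant_rows G (mat n M) = map (\<lambda>a. filter (pendant G) (nbrs G a)) As"
    by (simp add: pendant_rows_def As_def)
  have As: "set As = active M"
  proof (rule set_eqI)
    fix a
    show "a \<in> set As \<longleftrightarrow> a \<in> active M"
    proof (cases "a < n")
      case True
      have "u \<in> nb E a \<Longrightarrow> u < n" for u using nb_lt by blast
      then show ?thesis using True by (auto simp: As_def active_def set_nbrs pendant_iff entry_mat)
    next
      case False
      then show ?thesis using nb_lt by (auto simp: As_def active_def)
    qed
  qed
  have row: "set (filter (pendant G) (nbrs G a)) = {v \<in> nb E a. pend E v}" if "a \<in> active M" for a
  proof -
    have "a < n" using that nb_lt by (auto simp: active_def)
    then show ?thesis using nb_lt by (auto simp: set_nbrs pendant_iff)
  qed
  have "distinct Cs \<and> set Cs = {C. set [] \<subseteq> C \<and>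
      C \<subseteq> set [] \<union> (\<Union>r\<in>set (pendant_rows G (mat n M)). set r) \<and>
      (\<forall>r\<in>set (pendant_rows G (mat n M)). \<exists>!v. v \<in> C \<and> v \<in> set r)}"
    unfolding Cs_def
  proof (rule choices_sets)
    fix r assume "r \<in> set (pendant_rows G (mat n M))"
    then obtain a where a: "a \<in> active M" "r = filter (pendant G) (nbrs G a)" unfolding opts As[symmetric] by auto
    have "set r \<noteq> {}" unfolding a(2) row[OF a(1)] using a(1) by (auto simp: active_def)
    then have "r \<noteq> []" by auto
    moreover have "distinct r" unfolding a(2) by (simp add: distinct_nbrs)
    ultimately show "r \<noteq> [] \<and> distinct r" ..
  next
    have "sorted_wrt (<) As" unfolding As_def by (intro sorted_wrt_filter sorted_wrt_upt)
    then show "sorted_wrt (\<lambda>r s. set r \<inter> set s = {}) (pendant_rows G (mat n M))"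
      unfolding opts sorted_wrt_map
    proof (rule sorted_wrt_mono_rel[rotated])
      \<comment> \<open>A pendant vertex has a single neighbour, so it cannot occur in the rows of
        two different vertices.\<close>
      fix a b assume ab: "a \<in> set As" "b \<in> set As" "a < b"
      have False if "v \<in> nb E a" "v \<in> nb E b" "pend E v" for v
        using that pend_nb[of v a] pend_nb[of v b] nb_sym[of v a] nb_sym[of v b] ab(3) by auto
      then show "set (filter (pendant G) (nbrs G a)) \<inter> set (filter (pendant G) (nbrs G b)) = {}"
        using row ab(1,2) unfolding As by blast
    qed
  qed simp
  moreover have "valid M C \<longleftrightarrow> C \<subseteq> (\<Union>r\<in>set (pendant_rows G (mat n M)). set r) \<and>
      (\<forall>r\<in>set (pendant_rows G (mat n M)). \<exists>!v. v \<in> C \<and> v \<in> set r)" for C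
  proof -
    have U: "(\<Union>r\<in>set (pendant_rows G (mat n M)). set r) = (\<Union>a\<in>active M. {v \<in> nb E a. pend E v})"
      unfolding opts As[symmetric] using row As by auto
    have rows: "(\<forall>r\<in>set (pendant_rows G (mat n M)). \<exists>!v. v \<in> C \<and> v \<in> set r) \<longleftrightarrow>
        (\<forall>a\<in>active M. \<exists>!v. v \<in> C \<and> v \<in> {v \<in> nb E a. pend E v})"
      unfolding opts set_map As by (simp only: ball_simps row cong: ball_cong)
    have unique: "(\<exists>!v. v \<in> C \<and> v \<in> {v \<in> nb E a. pend E v}) \<longleftrightarrow> (\<exists>!v. v \<in> C \<and> v \<in> nb E a)"
      if "\<forall>v\<in>C. pend E v" for a using that by auto
    have sub: "C \<subseteq> (\<Union>a\<in>active M. {v \<in> nb E a. pend E v}) \<longleftrightarrow> (\<forall>v\<in>C. pend E v \<and> (\<exists>a\<in>active M. v \<in> nb E a))"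
      by auto
    show ?thesis
    proof (cases "\<forall>v\<in>C. pend E v")
      case True
      show ?thesis unfolding U rows sub valid_def by (simp only: unique[OF True])
    next
      case False
      then show ?thesis unfolding U sub valid_def by blast
    qed
  qed
  ultimately show "distinct Cs" "set Cs = {C. valid M C}" by auto
qed

text \<open>No cut is listed twice: within one canonical cut \<open>swap\<close> is injective on the
  valid sets, and lifts of different canonical cuts differ because \<open>rep_edges\<close> recovers
  the canonical cut.\<close>

lemma enumeration_correct:
  assumes sel: "sel G (map (mat n) canonical_list) = map (mat n) (filter P canonical_list)"
  shows "\<exists>Ms. distinct Ms \<and> set Ms = \<Union> (lifts ` {M \<in> canonical. P M}) \<and> enumeration sel G = map (mat n) Ms"
proof -
  let ?L = "\<lambda>M. map (swap M) (map set (choices [] (pendant_rows G (mat n M))))"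
  let ?Ks = "filter P canonical_list"
  have Ks: "set ?Ks = {M \<in> canonical. P M}" by (auto simp: set_canonical_list)
  have L: "distinct (?L M)" "set (?L M) = lifts M" if M: "M \<in> set ?Ks" for M
  proof -
    have M: "M \<in> canonical" using M unfolding Ks by simp
    show "distinct (?L M)" "set (?L M) = lifts M"
      using choices_valid[OF M] swap_inj[of M] lifts_eq[OF M] by (simp_all only: distinct_map set_map simp_thms)
  qed
  have "distinct (concat (map ?L ?Ks))"
  proof (rule distinct_concat_map)
    show "distinct ?Ks" using distinct_canonical_list by simp
    show "set (?L M) \<inter> set (?L N) = {}" if "M \<in> set ?Ks" "N \<in> set ?Ks" "M \<noteq> N" for M N
      unfolding L(2)[OF that(1)] L(2)[OF that(2)] by (rule lifts_disjoint[OF that(3)])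
  qed (rule L(1))
  moreover have "set (concat (map ?L ?Ks)) = \<Union> (lifts ` {M \<in> canonical. P M})"
    using L(2) unfolding Ks[symmetric] set_concat set_map image_image by simp
  moreover have "enumeration sel G = map (mat n) (concat (map ?L ?Ks))"
  proof -
    have "map (swap_pendants G (mat n M)) cs = map (mat n) (map (swap M) (map set cs))"
      if "M \<in> set ?Ks" for M cs
    proof -
      have "M \<in> canonical" using that unfolding Ks by simp
      then have "M \<subseteq> E" using matching_cut_subset by (auto simp: canonical_def)
      then show ?thesis using swap_pendants_eq by simp
    qed
    then have eq: "map (\<lambda>M. map (swap_pendants G (mat n M)) (choices [] (pendant_rows G (mat n M)))) ?Ks =
        map (\<lambda>M. map (mat n) (?L M)) ?Ks" by (intro map_cong refl)
    have "enumeration sel G =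
        concat (map (\<lambda>M. map (swap_pendants G (mat n M)) (choices [] (pendant_rows G (mat n M)))) ?Ks)"
      by (simp add: enumeration_def canonical_cuts_eq sel o_def)
    also have "\<dots> = concat (map (\<lambda>M. map (mat n) (?L M)) ?Ks)" by (simp only: eq)
    also have "\<dots> = map (mat n) (concat (map ?L ?Ks))" by (simp add: map_concat o_def)
    finally show ?thesis .
  qed
  ultimately show ?thesis by blast
qed

subsection \<open>Size bounds\<close>

lemma sz_mat: "sz (mat n M) \<le> n * (2 * n + 1)"
proof -
  have "sz (map (\<lambda>j. {i, j} \<in> M) [0..<n]) \<le> n * 2" for i
    using sz_list_le[of "map (\<lambda>j. {i, j} \<in> M) [0..<n]" 1] sz_bool_le by simp
  then show ?thesis
    using sz_list_le[of "mat n M" "n * 2"] by (force simp: mat_def mult.commute)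
qed

lemma sz_colourings:
  assumes k: "k \<le> n"
  shows "sz (fold (extend G) (take k (cover_first G)) [[]]) \<le>
    2 ^ (6 * vertex_cover_number {..<n} E) * (n * (n + 3) + 1)"
proof -
  let ?vs = "take k (cover_first G)" and ?S = "set (greedy_cover G)" and ?t = "vertex_cover_number {..<n} E"
  have vs: "distinct ?vs" "set ?vs \<subseteq> {..<n}"
    using distinct_cover_first set_cover_first set_take_subset[of k "cover_first G"] by simp_all
  have cardS: "card ?S \<le> 2 * ?t"
    using greedy_cover_length distinct_card[OF greedy_cover_distinct] by simp
  have "length (fold (extend G) ?vs [[]]) \<le> 2 ^ (6 * ?t)"
  \<comment> \<open>A short prefix consists of cover vertices only and serves itself as the set
    \<open>S\<close> of the count; a longer one contains the whole cover. The exponent is 6 because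
    the cover has at most twice \<tau> vertices.\<close>
  proof (cases "k \<le> length (greedy_cover G)")
    case True
    then have "set ?vs \<subseteq> ?S" by (auto simp: cover_first_def dest: in_set_takeD)
    then have "card (set ?vs) \<le> 2 * ?t" using card_mono[of ?S "set ?vs"] cardS by simp
    then have "(2::nat) ^ (3 * card (set ?vs)) \<le> 2 ^ (6 * ?t)" by (intro power_increasing) auto
    moreover have "length (fold (extend G) ?vs [[]]) \<le> 2 ^ (3 * card (set ?vs))"
      by (rule length_fold_extend[OF vs]) auto
    ultimately show ?thesis by (rule order_trans[rotated])
  next
    case False
    then have S: "?S \<subseteq> set ?vs" by (simp add: cover_first_def)
    have "nb E v \<subseteq> ?S" if "v \<in> set ?vs - ?S" for v
      using that greedy_cover_edge by (fastforce simp: nb_def)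
    then have "length (fold (extend G) ?vs [[]]) \<le> 2 ^ (3 * card ?S)"
      by (intro length_fold_extend vs S)
    also have "\<dots> \<le> 2 ^ (6 * ?t)" using cardS by (intro power_increasing) auto
    finally show ?thesis .
  qed
  moreover have "sz P \<le> n * (n + 3)" if P: "P \<in> set (fold (extend G) ?vs [[]])" for P
  proof -
    have fst: "map fst P = rev ?vs" using fold_extend[OF vs refl] P by simp
    have "sz x \<le> n + 2" if x: "x \<in> set P" for x
    proof -
      have "fst x \<in> set (map fst P)" using x by simp
      then have "fst x < n" unfolding fst using vs(2) by auto
      then show ?thesis using sz_bool_le[of "snd x"] by (cases x) simp
    qed
    then have "sz P \<le> length P * (n + 2 + 1)" by (rule sz_list_le)
    moreover have "length P \<le> n"
      using arg_cong[OF fst, of length] k by simp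
    then have "length P * (n + 2 + 1) \<le> n * (n + 2 + 1)" by (rule mult_right_mono) simp
    ultimately show ?thesis by (simp add: algebra_simps)
  qed
  then have "sz (fold (extend G) ?vs [[]]) \<le> length (fold (extend G) ?vs [[]]) * (n * (n + 3) + 1)"
    by (rule sz_list_le)
  ultimately show ?thesis by (meson le_trans mult_right_mono zero_le)
qed

lemma length_cover_first: "length (cover_first G) = n"
  using distinct_card[OF distinct_cover_first] set_cover_first by simp

lemma search_bound_le:
  "search_bound G + 2 \<le> 2 ^ (6 * vertex_cover_number {..<n} E) * (n + 2) ^ 5"
proof -
  let ?K = "2 ^ (6 * vertex_cover_number {..<n} E) :: nat"
  have "(\<Sum>k\<le>length (cover_first G). sz (fold (extend G) (take k (cover_first G)) [[]]))
      \<le> (\<Sum>k\<le>n. ?K * (n * (n + 3) + 1))"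
    unfolding length_cover_first by (intro sum_mono sz_colourings) simp
  then have "search_bound G + 2 \<le> n * (2 * n + 1) + (n + 1) * (?K * (n * (n + 3) + 1)) + 2"
    using sz_mat[of E] unfolding search_bound_def by simp
  also have "\<dots> \<le> ?K * (n * (2 * n + 1)) + (n + 1) * (?K * (n * (n + 3) + 1)) + ?K * 2"
    by (intro add_mono) auto
  also have "\<dots> = ?K * (n * (2 * n + 1) + (n + 1) * (n * (n + 3) + 1) + 2)"
    by (simp add: algebra_simps)
  \<comment> \<open>The bracket has degree 3 and is at most \<open>2 * m ^ 3\<close>; the factor 2
    is absorbed by \<open>m ^ 2\<close>.\<close>
  also have "\<dots> \<le> ?K * (n + 2) ^ 5"
  proof (rule mult_left_mono)
    define m where "m = n + 2"
    have "n * (2 * n + 1) + 2 \<le> 2 * m ^ 2" "n * (n + 3) + 1 \<le> m ^ 2" "n + 1 \<le> m"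
      by (simp_all add: m_def power2_eq_square algebra_simps)
    moreover from this(2,3) have "(n + 1) * (n * (n + 3) + 1) \<le> m * m ^ 2" by (intro mult_mono) auto
    moreover have "2 * m ^ 2 \<le> m * m ^ 2" by (rule mult_right_mono) (auto simp: m_def)
    ultimately have "n * (2 * n + 1) + (n + 1) * (n * (n + 3) + 1) + 2 \<le> m * m ^ 2 + m * m ^ 2"
      by linarith
    also have "\<dots> = 2 * m ^ 3" by (simp add: power3_eq_cube power2_eq_square)
    also have "\<dots> \<le> m ^ 2 * m ^ 3"
      by (rule mult_right_mono) (auto simp: m_def power2_eq_square)
    also have "\<dots> = m ^ 5" by (simp flip: power_add)
    finally show "n * (2 * n + 1) + (n + 1) * (n * (n + 3) + 1) + 2 \<le> (n + 2) ^ 5"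
      by (simp only: m_def)
  qed simp
  finally show ?thesis .
qed

lemma card_canonical_le: "card canonical \<le> 2 ^ (6 * vertex_cover_number {..<n} E)"
proof -
  have "card canonical \<le> 2 ^ (3 * card (set (greedy_cover G)))"
    by (rule card_canonical[OF greedy_cover_lt greedy_cover_edge])
  also have "\<dots> \<le> 2 ^ (6 * vertex_cover_number {..<n} E)"
    using greedy_cover_length distinct_card[OF greedy_cover_distinct]
    by (intro power_increasing) auto
  finally show ?thesis .
qed

lemma card_minimal:
  "card (minimal_matching_cuts {..<n} E) \<le> 2 ^ (6 * vertex_cover_number {..<n} E) + n ^ 2"
proof -
  have fin: "finite canonical" unfolding set_canonical_list[symmetric] by simp
  have "card (minimal_matching_cuts {..<n} E) \<le> card (canonical \<union> (\<lambda>e. {e}) ` E)"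
    by (rule card_mono[OF _ minimal_subset]) (simp add: fin finite_E)
  also have "\<dots> \<le> card canonical + card ((\<lambda>e. {e}) ` E)" by (rule card_Un_le)
  also have "card ((\<lambda>e. {e}) ` E) \<le> card E" by (rule card_image_le[OF finite_E])
  also note card_E
  also note card_canonical_le
  finally show ?thesis by simp
qed

end

section \<open>From explicit bounds to the asymptotic statement\<close>

lemma fpt_enumerableI:
  assumes "\<And>n E. simple_graph {..<n} E \<Longrightarrow> \<exists>tr. enumeration_trace p n E (\<P> {..<n} E) tr \<and>
      cost tr \<le> (2 ^ (6 * vertex_cover_number {..<n} E) * (n + 2) ^ 5) ^ c"
  shows "fpt_enumerable cost \<P>"
proof -
  \<comment> \<open>For \<open>n \<ge> 1\<close>, \<open>n + 2 \<le> 4 * n\<close> gives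
    \<open>(n + 2) ^ 5 \<le> 2 ^ 10 * n ^ 5\<close>, whence the \<open>10 * c\<close>. This constant
    term is linear in \<open>k\<close> from \<open>k = 1\<close> on, as the Landau symbol
    requires.\<close>
  define f :: "nat \<Rightarrow> real" where "f k = real (6 * c) * real k + real (10 * c)" for k
  define g :: "nat \<Rightarrow> real" where "g n = real (5 * c)" for n
  have f: "f \<in> O(\<lambda>k. real k)"
  proof (rule bigoI)
    show "\<forall>\<^sub>F k in at_top. norm (f k) \<le> real (16 * c) * norm (real k)"
      using eventually_ge_at_top[of 1]
    proof eventually_elim
      case (elim k)
      then have "real (10 * c) * 1 \<le> real (10 * c) * real k" by (intro mult_left_mono) auto
      then show ?case unfolding f_def by (simp add: algebra_simps)
    qed
  qed
  have g: "g \<in> O(\<lambda>_. 1)" unfolding g_def by simp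
  have bound: "real ((2 ^ (6 * k) * (n + 2) ^ 5) ^ c) \<le> 2 powr f k * real n powr g n" if "n \<ge> 1" for k n
  proof -
    have "real (n + 2) \<le> 4 * real n" using that by simp
    then have "real ((2 ^ (6 * k) * (n + 2) ^ 5) ^ c) \<le> (2 ^ (6 * k) * (4 * real n) ^ 5) ^ c"
      unfolding of_nat_power of_nat_mult by (intro power_mono mult_mono) auto
    also have "\<dots> = 2 ^ (6 * c * k + 10 * c) * real n ^ (5 * c)"
    proof -
      have "(4 * real n) ^ 5 = 2 ^ 10 * real n ^ 5" by (simp add: power_mult_distrib)
      then show ?thesis
        by (simp only: power_mult_distrib power_mult[symmetric] power_add mult_ac)
    qed
    also have "\<dots> = 2 powr f k * real n powr g n"
      using that unfolding f_def g_def
      by (simp flip: powr_realpow add: algebra_simps)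
    finally show ?thesis .
  qed
  show ?thesis
    unfolding fpt_enumerable_def
  proof (intro exI[of _ p] bexI[OF _ f] bexI[OF _ g] allI impI)
    fix n :: nat and E assume "simple_graph {..<n} E"
    from assms[OF this] obtain tr where tr: "enumeration_trace p n E (\<P> {..<n} E) tr"
      "cost tr \<le> (2 ^ (6 * vertex_cover_number {..<n} E) * (n + 2) ^ 5) ^ c" by blast
    have "real (cost tr) \<le> 2 powr f (vertex_cover_number {..<n} E) * real n powr g n" if "n \<ge> 1"
      using tr(2) bound[OF that, of "vertex_cover_number {..<n} E"] by (meson of_nat_mono order_trans)
    then show "\<exists>tr. enumeration_trace p n E (\<P> {..<n} E) tr \<and> (n \<ge> 1 \<longrightarrow>
        real (cost tr) \<le> 2 powr f (vertex_cover_number {..<n} E) * real n powr g n)"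
      using tr(1) by blast
  qed
qed

text \<open>The three problems differ only in which canonical cuts are selected for expansion. The
  number of outputs is recorded because it turns delay into total time for the minimal cuts.\<close>

lemma enumeration_traces:
  assumes FP: "FP (\<lambda>z. sel (fst z) (snd z))"
    and sel: "\<And>n E. simple_graph {..<n} E \<Longrightarrow>
      sel (mat n E) (map (mat n) (graph.canonical_list n E)) = map (mat n) (filter (Q n E) (graph.canonical_list n E))"
    and lifts: "\<And>n E. simple_graph {..<n} E \<Longrightarrow>
      \<P> {..<n} E = \<Union> (graph.lifts E ` {M \<in> graph.canonical n E. Q n E M})"
  shows "\<exists>p c. \<forall>n E. simple_graph {..<n} E \<longrightarrow> (\<exists>tr. enumeration_trace p n E (\<P> {..<n} E) tr \<and>
    length (outputs tr) = card (\<P> {..<n} E) \<and>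
    delay tr \<le> (2 ^ (6 * vertex_cover_number {..<n} E) * (n + 2) ^ 5) ^ c)"
proof -
  obtain p c where p: "\<And>G. \<exists>tr. run p (enc G) tr \<and> outputs tr = map enc (enumeration sel G) \<and>
      delay tr \<le> (search_bound G + 2) ^ c"
    using enumeration_program[OF FP] by blast
  show ?thesis
  proof (intro exI[of _ p] exI[of _ c] allI impI)
    fix n :: nat and E assume sg: "simple_graph {..<n} E"
    then interpret graph n E by unfold_locales
    obtain tr where tr: "run p (enc G) tr" "outputs tr = map enc (enumeration sel G)"
      "delay tr \<le> (search_bound G + 2) ^ c" using p by blast
    obtain Ms where Ms: "distinct Ms" "set Ms = \<P> {..<n} E" "enumeration sel G = map (mat n) Ms"
      using enumeration_correct[of sel "Q n E", OF sel[OF sg]] lifts[OF sg] by auto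
    have out: "outputs tr = map (encode_edges n) Ms" unfolding tr(2) Ms(3) by (simp add: encode_edges_eq)
    then have "length (outputs tr) = card (\<P> {..<n} E)" using distinct_card[OF Ms(1)] Ms(2) by simp
    moreover have "enumeration_trace p n E (\<P> {..<n} E) tr"
      unfolding enumeration_trace_def using tr(1) out Ms(1,2) by (auto simp: encode_edges_eq)
    moreover have "(search_bound G + 2) ^ c \<le> (2 ^ (6 * vertex_cover_number {..<n} E) * (n + 2) ^ 5) ^ c"
      by (rule power_mono[OF search_bound_le]) simp
    ultimately show "\<exists>tr. enumeration_trace p n E (\<P> {..<n} E) tr \<and>
        length (outputs tr) = card (\<P> {..<n} E) \<and>
        delay tr \<le> (2 ^ (6 * vertex_cover_number {..<n} E) * (n + 2) ^ 5) ^ c"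
      using tr(3) le_trans by blast
  qed
qed

theorem theorem16:
  "fpt_enumerable total_time minimal_matching_cuts \<and>
   fpt_enumerable delay matching_cuts \<and>
   fpt_enumerable delay maximal_matching_cuts"
proof (intro conjI)
  have "\<exists>p c. \<forall>n E. simple_graph {..<n} E \<longrightarrow> (\<exists>tr. enumeration_trace p n E (minimal_matching_cuts {..<n} E) tr \<and>
    length (outputs tr) = card (minimal_matching_cuts {..<n} E) \<and>
    delay tr \<le> (2 ^ (6 * vertex_cover_number {..<n} E) * (n + 2) ^ 5) ^ c)"
    by (rule enumeration_traces[OF FP_minimal_cuts graph.minimal_cuts_eq[OF graph.intro] graph.minimal_lifts[OF graph.intro]])
  then obtain p c where p: "\<And>n E. simple_graph {..<n} E \<Longrightarrow> \<exists>tr. enumeration_trace p n E (minimal_matching_cuts {..<n} E) tr \<and>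
    length (outputs tr) = card (minimal_matching_cuts {..<n} E) \<and>
    delay tr \<le> (2 ^ (6 * vertex_cover_number {..<n} E) * (n + 2) ^ 5) ^ c" by blast
  show "fpt_enumerable total_time minimal_matching_cuts"
  \<comment> \<open>The number of gaps is itself at most \<open>2 ^ (6 * k) * (n + 2) ^ 5\<close>
    with \<open>k\<close> the vertex cover number. Multiplying the delay by it raises the exponent
    to \<open>c + 1\<close>.\<close>
  proof (rule fpt_enumerableI[where p = p and c = "c + 1"])
    fix n :: nat and E assume sg: "simple_graph {..<n} E"
    then interpret graph n E by unfold_locales
    let ?K = "2 ^ (6 * vertex_cover_number {..<n} E) :: nat"
    obtain tr where tr: "enumeration_trace p n E (minimal_matching_cuts {..<n} E) tr"
      "length (outputs tr) = card (minimal_matching_cuts {..<n} E)"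
      "delay tr \<le> (?K * (n + 2) ^ 5) ^ c" using p[OF sg] by blast
    have "length (outputs tr) + 1 \<le> ?K + n ^ 2 + 1" using tr(2) card_minimal by simp
    also have "\<dots> \<le> ?K + ?K * n ^ 2 + ?K" by (intro add_mono) auto
    also have "\<dots> = ?K * (n ^ 2 + 2)" by (simp add: algebra_simps)
    also have "\<dots> \<le> ?K * (n + 2) ^ 5"
    proof (rule mult_left_mono)
      have "n ^ 2 + 2 \<le> (n + 2) ^ 2" by (simp add: power2_eq_square algebra_simps)
      also have "\<dots> \<le> (n + 2) ^ 5" by (rule power_increasing) auto
      finally show "n ^ 2 + 2 \<le> (n + 2) ^ 5" .
    qed simp
    finally have "(length (outputs tr) + 1) * delay tr \<le> ?K * (n + 2) ^ 5 * (?K * (n + 2) ^ 5) ^ c"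
      using tr(3) by (rule mult_mono) auto
    then have "total_time tr \<le> (?K * (n + 2) ^ 5) ^ (c + 1)"
      using total_time_le_delay[of tr] by simp
    then show "\<exists>tr. enumeration_trace p n E (minimal_matching_cuts {..<n} E) tr \<and>
        total_time tr \<le> (?K * (n + 2) ^ 5) ^ (c + 1)" using tr(1) by blast
  qed
next
  have "\<exists>p c. \<forall>n E. simple_graph {..<n} E \<longrightarrow> (\<exists>tr. enumeration_trace p n E (matching_cuts {..<n} E) tr \<and>
    length (outputs tr) = card (matching_cuts {..<n} E) \<and>
    delay tr \<le> (2 ^ (6 * vertex_cover_number {..<n} E) * (n + 2) ^ 5) ^ c)"
  proof (rule enumeration_traces[where sel = "\<lambda>_ Ms. Ms" and Q = "\<lambda>_ _ _. True"])
    show "FP (\<lambda>z :: matrix \<times> matrix list. snd z)" by (intro FP_intros)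
    show "matching_cuts {..<n} E = \<Union> (graph.lifts E ` {M \<in> graph.canonical n E. True})"
      if "simple_graph {..<n} E" for n E
      using graph.matching_cuts_lifts[OF graph.intro[OF that]] by simp
  qed simp
  then show "fpt_enumerable delay matching_cuts" by (elim exE, intro fpt_enumerableI) blast
next
  have "\<exists>p c. \<forall>n E. simple_graph {..<n} E \<longrightarrow> (\<exists>tr. enumeration_trace p n E (maximal_matching_cuts {..<n} E) tr \<and>
    length (outputs tr) = card (maximal_matching_cuts {..<n} E) \<and>
    delay tr \<le> (2 ^ (6 * vertex_cover_number {..<n} E) * (n + 2) ^ 5) ^ c)"
    by (rule enumeration_traces[OF FP_maximal_cuts graph.maximal_cuts_eq[OF graph.intro] graph.maximal_lifts[OF graph.intro]])
  then show "fpt_enumerable delay maximal_matching_cuts" by (elim exE, intro fpt_enumerableI) blast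
qed

end
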